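(* Let $n\ge 1$ and $m\geq 2$ be integers and let $p\ge 1$ be a real number. Let $X$ denote either $A^m_p(\mathbb{R}^n)$ or $W^m_p(\mathbb{R}^n)$. Let $f:\mathbb{R}\to\mathbb{R}$ be a function such that the composition operator $N_f: g\mapsto f\circ g$ sends $X$ to itself. Let $\alpha\in\mathbb{N}^n$ be such that $0<|\alpha|\le m$. Then, for all $g\in X$, the formula $$(f\circ g)^{(\alpha)}=\sum_{s=1}^{|\alpha|}\ \sum_{\substack{\gamma=(\gamma_1,\dots,\gamma_s)\\ \gamma_r\in\mathbb{N}^n\setminus\{0\},\ \gamma_1+\cdots+\gamma_s=\alpha}} c_{\alpha,s,\gamma}\,(f^{(s)}\circ g)\,g^{(\gamma_1)}\cdots g^{(\gamma_s)}$$ holds in the sense of distributions on $\mathbb{R}^n$ and almost everywhere.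
   Context: $\mathbb{N}$ includes $0$; all functions are real valued; for $\alpha\in\mathbb{N}^n$, $|\alpha|=\alpha_1+\dots+\alpha_n$ and $g^{(\alpha)}$ is the partial derivative of order $\alpha$ (in the sense of distributions when $g$ is not smooth). Measurable functions on $\mathbb{R}^n$ equal a.e. are identified into classes. $W^m_p(\mathbb{R}^n)$ is the usual Sobolev space of distributions $g$ with $g^{(\alpha)}\in L_p(\mathbb{R}^n)$ for all $|\alpha|\le m$; $\dot W^1_{mp}(\mathbb{R}^n)$ is the space of distributions whose first order partial derivatives all belong to $L_{mp}(\mathbb{R}^n)$. The inhomogeneous Adams-Frazier space is $A^m_p(\mathbb{R}^n)=W^m_p(\mathbb{R}^n)\cap\dot W^1_{mp}(\mathbb{R}^n)$. "$N_f$ sends $X$ to itself" means that for each $g\in X$ the class of $f\circ g$ belongs to $X$. Meaning of the right-hand side. It is known that any $f$ satisfying the hypothesis is of class $C^{m-1}$ with $f^{(m-1)}$ locally absolutely continuous. For $s<m$, $f^{(s)}$ is this continuous derivative, and $(f^{(s)}\circ g)\,g^{(\gamma_1)}\cdots g^{(\gamma_s)}$ is the class of the pointwise product formed from any representatives of $g, g^{(\gamma_1)},\dots,g^{(\gamma_s)}$. For $s=m$, $f^{(m)}$ is only a class of locally integrable functions on $\mathbb{R}$; the product $(f^{(m)}\circ g)\,g^{(\gamma_1)}\cdots g^{(\gamma_m)}$ is the class of $x\mapsto u(v(x))\,w_1(x)\cdots w_m(x)$, where $u,v,w_r$ are arbitrary representatives of $f^{(m)},g,g^{(\gamma_r)}$,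 and the formula is understood to include that this class does not depend on the representatives (in particular not on $u$). The numbers $c_{\alpha,s,\gamma}$ are the combinatorial constants of the classical Faà di Bruno formula, i.e. those for which the displayed formula holds for all smooth $f:\mathbb{R}\to\mathbb{R}$, $g:\mathbb{R}^n\to\mathbb{R}$; with the sum over ordered tuples one may take $c_{\alpha,s,\gamma}=\frac{\alpha!}{s!\,\gamma_1!\cdots\gamma_s!}$. *)

theory Defs
  imports "HOL-Analysis.Analysis" "HOL-Library.Multiset"
begin

text \<open>
  Classes of functions modulo equality almost everywhere are handled through representatives,
  which are measurable for the completed Lebesgue measure; so any function equal almost
  everywhere to a representative is again a representative.  All distributions that occur are
  regular, i.e. given by locally integrable functions.
\<close>

definition locally_integrable :: "('a::euclidean_space \<Rightarrow> real) \<Rightarrow> bool" where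
  "locally_integrable g \<longleftrightarrow> (\<forall>K. compact K \<longrightarrow> set_integrable lebesgue K g)"

definition dir_deriv :: "'a::euclidean_space \<Rightarrow> ('a \<Rightarrow> real) \<Rightarrow> ('a \<Rightarrow> real)" where
  "dir_deriv b \<phi> = (\<lambda>x. frechet_derivative \<phi> (at x) b)"

definition iter_deriv :: "'a::euclidean_space list \<Rightarrow> ('a \<Rightarrow> real) \<Rightarrow> ('a \<Rightarrow> real)" where
  "iter_deriv bs \<phi> = foldr dir_deriv bs \<phi>"

definition smooth :: "('a::euclidean_space \<Rightarrow> real) \<Rightarrow> bool" where
  "smooth \<phi> \<longleftrightarrow> (\<forall>bs. set bs \<subseteq> Basis \<longrightarrow> (\<forall>x. iter_deriv bs \<phi> differentiable (at x)))"

definition test_function :: "('a::euclidean_space \<Rightarrow> real) \<Rightarrow> bool" where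
  "test_function \<phi> \<longleftrightarrow> smooth \<phi> \<and> compact (closure {x. \<phi> x \<noteq> 0})"

text \<open>For a list \<open>bs\<close> of basis vectors: \<open>h\<close> represents the iterated distributional partial
  derivative of \<open>g\<close> in the directions \<open>bs\<close>.\<close>

definition distr_deriv ::
    "'a::euclidean_space list \<Rightarrow> ('a \<Rightarrow> real) \<Rightarrow> ('a \<Rightarrow> real) \<Rightarrow> bool" where
  "distr_deriv bs g h \<longleftrightarrow>
     locally_integrable g \<and> locally_integrable h \<and>
     (\<forall>\<phi>. test_function \<phi> \<longrightarrow>
        integral\<^sup>L lebesgue (\<lambda>x. g x * iter_deriv bs \<phi> x) =
        (-1) ^ length bs * integral\<^sup>L lebesgue (\<lambda>x. h x * \<phi> x))"

type_synonym 'n multi_index = "nat ^ 'n"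

definition mi_abs :: "'n::finite multi_index \<Rightarrow> nat" where
  "mi_abs \<alpha> = (\<Sum>i\<in>UNIV. \<alpha> $ i)"

definition mi_fact :: "'n::finite multi_index \<Rightarrow> real" where
  "mi_fact \<alpha> = (\<Prod>i\<in>UNIV. fact (\<alpha> $ i))"

text \<open>Some sequence of coordinates in which each \<open>i\<close> occurs \<open>\<alpha> $ i\<close> times; the order is immaterial
  since it is only used to differentiate smooth functions.\<close>

definition mi_list :: "'n::finite multi_index \<Rightarrow> 'n list" where
  "mi_list \<alpha> = (SOME is. \<forall>i. count_list is i = \<alpha> $ i)"

lemma count_mi_list: "count_list (mi_list \<alpha>) i = \<alpha> $ i"
proof -
  obtain xs where xs: "mset xs = (\<Sum>j\<in>UNIV. replicate_mset (\<alpha> $ j) j)"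
    using ex_mset by blast
  have "count_list xs k = \<alpha> $ k" for k
  proof -
    have "count_list xs k = count (mset xs) k"
      by (simp add: count_mset)
    also have "\<dots> = (\<Sum>j\<in>UNIV. if j = k then \<alpha> $ j else 0)"
      by (simp add: xs count_sum)
    finally show ?thesis by simp
  qed
  then have "\<exists>is. \<forall>i. count_list is i = \<alpha> $ i" by blast
  from someI_ex[OF this] show ?thesis by (simp add: mi_list_def)
qed

text \<open>\<open>h\<close> represents \<open>g\<^sup>(\<^sup>\<alpha>\<^sup>)\<close>, the distributional derivative of order \<open>\<alpha>\<close>.\<close>

definition weak_deriv ::
    "'n::finite multi_index \<Rightarrow> (real^'n \<Rightarrow> real) \<Rightarrow> (real^'n \<Rightarrow> real) \<Rightarrow> bool" where
  "weak_deriv \<alpha> g h \<longleftrightarrow> distr_deriv (map (\<lambda>i. axis i 1) (mi_list \<alpha>)) g h"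

definition in_Lp :: "real \<Rightarrow> ('a::euclidean_space \<Rightarrow> real) \<Rightarrow> bool" where
  "in_Lp p h \<longleftrightarrow> h \<in> borel_measurable lebesgue \<and> integrable lebesgue (\<lambda>x. \<bar>h x\<bar> powr p)"

definition sobolev :: "nat \<Rightarrow> real \<Rightarrow> (real^'n::finite \<Rightarrow> real) set" where
  "sobolev m p = {g. \<forall>\<beta>. mi_abs \<beta> \<le> m \<longrightarrow> (\<exists>h. weak_deriv \<beta> g h \<and> in_Lp p h)}"

definition homogeneous_sobolev1 :: "real \<Rightarrow> (real^'n::finite \<Rightarrow> real) set" where
  "homogeneous_sobolev1 q = {g. \<forall>\<beta>. mi_abs \<beta> = 1 \<longrightarrow> (\<exists>h. weak_deriv \<beta> g h \<and> in_Lp q h)}"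

definition adams_frazier :: "nat \<Rightarrow> real \<Rightarrow> (real^'n::finite \<Rightarrow> real) set" where
  "adams_frazier m p = sobolev m p \<inter> homogeneous_sobolev1 (real m * p)"

definition class_C :: "nat \<Rightarrow> (real \<Rightarrow> real) \<Rightarrow> bool" where
  "class_C k f \<longleftrightarrow>
     (\<forall>s<k. \<forall>t. (deriv ^^ s) f field_differentiable (at t)) \<and>
     continuous_on UNIV ((deriv ^^ k) f)"

text \<open>The functions that may stand for the \<open>s\<close>-th derivative of \<open>f\<close>, for \<open>s \<le> m\<close>: the classical
  derivative if \<open>s < m\<close>, any representative of the distributional one if \<open>s = m\<close>.\<close>

definition deriv_rep :: "nat \<Rightarrow> (real \<Rightarrow> real) \<Rightarrow> nat \<Rightarrow> (real \<Rightarrow> real) \<Rightarrow> bool" where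
  "deriv_rep m f s u \<longleftrightarrow>
     (if s < m then u = (deriv ^^ s) f else distr_deriv (replicate s 1) f u)"

definition mi_tuples :: "'n::finite multi_index \<Rightarrow> nat \<Rightarrow> 'n multi_index list set" where
  "mi_tuples \<alpha> s = {\<gamma>. length \<gamma> = s \<and> 0 \<notin> set \<gamma> \<and> sum_list \<gamma> = \<alpha>}"

lemma finite_mi_tuples: "finite (mi_tuples \<alpha> s)"
proof -
  let ?B = "{\<beta>. \<forall>i. \<beta> $ i \<le> \<alpha> $ i}"
  have "?B \<subseteq> vec_lambda ` (\<Pi>\<^sub>E i\<in>UNIV. {..\<alpha> $ i})"
  proof
    fix \<beta> assume "\<beta> \<in> ?B"
    then have "vec_nth \<beta> \<in> (\<Pi>\<^sub>E i\<in>UNIV. {..\<alpha> $ i})" by (auto simp: PiE_def Pi_def)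
    then show "\<beta> \<in> vec_lambda ` (\<Pi>\<^sub>E i\<in>UNIV. {..\<alpha> $ i})"
      by (metis image_eqI vec_nth_inverse)
  qed
  then have B: "finite ?B" by (rule finite_subset) (auto intro!: finite_PiE)
  have le: "\<beta> $ i \<le> sum_list \<gamma> $ i" if "\<beta> \<in> set \<gamma>"
    for \<beta> :: "'a multi_index" and \<gamma> i
    using that by (induction \<gamma>) (auto intro: trans_le_add2)
  have "mi_tuples \<alpha> s \<subseteq> {\<gamma>. set \<gamma> \<subseteq> ?B \<and> length \<gamma> = s}"
    using le by (auto simp: mi_tuples_def)
  then show ?thesis
    using finite_lists_length_eq[OF B] finite_subset by blast
qed

text \<open>The classical constants when the sum runs over ordered tuples.\<close>

definition fdb_coeff :: "'n::finite multi_index \<Rightarrow> nat \<Rightarrow> 'n multi_index list \<Rightarrow> real" where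
  "fdb_coeff \<alpha> s \<gamma> = mi_fact \<alpha> / (fact s * (\<Prod>r<s. mi_fact (\<gamma> ! r)))"

text \<open>All functions obtained, up to equality almost everywhere, as pointwise products
  \<open>u (v x) * w 0 x * \<dots> * w (s - 1) x\<close> of representatives of the \<open>s\<close>-th derivative of \<open>f\<close>, of \<open>g\<close>,
  and of its derivatives of orders \<open>\<gamma> ! 0, \<dots>, \<gamma> ! (s - 1)\<close>, where \<open>s = length \<gamma>\<close>.\<close>

definition fdb_product ::
    "nat \<Rightarrow> (real \<Rightarrow> real) \<Rightarrow> (real^'n::finite \<Rightarrow> real) \<Rightarrow> 'n multi_index list
      \<Rightarrow> (real^'n \<Rightarrow> real) set" where
  "fdb_product m f g \<gamma> =
     {P. \<exists>u v w. deriv_rep m f (length \<gamma>) u \<and>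
           (AE x in lebesgue. v x = g x) \<and>
           (\<forall>r<length \<gamma>. weak_deriv (\<gamma> ! r) g (w r)) \<and>
           (AE x in lebesgue. P x = u (v x) * (\<Prod>r<length \<gamma>. w r x))}"

end

theory Submission
  imports Defs
begin

text \<open>
  Since \<open>f \<circ> g\<close> belongs to \<open>X\<close>, all its weak derivatives up to order \<open>m\<close> exist as functions, and only their values
  almost everywhere have to be identified.  This is done on lines: for almost every line parallel to
  a coordinate axis, weak derivatives of order less than \<open>m\<close> agree almost everywhere with indefinite integrals of
  the next ones.  On such a line the formula of order \<open>\<alpha>\<close> is an identity between continuous functions, and its
  derivative at almost every point is the formula of the next order.  The only delicate term is
  \<open>(f\<^sup>(\<^sup>m\<^sup>-\<^sup>1\<^sup>) \<circ> g) Q\<close>, as \<open>f\<^sup>(\<^sup>m\<^sup>-\<^sup>1\<^sup>) \<circ> g\<close> need not be absolutely continuous; but the identity exhibits this term as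
  a difference of functions differentiable almost everywhere, and then the Serrin-Varberg
  argument applies: a function whose values on \<open>E\<close> form a null set has derivative zero almost everywhere on \<open>E\<close>.
  The same fact makes the terms with \<open>f\<^sup>(\<^sup>m\<^sup>)\<close> independent of representatives.

  The regularity of \<open>f\<close> results from testing with \<open>g\<close> that depends, near the origin, on one coordinate
  only: linearly, to see \<open>f\<close> up to a null set, and through a smooth function that is constant on a half space, to
  exclude exceptional points.
\<close>

section \<open>Functions of one real variable\<close>

text \<open>The obstacle is that \<open>f^(m)\<close> is merely locally integrable. On a line,
  \<open>f^(m-1) \<circ> g\<close> is a composition of two indefinite integrals, which can fail to
  be an indefinite integral; so no chain rule can be quoted for the top term, nor are the products
  on the right known in advance to be integrable. That the whole left side is an indefinite integral
  compensates for this: as all other terms are differentiable almost everywhere, the top term must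
  be so too. Both spaces are handled at once. The argument takes from \<open>X\<close> that it
  contains the test functions, which supply the probes for \<open>f\<close>, and that it lies in
  \<open>sobolev m p\<close>, which supplies locally integrable derivatives of \<open>g\<close> and
  of \<open>f \<circ> g\<close>. Indefinite integrals are understood in the gauge sense, because
  Henstock's lemma then gives both properties that matter: differentiability almost everywhere and
  null images of null sets.\<close>

lemma AE_lebesgue_iff_negligible: "(AE x in lebesgue. P x) \<longleftrightarrow> negligible {x. \<not> P x}"
  by (auto simp: completion.AE_iff_null_sets negligible_iff_null_sets null_sets_completion_subset)

text \<open>The integral is the gauge integral, so \<open>F\<close> may be any Henstock-Kurzweil
  primitive. The property takes the place of local absolute continuity and survives changes of
  \<open>u\<close> on null sets.\<close>

definition primitive :: "(real \<Rightarrow> real) \<Rightarrow> (real \<Rightarrow> real) \<Rightarrow> bool" where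
  "primitive F u \<longleftrightarrow> (\<forall>a b. a \<le> b \<longrightarrow> (u has_integral F b - F a) {a..b})"

lemma primitiveD: "primitive F u \<Longrightarrow> a \<le> b \<Longrightarrow> (u has_integral F b - F a) {a..b}"
  by (simp add: primitive_def)

text \<open>Henstock's lemma for intervals tagged at an endpoint: the segment from the tag
  \<open>x i\<close> to \<open>y i\<close> may point in either direction, and its integral is an
  increment of \<open>F\<close>. The index type is left open because the covers below are indexed by
  points in one case and by intervals in the other.\<close>

lemma Henstock_segments:
  fixes F u :: "real \<Rightarrow> real"
  assumes prim: "primitive F u" and "\<epsilon> > 0"
  shows "\<exists>\<delta>. (\<forall>x. \<delta> x > 0) \<and>
    (\<forall>(I :: 'i set) x y. finite I \<longrightarrow>
        (\<forall>i\<in>I. x i \<in> {a..b} \<and> y i \<in> {a..b} \<and> x i \<noteq> y i \<and> \<bar>y i - x i\<bar> < \<delta> (x i)) \<longrightarrow>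
        (\<forall>i\<in>I. \<forall>j\<in>I. i \<noteq> j \<longrightarrow>
            open_segment (x i) (y i) \<inter> open_segment (x j) (y j) = {}) \<longrightarrow>
        (\<Sum>i\<in>I. \<bar>F (y i) - F (x i) - u (x i) * (y i - x i)\<bar>) < \<epsilon>)"
proof (cases "a \<le> b")
  case False
  have "(\<Sum>i\<in>I. \<bar>F (y i) - F (x i) - u (x i) * (y i - x i)\<bar>) < \<epsilon>"
    if "\<forall>i\<in>I. x i \<in> {a..b} \<and> y i \<in> {a..b} \<and> x i \<noteq> y i \<and> \<bar>y i - x i\<bar> < 1" for I :: "'i set" and x y
  proof -
    have "I = {}" using False that by fastforce
    then show ?thesis using \<open>\<epsilon> > 0\<close> by simp
  qed
  then show ?thesis
    by (intro exI[of _ "\<lambda>_. 1"]) auto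
next
  case ab: True
  have int: "u integrable_on cbox a b"
    using primitiveD[OF prim ab] by (auto simp: integrable_on_def)
  show ?thesis
  proof (rule Henstock_lemma[OF int \<open>\<epsilon> > 0\<close>])
    fix \<gamma> assume \<gamma>: "gauge \<gamma>"
      and fine: "\<And>p. \<lbrakk>p tagged_partial_division_of cbox a b; \<gamma> fine p\<rbrakk> \<Longrightarrow>
               (\<Sum>(x,k)\<in>p. norm(measure lborel k *\<^sub>R u x - integral k u)) < \<epsilon>"
    have "\<exists>d>0. ball x d \<subseteq> \<gamma> x" for x
      using \<gamma> by (auto simp: gauge_def open_contains_ball)
    then obtain \<delta> where \<delta>: "\<And>x. \<delta> x > 0" "\<And>x. ball x (\<delta> x) \<subseteq> \<gamma> x"
      by metis
    show ?thesis
    proof (intro exI[of _ \<delta>] conjI allI impI \<delta>(1))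
      fix I :: "'i set" and x y
      assume I: "finite I"
        and xyI: "\<forall>i\<in>I. x i \<in> {a..b} \<and> y i \<in> {a..b} \<and> x i \<noteq> y i \<and> \<bar>y i - x i\<bar> < \<delta> (x i)"
        and disj: "\<forall>i\<in>I. \<forall>j\<in>I. i \<noteq> j \<longrightarrow>
              open_segment (x i) (y i) \<inter> open_segment (x j) (y j) = {}"
      note xy = bspec[OF xyI]
      let ?K = "\<lambda>i. closed_segment (x i) (y i)"
      let ?q = "\<lambda>i. (x i, ?K i)"
      have K: "?K i = cbox (min (x i) (y i)) (max (x i) (y i))" for i
        by (auto simp: closed_segment_eq_real_ivl)
      have intK: "interior (?K i) = open_segment (x i) (y i)" for i
        by (auto simp: closed_segment_eq_real_ivl open_segment_eq_real_ivl)
      have inj: "inj_on ?q I"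
      proof (rule inj_onI, rule ccontr)
        fix i j assume ij: "i \<in> I" "j \<in> I" "?q i = ?q j" "i \<noteq> j"
        then have "open_segment (x i) (y i) = {}"
          using ij disj intK[of i] intK[of j] by (metis Int_absorb Pair_inject)
        then show False using xy[OF ij(1)] by (auto simp: open_segment_eq_real_ivl split: if_splits)
      qed
      have div: "?q ` I tagged_partial_division_of cbox a b"
        unfolding tagged_partial_division_of_def
      proof (intro conjI allI impI)
        fix z L assume "(z, L) \<in> ?q ` I"
        then obtain i where i: "i \<in> I" "z = x i" "L = ?K i" by auto
        show "z \<in> L" using i by auto
        show "L \<subseteq> cbox a b" using xy[OF i(1)] i by (auto simp: closed_segment_eq_real_ivl split: if_splits)
        show "\<exists>c d. L = cbox c d" using i K by auto
      next
        fix z L z' L' assume "(z, L) \<in> ?q ` I \<and> (z', L') \<in> ?q ` I \<and> (z, L) \<noteq> (z', L')"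
        then obtain i j where "i \<in> I" "L = ?K i" "j \<in> I" "L' = ?K j" "i \<noteq> j" by auto
        then show "interior L \<inter> interior L' = {}" using disj intK by auto
      qed (use I in auto)
      have fin: "\<gamma> fine ?q ` I"
      proof (rule fineI)
        fix z L assume "(z, L) \<in> ?q ` I"
        then obtain i where i: "i \<in> I" "z = x i" "L = ?K i" by auto
        have "L \<subseteq> ball z (\<delta> z)"
          using xy[OF i(1)] i by (auto simp: closed_segment_eq_real_ivl dist_real_def split: if_splits)
        then show "L \<subseteq> \<gamma> z" using \<delta>(2) by blast
      qed
      have "(\<Sum>i\<in>I. \<bar>F (y i) - F (x i) - u (x i) * (y i - x i)\<bar>) =
            (\<Sum>i\<in>I. norm (measure lborel (?K i) *\<^sub>R u (x i) - integral (?K i) u))"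
      proof (rule sum.cong[OF refl])
        fix i assume "i \<in> I"
        show "\<bar>F (y i) - F (x i) - u (x i) * (y i - x i)\<bar> =
            norm (measure lborel (?K i) *\<^sub>R u (x i) - integral (?K i) u)"
        proof (cases "x i \<le> y i")
          case True
          then have "integral (?K i) u = F (y i) - F (x i)"
            using primitiveD[OF prim True] by (simp add: closed_segment_eq_real_ivl integral_unique)
          then show ?thesis using True by (simp add: closed_segment_eq_real_ivl abs_minus_commute algebra_simps)
        next
          case False
          then have "y i \<le> x i" by simp
          from primitiveD[OF prim this] have "integral (?K i) u = F (x i) - F (y i)"
            using False by (simp add: closed_segment_eq_real_ivl integral_unique)
          then show ?thesis using False by (simp add: closed_segment_eq_real_ivl algebra_simps)
        qed
      qed
      also have "\<dots> = (\<Sum>(x,k)\<in>?q ` I. norm(measure lborel k *\<^sub>R u x - integral k u))"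
        by (subst sum.reindex[OF inj]) simp
      also have "\<dots> < \<epsilon>" by (rule fine[OF div fin])
      finally show "(\<Sum>i\<in>I. \<bar>F (y i) - F (x i) - u (x i) * (y i - x i)\<bar>) < \<epsilon>" .
    qed
  qed
qed

lemma primitive_continuous:
  assumes "primitive F u" shows "continuous_on UNIV F"
proof -
  have "isCont F x" for x
  proof -
    have int: "u integrable_on {x-1..x+1}"
      using primitiveD[OF assms, of "x-1" "x+1"] by (auto simp: integrable_on_def)
    have "continuous_on {x-1..x+1} (\<lambda>t. F (x-1) + integral {x-1..t} u)"
      by (intro continuous_intros indefinite_integral_continuous_1 int)
    moreover have "F (x-1) + integral {x-1..t} u = F t" if "t \<in> {x-1..x+1}" for t
      using primitiveD[OF assms, of "x-1" t] that by (auto simp: integral_unique)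
    ultimately have "continuous_on {x-1..x+1} F"
      using continuous_on_eq by blast
    then show ?thesis
      by (rule continuous_on_interior) (simp add: interior_atLeastAtMost_real)
  qed
  then show ?thesis by (simp add: continuous_at_imp_continuous_on)
qed

text \<open>Vitali's covering lemma, applied to segments that start at a bad point and are fine for
  the gauge of Henstock's lemma, bounds the measure of the bad points.\<close>

lemma primitive_AE_deriv:
  assumes prim: "primitive F u"
  shows "AE t in lebesgue. (F has_real_derivative u t) (at t)"
proof -
  define S where "S e = {x. \<forall>d>0. \<exists>y. \<bar>y - x\<bar> < d \<and> \<bar>F y - F x - u x * (y - x)\<bar> > e * \<bar>y - x\<bar>}"
    for e :: real
  have neg: "negligible (S e \<inter> {a<..<b})" if e: "e > 0" for e a b
    unfolding negligible_outer_le
  proof (intro allI impI)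
    fix \<eta> :: real assume \<eta>: "\<eta> > 0"
    \<comment> \<open>Vitali's lemma enlarges radii by 5, and each chosen segment is shorter than
      \<open>1 / e\<close> times its Henstock error; so the enlarged cover has measure at most
      \<open>5 / e * \<epsilon> = \<eta>\<close>.\<close>
    define \<epsilon> where "\<epsilon> = e * \<eta> / 5"
    have \<epsilon>: "\<epsilon> > 0" using e \<eta> by (simp add: \<epsilon>_def)
    obtain \<delta> where \<delta>H: "(\<forall>x. \<delta> x > 0) \<and> (\<forall>(I :: real set) x y. finite I \<longrightarrow>
        (\<forall>i\<in>I. x i \<in> {a..b} \<and> y i \<in> {a..b} \<and> x i \<noteq> y i \<and> \<bar>y i - x i\<bar> < \<delta> (x i)) \<longrightarrow>
        (\<forall>i\<in>I. \<forall>j\<in>I. i \<noteq> j \<longrightarrow>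
            open_segment (x i) (y i) \<inter> open_segment (x j) (y j) = {}) \<longrightarrow>
        (\<Sum>i\<in>I. \<bar>F (y i) - F (x i) - u (x i) * (y i - x i)\<bar>) < \<epsilon>)"
      by (rule exE[OF Henstock_segments[OF prim \<epsilon>, where ?'i = "real" and a = a and b = b]])
    note \<delta> = conjunct1[OF \<delta>H, rule_format] and H = conjunct2[OF \<delta>H, rule_format]
    let ?S = "S e \<inter> {a<..<b}"
    have "\<exists>y. \<bar>y - x\<bar> < min (\<delta> x) (min (x - a) (b - x)) \<and> \<bar>F y - F x - u x * (y - x)\<bar> > e * \<bar>y - x\<bar>"
      if "x \<in> ?S" for x
      using that \<delta>[of x] unfolding S_def by (auto simp del: min_less_iff_conj)
    then obtain y where y: "\<And>x. x \<in> ?S \<Longrightarrow> \<bar>y x - x\<bar> < min (\<delta> x) (min (x - a) (b - x)) \<and>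
        \<bar>F (y x) - F x - u x * (y x - x)\<bar> > e * \<bar>y x - x\<bar>"
      by metis
    have yx: "y x \<noteq> x" if "x \<in> ?S" for x
      using y[OF that] by auto
    \<comment> \<open>Centre and radius that present the segment from \<open>x\<close> to
      \<open>y x\<close> as a ball, the form in which Vitali's lemma selects disjoint
      pieces.\<close>
    define c where "c x = (x + y x) / 2" for x
    define r where "r x = \<bar>y x - x\<bar> / 2" for x
    have cb: "cball (c x) (r x) = closed_segment x (y x)" for x
      by (auto simp: c_def r_def cball_eq_atLeastAtMost closed_segment_eq_real_ivl field_simps abs_if)
    have cov: "?S \<subseteq> (\<Union>x\<in>?S. cball (c x) (r x))"
      unfolding cb by auto
    have rpos: "0 < r x \<and> r x \<le> b - a" if "x \<in> ?S" for x
      using yx[OF that] y[OF that] that by (auto simp: r_def)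
    obtain C where C: "countable C" "C \<subseteq> ?S"
      "pairwise (\<lambda>i j. disjnt (cball (c i) (r i)) (cball (c j) (r j))) C"
      "?S \<subseteq> (\<Union>i\<in>C. cball (c i) (5 * r i))"
      by (rule Vitali_covering_lemma_cballs[OF cov rpos])
    have bound: "measure lebesgue (\<Union>i\<in>I. cball (c i) (5 * r i)) \<le> \<eta>" if I: "I \<subseteq> C" "finite I" for I
    proof -
      have rI: "0 < r i" if "i \<in> I" for i using that I C(2) rpos by blast
      have "measure lebesgue (\<Union>i\<in>I. cball (c i) (5 * r i)) \<le> (\<Sum>i\<in>I. measure lebesgue (cball (c i) (5 * r i)))"
        by (rule measure_UNION_le) (use I in auto)
      also have "\<dots> = (\<Sum>i\<in>I. 5 * \<bar>y i - i\<bar>)"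
        by (rule sum.cong) (use rI in \<open>force simp: cball_eq_atLeastAtMost r_def\<close>)+
      also have "\<dots> \<le> (\<Sum>i\<in>I. 5 / e * \<bar>F (y i) - F i - u i * (y i - i)\<bar>)"
      proof (rule sum_mono)
        fix i assume "i \<in> I"
        then have "e * \<bar>y i - i\<bar> \<le> \<bar>F (y i) - F i - u i * (y i - i)\<bar>" using y[of i] I C(2) by fastforce
        then show "5 * \<bar>y i - i\<bar> \<le> 5 / e * \<bar>F (y i) - F i - u i * (y i - i)\<bar>"
          using e by (simp add: field_simps)
      qed
      also have "\<dots> = 5 / e * (\<Sum>i\<in>I. \<bar>F (y i) - F i - u i * (y i - i)\<bar>)"
        by (simp add: sum_distrib_left)
      also have "\<dots> \<le> 5 / e * \<epsilon>"
      proof (rule mult_left_mono)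
        have "(\<Sum>i\<in>I. \<bar>F (y i) - F i - u i * (y i - i)\<bar>) < \<epsilon>"
        proof (rule H[where x = "\<lambda>i. i"])
          fix i assume "i \<in> I"
          then have "i \<in> ?S" using I C(2) by blast
          then show "i \<in> {a..b} \<and> y i \<in> {a..b} \<and> i \<noteq> y i \<and> \<bar>y i - i\<bar> < \<delta> i"
            using y[of i] yx[of i] by (auto simp: abs_less_iff)
        next
          fix i j assume "i \<in> I" "j \<in> I" "i \<noteq> j"
          then have "disjnt (cball (c i) (r i)) (cball (c j) (r j))"
            using C(3) I(1) by (auto simp: pairwise_def)
          then show "open_segment i (y i) \<inter> open_segment j (y j) = {}"
            unfolding cb by (auto simp: disjnt_def open_segment_def)
        qed (use I in auto)
        then show "(\<Sum>i\<in>I. \<bar>F (y i) - F i - u i * (y i - i)\<bar>) \<le> \<epsilon>" by simp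
      qed (use e in auto)
      also have "\<dots> = \<eta>" using e by (simp add: \<epsilon>_def)
      finally show ?thesis .
    qed
    show "\<exists>T. ?S \<subseteq> T \<and> T \<in> lmeasurable \<and> measure lebesgue T \<le> \<eta>"
      using fmeasurable_UN_bound[OF C(1) _ bound] measure_UN_bound[OF C(1) _ bound] C(4)
      by (intro exI[of _ "\<Union>i\<in>C. cball (c i) (5 * r i)"]) auto
  qed
  have "{t. \<not> (F has_real_derivative u t) (at t)} \<subseteq>
      (\<Union>n::nat. \<Union>k::nat. S (1 / Suc n) \<inter> {- real k<..<real k})"
  proof
    fix t assume "t \<in> {t. \<not> (F has_real_derivative u t) (at t)}"
    then have "\<not> (\<forall>e>0. \<exists>d>0. \<forall>y. norm (y - t) < d \<longrightarrow> norm (F y - F t - u t * (y - t)) \<le> e * norm (y - t))"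
      by (simp add: has_field_derivative_def has_derivative_at_alt bounded_linear_mult_right)
    then obtain e where e: "e > 0" "t \<in> S e"
      unfolding S_def by (auto simp: not_le)
    obtain n where n: "1 / Suc n < e" using nat_approx_posE[OF e(1)] by metis
    have "t \<in> S (1 / Suc n)"
      unfolding S_def
    proof safe
      fix d :: real assume "d > 0"
      then obtain y where y: "\<bar>y - t\<bar> < d" "\<bar>F y - F t - u t * (y - t)\<bar> > e * \<bar>y - t\<bar>"
        using e(2) by (auto simp: S_def)
      have "1 / Suc n * \<bar>y - t\<bar> \<le> e * \<bar>y - t\<bar>" using n by (intro mult_right_mono) auto
      with y show "\<exists>y. \<bar>y - t\<bar> < d \<and> 1 / real (Suc n) * \<bar>y - t\<bar> < \<bar>F y - F t - u t * (y - t)\<bar>"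
        by (intro exI[of _ y]) auto
    qed
    moreover obtain k :: nat where "\<bar>t\<bar> < real k" using reals_Archimedean2 by blast
    ultimately show "t \<in> (\<Union>n::nat. \<Union>k::nat. S (1 / Suc n) \<inter> {- real k<..<real k})"
      by (intro UN_I[of n] UN_I[of k]) (auto simp: abs_less_iff)
  qed
  moreover have "negligible (\<Union>n::nat. \<Union>k::nat. S (1 / Suc n) \<inter> {- real k<..<real k})"
    by (intro negligible_Union_nat neg) simp
  ultimately show ?thesis
    unfolding AE_lebesgue_iff_negligible by (rule negligible_subset[rotated])
qed

text \<open>Lusin's property (N), again from Henstock's lemma, after changing \<open>u\<close> to \<open>0\<close> on \<open>N\<close>.\<close>

lemma primitive_negligible_image:
  assumes prim: "primitive F u" and N: "negligible N"
  shows "negligible (F ` N)"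
proof -
  define v where "v x = (if x \<in> N then 0 else u x)" for x
  have primv: "primitive F v"
    unfolding primitive_def
    by (auto intro!: has_integral_spike[OF N _ primitiveD[OF prim]] simp: v_def)
  have cont: "continuous_on UNIV F" by (rule primitive_continuous[OF prim])
  have neg: "negligible (F ` (N \<inter> {a..b}))" if ab: "a < b" for a b
    unfolding negligible_outer_le
  proof (intro allI impI)
    fix \<eta> :: real assume \<eta>: "\<eta> > 0"
    define \<epsilon> where "\<epsilon> = \<eta> / 2"
    have \<epsilon>: "\<epsilon> > 0" using \<eta> by (simp add: \<epsilon>_def)
    obtain \<delta> where \<delta>H: "(\<forall>x. \<delta> x > 0) \<and> (\<forall>(I :: real set set) x y. finite I \<longrightarrow>
        (\<forall>i\<in>I. x i \<in> {a..b} \<and> y i \<in> {a..b} \<and> x i \<noteq> y i \<and> \<bar>y i - x i\<bar> < \<delta> (x i)) \<longrightarrow>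
        (\<forall>i\<in>I. \<forall>j\<in>I. i \<noteq> j \<longrightarrow>
            open_segment (x i) (y i) \<inter> open_segment (x j) (y j) = {}) \<longrightarrow>
        (\<Sum>i\<in>I. \<bar>F (y i) - F (x i) - v (x i) * (y i - x i)\<bar>) < \<epsilon>)"
      by (rule exE[OF Henstock_segments[OF primv \<epsilon>, where ?'i = "real set" and a = a and b = b]])
    note \<delta> = conjunct1[OF \<delta>H, rule_format] and H = conjunct2[OF \<delta>H, rule_format]
    have g: "gauge (\<lambda>x. ball x (\<delta> x))" by (rule gauge_ball_dependent) (use \<delta> in auto)
    have sub: "N \<inter> {a..b} \<subseteq> cbox a b" by auto
    have bx: "box a b \<noteq> {}" using ab by auto
    show "\<exists>T. F ` (N \<inter> {a..b}) \<subseteq> T \<and> T \<in> lmeasurable \<and> measure lebesgue T \<le> \<eta>"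
    proof (rule covering_lemma[OF sub bx g])
      fix \<D> assume D: "countable \<D>" "\<Union>\<D> \<subseteq> cbox a b"
        "\<And>K. K \<in> \<D> \<Longrightarrow> interior K \<noteq> {} \<and> (\<exists>c d. K = cbox c d)"
        "pairwise (\<lambda>A B. interior A \<inter> interior B = {}) \<D>"
        "\<And>K. K \<in> \<D> \<Longrightarrow> \<exists>x \<in> (N \<inter> {a..b}) \<inter> K. K \<subseteq> ball x (\<delta> x)"
        "N \<inter> {a..b} \<subseteq> \<Union>\<D>"
      \<comment> \<open>As \<open>y\<close> maximizes the distance of \<open>F\<close> from
        \<open>F x\<close> on \<open>K\<close>, the image of \<open>K\<close> lies in the ball of
        radius \<open>\<bar>F y - F x\<bar>\<close> about \<open>F x\<close>. Since
        \<open>v x = 0\<close>, this radius is exactly the error that Henstock's lemma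
        bounds.\<close>
      have "\<exists>x y. x \<in> N \<inter> {a..b} \<inter> K \<and> K \<subseteq> ball x (\<delta> x) \<and> y \<in> K \<and>
          (\<forall>z\<in>K. \<bar>F z - F x\<bar> \<le> \<bar>F y - F x\<bar>)" if K: "K \<in> \<D>" for K
      proof -
        obtain x where x: "x \<in> N \<inter> {a..b} \<inter> K" "K \<subseteq> ball x (\<delta> x)" using D(5)[OF K] by auto
        have "compact K" using D(3)[OF K] by auto
        moreover have "K \<noteq> {}" using x by auto
        moreover have "continuous_on K (\<lambda>z. \<bar>F z - F x\<bar>)"
          by (intro continuous_intros continuous_on_subset[OF cont]) auto
        ultimately obtain y where "y \<in> K" "\<forall>z\<in>K. \<bar>F z - F x\<bar> \<le> \<bar>F y - F x\<bar>"
          using continuous_attains_sup by metis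
        with x show ?thesis by blast
      qed
      then obtain x y where xy: "\<And>K. K \<in> \<D> \<Longrightarrow> x K \<in> N \<inter> {a..b} \<inter> K \<and> K \<subseteq> ball (x K) (\<delta> (x K)) \<and> y K \<in> K \<and>
          (\<forall>z\<in>K. \<bar>F z - F (x K)\<bar> \<le> \<bar>F (y K) - F (x K)\<bar>)"
        by metis
      let ?T = "\<lambda>K. cball (F (x K)) \<bar>F (y K) - F (x K)\<bar>"
      have bound: "measure lebesgue (\<Union>K\<in>I. ?T K) \<le> \<eta>" if I: "I \<subseteq> \<D>" "finite I" for I
      proof -
        \<comment> \<open>Intervals with \<open>x K = y K\<close> have a single point as image and
          contribute nothing; they are set aside since \<open>Henstock_segments\<close> demands
          proper segments.\<close>
        define J where "J = {K \<in> I. x K \<noteq> y K}"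
        have "measure lebesgue (\<Union>K\<in>I. ?T K) \<le> (\<Sum>K\<in>I. measure lebesgue (?T K))"
          by (rule measure_UNION_le) (use I in auto)
        also have "\<dots> = (\<Sum>K\<in>I. 2 * \<bar>F (y K) - F (x K)\<bar>)"
          by (simp add: cball_eq_atLeastAtMost)
        also have "\<dots> = (\<Sum>K\<in>J. 2 * \<bar>F (y K) - F (x K)\<bar>)"
          by (rule sum.mono_neutral_right) (use I in \<open>auto simp: J_def\<close>)
        also have "\<dots> = 2 * (\<Sum>K\<in>J. \<bar>F (y K) - F (x K) - v (x K) * (y K - x K)\<bar>)"
        proof -
          have "v (x K) = 0" if "K \<in> J" for K
            using xy[of K] that I by (auto simp: J_def v_def)
          then show ?thesis by (simp add: sum_distrib_left)
        qed
        also have "\<dots> \<le> 2 * \<epsilon>"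
        proof -
          have "(\<Sum>K\<in>J. \<bar>F (y K) - F (x K) - v (x K) * (y K - x K)\<bar>) < \<epsilon>"
          proof (rule H)
            fix K assume "K \<in> J"
            then have K: "K \<in> \<D>" "x K \<noteq> y K" using I by (auto simp: J_def)
            have yK: "y K \<in> K" "y K \<in> ball (x K) (\<delta> (x K))" using xy[OF K(1)] by auto
            show "x K \<in> {a..b} \<and> y K \<in> {a..b} \<and> x K \<noteq> y K \<and> \<bar>y K - x K\<bar> < \<delta> (x K)"
              using xy[OF K(1)] K yK D(2) by (auto simp: dist_real_def abs_minus_commute)
          next
            fix K L assume KL: "K \<in> J" "L \<in> J" "K \<noteq> L"
            have *: "open_segment (x K) (y K) \<subseteq> interior K" if "K \<in> J" for K
            proof -
              have K: "K \<in> \<D>" using that I by (auto simp: J_def)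
              obtain c d where cd: "K = {c..d}" using D(3)[OF K] by auto
              show ?thesis using xy[OF K] unfolding cd
                by (auto simp: interior_atLeastAtMost_real open_segment_eq_real_ivl split: if_splits)
            qed
            have "interior K \<inter> interior L = {}"
              using D(4) KL I by (auto simp: J_def pairwise_def)
            then show "open_segment (x K) (y K) \<inter> open_segment (x L) (y L) = {}"
              using *[OF KL(1)] *[OF KL(2)] by blast
          qed (use I in \<open>auto simp: J_def\<close>)
          then show ?thesis by simp
        qed
        also have "\<dots> = \<eta>" by (simp add: \<epsilon>_def)
        finally show ?thesis .
      qed
      have "F ` (N \<inter> {a..b}) \<subseteq> (\<Union>K\<in>\<D>. ?T K)"
      proof
        fix w assume "w \<in> F ` (N \<inter> {a..b})"
        then obtain z where z: "w = F z" "z \<in> N \<inter> {a..b}" by auto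
        then obtain K where "K \<in> \<D>" "z \<in> K" using D(6) by blast
        then have "w \<in> ?T K" using xy[of K] z by (auto simp: dist_real_def abs_minus_commute)
        then show "w \<in> (\<Union>K\<in>\<D>. ?T K)" using \<open>K \<in> \<D>\<close> by blast
      qed
      then show ?thesis
        using fmeasurable_UN_bound[OF D(1) _ bound] measure_UN_bound[OF D(1) _ bound]
        by (intro exI[of _ "\<Union>K\<in>\<D>. ?T K"]) auto
    qed
  qed
  have "F ` N \<subseteq> (\<Union>k::nat. F ` (N \<inter> {- real (Suc k)..real (Suc k)}))"
  proof
    fix w assume "w \<in> F ` N"
    then obtain z where z: "w = F z" "z \<in> N" by auto
    obtain k :: nat where "\<bar>z\<bar> < real k" using reals_Archimedean2 by blast
    then show "w \<in> (\<Union>k::nat. F ` (N \<inter> {- real (Suc k)..real (Suc k)}))" using z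
      by (intro UN_I[of k]) (auto intro!: imageI)
  qed
  moreover have "negligible (\<Union>k::nat. F ` (N \<inter> {- real (Suc k)..real (Suc k)}))"
    by (intro negligible_Union_nat neg) simp
  ultimately show ?thesis by (rule negligible_subset[rotated])
qed

text \<open>Where the derivative is nonzero, \<open>h\<close> expands small distances. These points
  split into countably many pieces on which \<open>h\<close> is injective with a Lipschitz inverse,
  and this inverse carries a null set of values back to a null set of points.\<close>

lemma negligible_nonzero_deriv:
  fixes h d :: "real \<Rightarrow> real"
  assumes der: "\<And>t. t \<in> E \<Longrightarrow> (h has_real_derivative d t) (at t)"
    and neg: "negligible (h ` E)"
  shows "negligible {t \<in> E. d t \<noteq> 0}"
proof -
  \<comment> \<open>\<open>n\<close> fixes both the expansion factor and the scale on which it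
    holds; nearness to a rational \<open>q\<close> makes any two points of a piece closer than that
    scale.\<close>
  define P where "P n q = {t \<in> E. \<bar>t - q\<bar> < 1 / (2 * Suc n) \<and>
      (\<forall>y. \<bar>y - t\<bar> < 1 / Suc n \<longrightarrow> \<bar>h y - h t\<bar> \<ge> \<bar>y - t\<bar> / Suc n)}" for n :: nat and q
  have P: "negligible (P n q)" for n q
  proof -
    have lip: "\<bar>y - t\<bar> \<le> Suc n * \<bar>h y - h t\<bar>" if "t \<in> P n q" "y \<in> P n q" for t y
    proof -
      have "\<bar>y - t\<bar> < 1 / (2 * Suc n) + 1 / (2 * Suc n)"
        using that unfolding P_def mem_Collect_eq by argo
      then have "\<bar>y - t\<bar> < 1 / Suc n" by (simp add: field_simps)
      then have "\<bar>h y - h t\<bar> \<ge> \<bar>y - t\<bar> / Suc n" using that by (auto simp: P_def)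
      then show ?thesis by (simp add: field_simps)
    qed
    have inj: "inj_on h (P n q)"
      by (rule inj_onI) (use lip in fastforce)
    have negP: "negligible (h ` P n q)"
      by (rule negligible_subset[OF neg]) (auto simp: P_def)
    have "negligible (the_inv_into (P n q) h ` (h ` P n q))"
    proof (rule negligible_locally_Lipschitz_image[OF _ negP])
      fix x assume "x \<in> h ` P n q"
      then obtain t where t: "x = h t" "t \<in> P n q" by auto
      have "norm (the_inv_into (P n q) h y - the_inv_into (P n q) h x) \<le> Suc n * norm (y - x)"
        if "y \<in> h ` P n q" for y
        using that t lip inj by (auto simp: the_inv_into_f_f)
      then show "\<exists>T B. open T \<and> x \<in> T \<and> (\<forall>y\<in>h ` P n q \<inter> T.
          norm (the_inv_into (P n q) h y - the_inv_into (P n q) h x) \<le> B * norm (y - x))"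
        by (intro exI[of _ UNIV] exI[of _ "real (Suc n)"]) auto
    qed auto
    moreover have "the_inv_into (P n q) h ` (h ` P n q) = P n q"
      using inj by (force simp: the_inv_into_f_f image_image)
    ultimately show ?thesis by simp
  qed
  have "{t \<in> E. d t \<noteq> 0} \<subseteq> (\<Union>n. \<Union>q\<in>\<rat>. P n q)"
  proof
    fix t assume t: "t \<in> {t \<in> E. d t \<noteq> 0}"
    then have "(h has_real_derivative d t) (at t)" using der by auto
    then have D: "\<forall>e>0. \<exists>\<delta>>0. \<forall>y. norm (y - t) < \<delta> \<longrightarrow> norm (h y - h t - d t * (y - t)) \<le> e * norm (y - t)"
      by (simp add: has_field_derivative_def has_derivative_at_alt)
    have "\<bar>d t\<bar> / 2 > 0" using t by auto
    with D obtain \<delta> where \<delta>: "\<delta> > 0"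
      "\<And>y. norm (y - t) < \<delta> \<Longrightarrow> norm (h y - h t - d t * (y - t)) \<le> \<bar>d t\<bar> / 2 * norm (y - t)"
      by metis
    obtain n :: nat where n: "1 / Suc n < min \<delta> (\<bar>d t\<bar> / 2)"
      using nat_approx_posE[of "min \<delta> (\<bar>d t\<bar> / 2)"] \<delta>(1) t by auto
    obtain q where q: "q \<in> \<rat>" "t < q" "q < t + 1 / (2 * Suc n)"
      using Rats_dense_in_real[of t "t + 1 / (2 * Suc n)"] by auto
    have "\<bar>h y - h t\<bar> \<ge> \<bar>y - t\<bar> / Suc n" if "\<bar>y - t\<bar> < 1 / Suc n" for y
    proof -
      have "\<bar>h y - h t - d t * (y - t)\<bar> \<le> \<bar>d t\<bar> / 2 * \<bar>y - t\<bar>"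
        using \<delta>(2)[of y] that n by auto
      moreover have "\<bar>d t * (y - t)\<bar> = \<bar>d t\<bar> * \<bar>y - t\<bar>" by (rule abs_mult)
      ultimately have "\<bar>d t\<bar> * \<bar>y - t\<bar> - \<bar>h y - h t\<bar> \<le> \<bar>d t\<bar> / 2 * \<bar>y - t\<bar>"
        by linarith
      then have "\<bar>h y - h t\<bar> \<ge> \<bar>d t\<bar> / 2 * \<bar>y - t\<bar>" by (simp add: field_simps)
      moreover have "\<bar>d t\<bar> / 2 * \<bar>y - t\<bar> \<ge> 1 / Suc n * \<bar>y - t\<bar>"
        by (rule mult_right_mono) (use n in auto)
      ultimately have "1 / Suc n * \<bar>y - t\<bar> \<le> \<bar>h y - h t\<bar>" by linarith
      then show ?thesis by simp
    qed
    then have "t \<in> P n q" using t q by (auto simp: P_def)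
    then show "t \<in> (\<Union>n. \<Union>q\<in>\<rat>. P n q)" using q by blast
  qed
  moreover have "negligible (\<Union>n. \<Union>q\<in>\<rat>. P n q)"
    by (intro negligible_countable_Union) (auto intro!: negligible_countable_Union P simp: countable_rat)
  ultimately show ?thesis by (rule negligible_subset[rotated])
qed

text \<open>The composition \<open>F \<circ> g\<close> need not be absolutely continuous; what replaces this is that its
  product with \<open>Q\<close> is differentiable almost everywhere.\<close>

lemma AE_deriv_comp_mult:
  fixes F u g g' Q Q' T' :: "real \<Rightarrow> real"
  assumes prim: "primitive F u"
    and g: "AE t in lebesgue. (g has_real_derivative g' t) (at t)"
    and Q: "AE t in lebesgue. (Q has_real_derivative Q' t) (at t)"
    and contQ: "continuous_on UNIV Q"
    and T: "AE t in lebesgue. ((\<lambda>t. F (g t) * Q t) has_real_derivative T' t) (at t)"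
  shows "AE t in lebesgue. T' t = u (g t) * g' t * Q t + F (g t) * Q' t"
proof -
  define N where "N = {y. \<not> (F has_real_derivative u y) (at y)}"
  have N: "negligible N" using primitive_AE_deriv[OF prim] by (simp add: N_def AE_lebesgue_iff_negligible)
  define E where "E = {t. (g has_real_derivative g' t) (at t) \<and> (Q has_real_derivative Q' t) (at t) \<and>
    ((\<lambda>t. F (g t) * Q t) has_real_derivative T' t) (at t)}"
  define h where "h t = (T' t - F (g t) * Q' t) / Q t" for t
  have hder: "((\<lambda>t. F (g t)) has_real_derivative h t) (at t)" if t: "t \<in> E" "Q t \<noteq> 0" for t
  proof -
    have d: "((\<lambda>t. F (g t) * Q t) has_real_derivative T' t) (at t)" "(Q has_real_derivative Q' t) (at t)"
      using t by (auto simp: E_def)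
    have "((\<lambda>t. F (g t) * Q t / Q t) has_real_derivative h t) (at t)"
    proof -
      have "(T' t * Q t - F (g t) * Q t * Q' t) / (Q t * Q t) = h t"
        using t(2) by (simp add: h_def divide_simps) (simp add: algebra_simps)
      then show ?thesis using DERIV_divide[OF d t(2)] by metis
    qed
    \<comment> \<open>Continuity of \<open>Q\<close> makes the quotient equal to
      \<open>F (g s)\<close> on a whole neighbourhood of \<open>t\<close>, not only at
      \<open>t\<close>.\<close>
    moreover have "eventually (\<lambda>s. Q s \<noteq> 0) (nhds t)"
    proof -
      have "open {s. Q s \<noteq> 0}"
        by (rule open_Collect_neq) (use contQ in \<open>auto intro: continuous_intros\<close>)
      then show ?thesis using t by (auto simp: eventually_nhds)
    qed
    then have ev: "eventually (\<lambda>s. F (g s) * Q s / Q s = F (g s)) (nhds t)"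
      by eventually_elim auto
    ultimately show ?thesis
      by (simp only: DERIV_cong_ev[OF refl ev refl])
  qed
  \<comment> \<open>Each set is null because the function concerned takes values in a null set:
    \<open>g\<close> in \<open>N\<close>, \<open>F \<circ> g\<close> in the image of
    \<open>N\<close> under \<open>F\<close>, which is null by property (N), and the last two in
    \<open>{0}\<close>.\<close>
  have A1: "negligible {t \<in> {t \<in> E. g t \<in> N}. g' t \<noteq> 0}"
    by (rule negligible_nonzero_deriv[where h = g]) (auto simp: E_def intro: negligible_subset[OF N])
  have A2: "negligible {t \<in> {t \<in> E. g t \<in> N \<and> Q t \<noteq> 0}. h t \<noteq> 0}"
    by (rule negligible_nonzero_deriv[where h = "\<lambda>t. F (g t)"])
      (auto simp: hder intro: negligible_subset[OF primitive_negligible_image[OF prim N]])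
  have A3: "negligible {t \<in> {t \<in> E. Q t = 0}. T' t \<noteq> 0}"
    by (rule negligible_nonzero_deriv[where h = "\<lambda>t. F (g t) * Q t"])
      (auto simp: E_def intro: negligible_subset[of "{0}"])
  have A4: "negligible {t \<in> {t \<in> E. Q t = 0}. Q' t \<noteq> 0}"
    by (rule negligible_nonzero_deriv[where h = Q])
      (auto simp: E_def intro: negligible_subset[of "{0}"])
  have "AE t in lebesgue. t \<in> E"
    using g Q T by eventually_elim (auto simp: E_def)
  moreover have "AE t in lebesgue. t \<notin> {t \<in> {t \<in> E. g t \<in> N}. g' t \<noteq> 0}"
    "AE t in lebesgue. t \<notin> {t \<in> {t \<in> E. g t \<in> N \<and> Q t \<noteq> 0}. h t \<noteq> 0}"
    "AE t in lebesgue. t \<notin> {t \<in> {t \<in> E. Q t = 0}. T' t \<noteq> 0}"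
    "AE t in lebesgue. t \<notin> {t \<in> {t \<in> E. Q t = 0}. Q' t \<noteq> 0}"
    using A1 A2 A3 A4 by (simp_all only: AE_lebesgue_iff_negligible not_not Collect_mem_eq)
  ultimately show ?thesis
  proof eventually_elim
    case (elim t)
    show ?case
    proof (cases "g t \<in> N")
      case False
      then have "(F has_real_derivative u (g t)) (at (g t))" by (simp add: N_def)
      moreover have "(g has_real_derivative g' t) (at t)" "(Q has_real_derivative Q' t) (at t)"
        using elim(1) by (auto simp: E_def)
      ultimately have "((\<lambda>t. F (g t) * Q t) has_real_derivative u (g t) * g' t * Q t + Q' t * F (g t)) (at t)"
        by (intro DERIV_mult) (auto intro: DERIV_chain2)
      moreover have "((\<lambda>t. F (g t) * Q t) has_real_derivative T' t) (at t)" using elim(1) by (simp add: E_def)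
      ultimately show ?thesis by (metis DERIV_unique mult.commute)
    next
      case True
      show ?thesis
      proof (cases "Q t = 0")
        case True then show ?thesis using elim by auto
      next
        case False
        \<comment> \<open>\<open>h t = 0\<close> says \<open>T' t = F (g t) * Q' t\<close>, and
          \<open>g' t = 0\<close> removes the term with \<open>u (g t)\<close>, a value over which
          nothing is known at points of \<open>N\<close>.\<close>
        then have "h t = 0" "g' t = 0" using elim True by auto
        then show ?thesis using False by (simp add: h_def)
      qed
    qed
  qed
qed

section \<open>Smooth functions\<close>

lemma iter_deriv_Nil [simp]: "iter_deriv [] \<phi> = \<phi>"
  and iter_deriv_Cons [simp]: "iter_deriv (b # bs) \<phi> = dir_deriv b (iter_deriv bs \<phi>)"
  and iter_deriv_append: "iter_deriv (as @ bs) \<phi> = iter_deriv as (iter_deriv bs \<phi>)"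
  by (simp_all add: iter_deriv_def)

text \<open>Iterated derivatives never leave a set closed under partial derivatives, so smoothness
  can be checked without formulas for higher derivatives.\<close>

lemma smooth_coinduct:
  assumes "\<phi> \<in> S"
    and S: "\<And>\<psi>. \<psi> \<in> S \<Longrightarrow> (\<forall>x. \<psi> differentiable (at x)) \<and> (\<forall>b\<in>Basis. dir_deriv b \<psi> \<in> S)"
  shows "smooth \<phi>"
proof -
  have "iter_deriv bs \<phi> \<in> S" if "set bs \<subseteq> Basis" for bs
    using that by (induction bs) (use assms in auto)
  then show ?thesis using S by (auto simp: smooth_def)
qed

lemma smooth_differentiable: "smooth \<phi> \<Longrightarrow> \<phi> differentiable (at x)"
  unfolding smooth_def by (metis empty_set empty_subsetI iter_deriv_Nil)

lemma smooth_dir_deriv: "smooth (\<phi> :: 'a::euclidean_space \<Rightarrow> real) \<Longrightarrow> b \<in> Basis \<Longrightarrow> smooth (dir_deriv b \<phi>)"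
  unfolding smooth_def
proof (intro allI impI)
  fix bs :: "'a list" and x assume "\<forall>bs. set bs \<subseteq> Basis \<longrightarrow> (\<forall>x. iter_deriv bs \<phi> differentiable at x)"
    "b \<in> Basis" "set bs \<subseteq> Basis"
  then have "iter_deriv (bs @ [b]) \<phi> differentiable at x" by auto
  then show "iter_deriv bs (dir_deriv b \<phi>) differentiable at x" by (simp add: iter_deriv_append)
qed

lemma smooth_iter_deriv: "smooth \<phi> \<Longrightarrow> set bs \<subseteq> Basis \<Longrightarrow> smooth (iter_deriv bs \<phi>)"
  by (induction bs) (auto intro: smooth_dir_deriv)

lemma dir_deriv_eqI: "(\<phi> has_derivative D) (at x) \<Longrightarrow> dir_deriv b \<phi> x = D b"
  unfolding dir_deriv_def using frechet_derivative_at by metis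

lemma smooth_has_derivative:
  "smooth \<phi> \<Longrightarrow> (\<phi> has_derivative (\<lambda>b. dir_deriv b \<phi> x)) (at x)"
  using smooth_differentiable[of \<phi> x] unfolding dir_deriv_def frechet_derivative_works by simp

lemma smooth_line_deriv:
  assumes "smooth \<phi>"
  shows "((\<lambda>s. \<phi> (x + s *\<^sub>R b)) has_real_derivative dir_deriv b \<phi> (x + s *\<^sub>R b)) (at s)"
proof -
  have "((\<lambda>s. x + s *\<^sub>R b) has_derivative (\<lambda>s. s *\<^sub>R b)) (at s)"
    by (auto intro!: derivative_eq_intros)
  from has_derivative_compose[OF this smooth_has_derivative[OF assms]]
  have "((\<lambda>s. \<phi> (x + s *\<^sub>R b)) has_derivative (\<lambda>t. dir_deriv (t *\<^sub>R b) \<phi> (x + s *\<^sub>R b))) (at s)" .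
  moreover have "dir_deriv (t *\<^sub>R b) \<phi> y = dir_deriv b \<phi> y * t" for t y
    using linear_cmul[OF has_derivative_linear[OF smooth_has_derivative[OF assms, of y]], of t b]
    by simp
  ultimately show ?thesis
    by (simp add: has_field_derivative_def)
qed

lemma smooth_isCont: "smooth \<phi> \<Longrightarrow> isCont \<phi> x"
  by (simp add: differentiable_imp_continuous_within smooth_differentiable)

lemma smooth_continuous: "smooth \<phi> \<Longrightarrow> continuous_on S \<phi>"
  by (meson differentiable_at_imp_differentiable_on differentiable_imp_continuous_on smooth_differentiable)

text \<open>One coinduction gives all closure properties of smooth functions.\<close>

inductive_set smooth_closure :: "('a::euclidean_space \<Rightarrow> real) set" where
  base: "smooth \<phi> \<Longrightarrow> \<phi> \<in> smooth_closure"
| add: "\<phi> \<in> smooth_closure \<Longrightarrow> \<psi> \<in> smooth_closure \<Longrightarrow> (\<lambda>x. \<phi> x + \<psi> x) \<in> smooth_closure"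
| mult: "\<phi> \<in> smooth_closure \<Longrightarrow> \<psi> \<in> smooth_closure \<Longrightarrow> (\<lambda>x. \<phi> x * \<psi> x) \<in> smooth_closure"
| inverse: "\<phi> \<in> smooth_closure \<Longrightarrow> (\<And>x. \<phi> x \<noteq> 0) \<Longrightarrow> (\<lambda>x. inverse (\<phi> x)) \<in> smooth_closure"
| comp: "smooth \<theta> \<Longrightarrow> \<phi> \<in> smooth_closure \<Longrightarrow> (\<lambda>x. \<theta> (\<phi> x :: real)) \<in> smooth_closure"
| shift: "smooth \<phi> \<Longrightarrow> (\<lambda>x. \<phi> (x + a)) \<in> smooth_closure"

lemma smooth_affine: "smooth (\<lambda>x. x \<bullet> e + c)"
proof (rule smooth_coinduct)
  show "(\<lambda>x. x \<bullet> e + c) \<in> {\<lambda>x. x \<bullet> e + c | e c. True}" by auto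
  fix \<psi> :: "'a \<Rightarrow> real" assume "\<psi> \<in> {\<lambda>x. x \<bullet> e + c | e c. True}"
  then obtain e c where \<psi>: "\<psi> = (\<lambda>x. x \<bullet> e + c)" by auto
  have D: "(\<psi> has_derivative (\<lambda>h. h \<bullet> e)) (at x)" for x
    unfolding \<psi> by (auto intro!: derivative_eq_intros)
  have "dir_deriv b \<psi> = (\<lambda>x. x \<bullet> 0 + b \<bullet> e)" for b
    using dir_deriv_eqI[OF D] by auto
  then show "(\<forall>x. \<psi> differentiable (at x)) \<and> (\<forall>b\<in>Basis. dir_deriv b \<psi> \<in> {\<lambda>x. x \<bullet> e + c | e c. True})"
    using D unfolding differentiable_def by blast
qed

lemma smooth_const [simp]: "smooth (\<lambda>x. c)"
  using smooth_affine[of 0 c] by simp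

lemma smooth_closure_deriv:
  assumes "\<phi> \<in> smooth_closure"
  shows "(\<forall>x. \<phi> differentiable (at x)) \<and> (\<forall>b\<in>Basis. dir_deriv b \<phi> \<in> smooth_closure)"
  using assms
proof induction
  case (base \<phi>)
  then show ?case using smooth_differentiable smooth_dir_deriv smooth_closure.base by blast
next
  case (add \<phi> \<psi>)
  then have D: "((\<lambda>x. \<phi> x + \<psi> x) has_derivative (\<lambda>h. dir_deriv h \<phi> x + dir_deriv h \<psi> x)) (at x)" for x
    by (auto intro!: has_derivative_add simp: dir_deriv_def frechet_derivative_works)
  have "dir_deriv b (\<lambda>x. \<phi> x + \<psi> x) = (\<lambda>x. dir_deriv b \<phi> x + dir_deriv b \<psi> x)" for b
    using dir_deriv_eqI[OF D] by auto
  then show ?case using add D by (auto simp: differentiable_def intro: smooth_closure.add)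
next
  case (mult \<phi> \<psi>)
  then have D: "((\<lambda>x. \<phi> x * \<psi> x) has_derivative (\<lambda>h. \<phi> x * dir_deriv h \<psi> x + dir_deriv h \<phi> x * \<psi> x)) (at x)" for x
    by (auto intro!: has_derivative_mult simp: dir_deriv_def frechet_derivative_works)
  have "dir_deriv b (\<lambda>x. \<phi> x * \<psi> x) = (\<lambda>x. \<phi> x * dir_deriv b \<psi> x + dir_deriv b \<phi> x * \<psi> x)" for b
    using dir_deriv_eqI[OF D] by auto
  then show ?case using mult D
    by (auto simp: differentiable_def intro!: smooth_closure.add smooth_closure.mult)
next
  case (inverse \<phi>)
  then have D: "((\<lambda>x. inverse (\<phi> x)) has_derivative (\<lambda>h. - (inverse (\<phi> x) * dir_deriv h \<phi> x * inverse (\<phi> x)))) (at x)" for x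
    by (intro Deriv.has_derivative_inverse) (auto simp: dir_deriv_def frechet_derivative_works)
  have "dir_deriv b (\<lambda>x. inverse (\<phi> x)) = (\<lambda>x. (-1) * (inverse (\<phi> x) * dir_deriv b \<phi> x * inverse (\<phi> x)))" for b
    using dir_deriv_eqI[OF D] by auto
  moreover have "(\<lambda>x. (-1) * (inverse (\<phi> x) * dir_deriv b \<phi> x * inverse (\<phi> x))) \<in> smooth_closure" if "b \<in> Basis" for b
    using inverse that by (intro smooth_closure.mult smooth_closure.inverse smooth_closure.base[OF smooth_const]) auto
  ultimately show ?case using D by (auto simp: differentiable_def)
next
  case (comp \<theta> \<phi>)
  have D1: "(\<phi> has_derivative (\<lambda>h. dir_deriv h \<phi> x)) (at x)" for x
    using comp by (auto simp: dir_deriv_def frechet_derivative_works)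
  have lin: "dir_deriv t \<theta> y = dir_deriv 1 \<theta> y * t" for t y
    using linear_cmul[OF has_derivative_linear[OF smooth_has_derivative[OF comp(1), of y]], of t 1] by simp
  have D: "((\<lambda>x. \<theta> (\<phi> x)) has_derivative (\<lambda>h. dir_deriv 1 \<theta> (\<phi> x) * dir_deriv h \<phi> x)) (at x)" for x
  proof -
    have eq: "(\<lambda>h. dir_deriv (dir_deriv h \<phi> x) \<theta> (\<phi> x)) = (\<lambda>h. dir_deriv 1 \<theta> (\<phi> x) * dir_deriv h \<phi> x)"
      by (rule ext, rule lin)
    show ?thesis
      using has_derivative_compose[OF D1[of x] smooth_has_derivative[OF comp(1), of "\<phi> x"]] by (simp only: eq)
  qed
  have "dir_deriv b (\<lambda>x. \<theta> (\<phi> x)) = (\<lambda>x. dir_deriv 1 \<theta> (\<phi> x) * dir_deriv b \<phi> x)" for b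
    by (rule ext) (rule dir_deriv_eqI[OF D])
  moreover have "(\<lambda>x. dir_deriv 1 \<theta> (\<phi> x) * dir_deriv b \<phi> x) \<in> smooth_closure" if "b \<in> Basis" for b
  proof (rule smooth_closure.mult)
    have "smooth (dir_deriv 1 \<theta>)" by (rule smooth_dir_deriv[OF comp(1)]) simp
    then show "(\<lambda>x. dir_deriv 1 \<theta> (\<phi> x)) \<in> smooth_closure" by (rule smooth_closure.comp[OF _ comp(2)])
    show "dir_deriv b \<phi> \<in> smooth_closure" using comp(3) that by blast
  qed
  ultimately show ?case using D by (auto simp: differentiable_def)
next
  case (shift \<phi> a)
  have D1: "((\<lambda>x. x + a) has_derivative (\<lambda>h. h)) (at x)" for x
    by (auto intro!: derivative_eq_intros)
  have D: "((\<lambda>x. \<phi> (x + a)) has_derivative (\<lambda>h. dir_deriv h \<phi> (x + a))) (at x)" for x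
    using has_derivative_compose[OF D1[of x] smooth_has_derivative[OF shift, of "x + a"]] .
  have "dir_deriv b (\<lambda>x. \<phi> (x + a)) = (\<lambda>x. dir_deriv b \<phi> (x + a))" for b
    using dir_deriv_eqI[OF D] by auto
  then show ?case using D smooth_closure.shift[OF smooth_dir_deriv[OF shift]] by (auto simp: differentiable_def)
qed

lemma smooth_closure_smooth: "\<phi> \<in> smooth_closure \<Longrightarrow> smooth \<phi>"
  by (erule smooth_coinduct) (rule smooth_closure_deriv)

lemma smooth_add: "smooth \<phi> \<Longrightarrow> smooth \<psi> \<Longrightarrow> smooth (\<lambda>x. \<phi> x + \<psi> x)"
  and smooth_mult: "smooth \<phi> \<Longrightarrow> smooth \<psi> \<Longrightarrow> smooth (\<lambda>x. \<phi> x * \<psi> x)"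
  and smooth_inverse: "smooth \<phi> \<Longrightarrow> (\<And>x. \<phi> x \<noteq> 0) \<Longrightarrow> smooth (\<lambda>x. inverse (\<phi> x))"
  and smooth_comp: "smooth \<theta> \<Longrightarrow> smooth \<phi> \<Longrightarrow> smooth (\<lambda>x. \<theta> (\<phi> x :: real))"
  and smooth_shift: "smooth \<phi> \<Longrightarrow> smooth (\<lambda>x. \<phi> (x + a))"
  using smooth_closure.add[of \<phi> \<psi>] smooth_closure.mult[of \<phi> \<psi>] smooth_closure.inverse[of \<phi>]
    smooth_closure.comp[of \<theta> \<phi>] smooth_closure.shift[of \<phi> a]
  by (simp_all add: smooth_closure_smooth smooth_closure.base)

lemma smooth_diff: "smooth \<phi> \<Longrightarrow> smooth \<psi> \<Longrightarrow> smooth (\<lambda>x. \<phi> x - \<psi> x)"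
  using smooth_add[of \<phi> "\<lambda>x. (-1) * \<psi> x"] smooth_mult[OF smooth_const, of \<psi> "-1"] by simp

lemma smooth_prod: "finite I \<Longrightarrow> (\<And>i. i \<in> I \<Longrightarrow> smooth (\<phi> i)) \<Longrightarrow> smooth (\<lambda>x. \<Prod>i\<in>I. \<phi> i x)"
  by (induction I rule: finite_induct) (auto intro: smooth_mult)

lemma smooth_power: "smooth \<phi> \<Longrightarrow> smooth (\<lambda>x. \<phi> x ^ k)"
  by (induction k) (auto intro: smooth_mult)

lemma dir_deriv_mult:
  "smooth \<phi> \<Longrightarrow> smooth \<psi> \<Longrightarrow>
    dir_deriv b (\<lambda>x. \<phi> x * \<psi> x) = (\<lambda>x. \<phi> x * dir_deriv b \<psi> x + dir_deriv b \<phi> x * \<psi> x)"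
  using dir_deriv_eqI[OF has_derivative_mult[OF smooth_has_derivative smooth_has_derivative]] by blast

lemma dir_deriv_shift:
  assumes "smooth \<phi>"
  shows "dir_deriv b (\<lambda>x. \<phi> (x + a)) = (\<lambda>x. dir_deriv b \<phi> (x + a))"
proof
  fix x
  have "((\<lambda>x. x + a) has_derivative (\<lambda>h. h)) (at x)"
    by (auto intro!: derivative_eq_intros)
  from dir_deriv_eqI[OF has_derivative_compose[OF this smooth_has_derivative[OF assms]]]
  show "dir_deriv b (\<lambda>x. \<phi> (x + a)) x = dir_deriv b \<phi> (x + a)" .
qed

text \<open>Schwarz's theorem. The second difference of \<open>\<phi>\<close> over a small square
  with sides along \<open>a\<close> and \<open>b\<close> is symmetric in the two directions; two
  applications of the mean value theorem give \<open>t * t\<close> times either mixed derivative at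
  a nearby point, and continuity of both forces equality.\<close>

lemma dir_deriv_commute:
  assumes s: "smooth \<phi>" and a: "a \<in> Basis" and b: "b \<in> Basis"
  shows "dir_deriv a (dir_deriv b \<phi>) = dir_deriv b (dir_deriv a \<phi>)"
proof (rule ext, rule ccontr)
  have mvt: "\<exists>p. dist p x \<le> 2 * t \<and> \<phi> (x + t *\<^sub>R b + t *\<^sub>R a) - \<phi> (x + t *\<^sub>R a) - \<phi> (x + t *\<^sub>R b) + \<phi> x =
      t * t * dir_deriv b (dir_deriv a \<phi>) p"
    if t: "t > 0" and a: "a \<in> Basis" and b: "b \<in> Basis" for t x a b
  proof -
    have "((\<lambda>s. \<phi> ((x + t *\<^sub>R b) + s *\<^sub>R a) - \<phi> (x + s *\<^sub>R a)) has_real_derivative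
        dir_deriv a \<phi> ((x + t *\<^sub>R b) + s *\<^sub>R a) - dir_deriv a \<phi> (x + s *\<^sub>R a)) (at s)" for s
      by (intro DERIV_diff smooth_line_deriv s)
    from MVT2[OF t this] obtain \<sigma> where \<sigma>: "0 < \<sigma>" "\<sigma> < t"
      "(\<phi> ((x + t *\<^sub>R b) + t *\<^sub>R a) - \<phi> (x + t *\<^sub>R a)) - (\<phi> ((x + t *\<^sub>R b) + 0 *\<^sub>R a) - \<phi> (x + 0 *\<^sub>R a)) =
        (t - 0) * (dir_deriv a \<phi> ((x + t *\<^sub>R b) + \<sigma> *\<^sub>R a) - dir_deriv a \<phi> (x + \<sigma> *\<^sub>R a))"
      by blast
    have "((\<lambda>s. dir_deriv a \<phi> ((x + \<sigma> *\<^sub>R a) + s *\<^sub>R b)) has_real_derivative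
        dir_deriv b (dir_deriv a \<phi>) ((x + \<sigma> *\<^sub>R a) + s *\<^sub>R b)) (at s)" for s
      by (intro smooth_line_deriv smooth_dir_deriv s a)
    from MVT2[OF t this] obtain \<tau> where \<tau>: "0 < \<tau>" "\<tau> < t"
      "dir_deriv a \<phi> ((x + \<sigma> *\<^sub>R a) + t *\<^sub>R b) - dir_deriv a \<phi> ((x + \<sigma> *\<^sub>R a) + 0 *\<^sub>R b) =
        (t - 0) * dir_deriv b (dir_deriv a \<phi>) ((x + \<sigma> *\<^sub>R a) + \<tau> *\<^sub>R b)"
      by blast
    have "norm (\<sigma> *\<^sub>R a + \<tau> *\<^sub>R b) \<le> \<sigma> + \<tau>"
      using norm_triangle_ineq[of "\<sigma> *\<^sub>R a" "\<tau> *\<^sub>R b"] \<sigma> \<tau> a b by (simp add: norm_Basis)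
    then have "dist ((x + \<sigma> *\<^sub>R a) + \<tau> *\<^sub>R b) x \<le> 2 * t" using \<sigma> \<tau> by (simp add: dist_norm add.assoc)
    moreover have "\<phi> (x + t *\<^sub>R b + t *\<^sub>R a) - \<phi> (x + t *\<^sub>R a) - \<phi> (x + t *\<^sub>R b) + \<phi> x =
      t * t * dir_deriv b (dir_deriv a \<phi>) ((x + \<sigma> *\<^sub>R a) + \<tau> *\<^sub>R b)"
    proof -
      have e: "(x + t *\<^sub>R b) + \<sigma> *\<^sub>R a = (x + \<sigma> *\<^sub>R a) + t *\<^sub>R b" by (simp add: algebra_simps)
      have "\<phi> (x + t *\<^sub>R b + t *\<^sub>R a) - \<phi> (x + t *\<^sub>R a) - \<phi> (x + t *\<^sub>R b) + \<phi> x =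
          t * (dir_deriv a \<phi> ((x + t *\<^sub>R b) + \<sigma> *\<^sub>R a) - dir_deriv a \<phi> (x + \<sigma> *\<^sub>R a))"
        using \<sigma>(3) by simp
      also have "\<dots> = t * (t * dir_deriv b (dir_deriv a \<phi>) ((x + \<sigma> *\<^sub>R a) + \<tau> *\<^sub>R b))"
        using \<tau>(3) unfolding e by simp
      finally show ?thesis by simp
    qed
    ultimately show ?thesis by blast
  qed
  fix x assume ne: "dir_deriv a (dir_deriv b \<phi>) x \<noteq> dir_deriv b (dir_deriv a \<phi>) x"
  let ?A = "dir_deriv a (dir_deriv b \<phi>)" and ?B = "dir_deriv b (dir_deriv a \<phi>)"
  define \<epsilon> where "\<epsilon> = dist (?A x) (?B x) / 2"
  have \<epsilon>: "\<epsilon> > 0" using ne by (simp add: \<epsilon>_def)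
  have c: "isCont ?A x" "isCont ?B x"
    by (intro smooth_isCont smooth_dir_deriv s a b)+
  obtain d1 where d1: "d1 > 0" "\<forall>y. dist y x < d1 \<longrightarrow> dist (?A y) (?A x) < \<epsilon>"
    using c(1)[unfolded continuous_at_eps_delta, rule_format, OF \<epsilon>] by blast
  obtain d2 where d2: "d2 > 0" "\<forall>y. dist y x < d2 \<longrightarrow> dist (?B y) (?B x) < \<epsilon>"
    using c(2)[unfolded continuous_at_eps_delta, rule_format, OF \<epsilon>] by blast
  note d = d1 d2
  \<comment> \<open>A third, because the mean value points are only known to lie within
    \<open>2 * t\<close> of \<open>x\<close>.\<close>
  define t where "t = min d1 d2 / 3"
  have t: "t > 0" "2 * t < d1" "2 * t < d2" using d by (auto simp: t_def)
  obtain p q where p: "dist p x \<le> 2 * t" "dist q x \<le> 2 * t" and pq: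
    "\<phi> (x + t *\<^sub>R b + t *\<^sub>R a) - \<phi> (x + t *\<^sub>R a) - \<phi> (x + t *\<^sub>R b) + \<phi> x = t * t * ?B p"
    "\<phi> (x + t *\<^sub>R a + t *\<^sub>R b) - \<phi> (x + t *\<^sub>R b) - \<phi> (x + t *\<^sub>R a) + \<phi> x = t * t * ?A q"
    using mvt[OF t(1) a b, of x] mvt[OF t(1) b a, of x] by metis
  have e: "x + t *\<^sub>R a + t *\<^sub>R b = x + t *\<^sub>R b + t *\<^sub>R a" by (simp add: algebra_simps)
  have "t * t * ?B p = t * t * ?A q" using pq unfolding e by linarith
  then have "?B p = ?A q" using t by simp
  moreover have "dist (?A q) (?A x) < \<epsilon>" "dist (?B p) (?B x) < \<epsilon>" using d1(2)[rule_format, of q] d2(2)[rule_format, of p] p t by auto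
  ultimately have "dist (?A x) (?B x) < \<epsilon> + \<epsilon>"
    by (auto simp: dist_real_def)
  then show False by (simp add: \<epsilon>_def)
qed

lemma dir_deriv_iter_deriv_commute:
  "smooth \<phi> \<Longrightarrow> set bs \<subseteq> Basis \<Longrightarrow> b \<in> Basis \<Longrightarrow>
    iter_deriv bs (dir_deriv b \<phi>) = dir_deriv b (iter_deriv bs \<phi>)"
proof (induction bs)
  case (Cons c bs)
  then show ?case
    using dir_deriv_commute[of "iter_deriv bs \<phi>" c b] smooth_iter_deriv by auto
qed simp

lemma iter_deriv_perm:
  "smooth \<phi> \<Longrightarrow> set bs \<subseteq> Basis \<Longrightarrow> mset bs = mset cs \<Longrightarrow> iter_deriv bs \<phi> = iter_deriv cs \<phi>"
proof (induction bs arbitrary: cs)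
  case (Cons b bs)
  then have "b \<in> set cs" by (metis list.set_intros(1) mset_eq_setD)
  then obtain xs ys where cs: "cs = xs @ b # ys" by (meson split_list)
  then have m: "mset bs = mset (xs @ ys)" using Cons.prems by simp
  then have "set bs = set xs \<union> set ys" by (metis mset_eq_setD set_append)
  then have sub: "set xs \<subseteq> Basis" "set ys \<subseteq> Basis" using Cons.prems by auto
  have "iter_deriv (b # bs) \<phi> = dir_deriv b (iter_deriv (xs @ ys) \<phi>)"
    using Cons.IH[OF Cons.prems(1) _ m] Cons.prems(2) by simp
  also have "\<dots> = iter_deriv cs \<phi>"
    using dir_deriv_iter_deriv_commute[OF smooth_iter_deriv[OF Cons.prems(1) sub(2)] sub(1), of b] Cons.prems(2)
    by (simp add: cs iter_deriv_append)
  finally show ?case .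
qed simp

section \<open>Test functions\<close>

text \<open>A family closed under differentiation: all derivatives of \<open>exp (- (1 / x))\<close>
  are polynomials in \<open>1 / x\<close> times this exponential, extended by 0.\<close>

definition bump :: "real poly \<Rightarrow> real \<Rightarrow> real" where
  "bump P x = (if x > 0 then poly P (1 / x) * exp (- (1 / x)) else 0)"

lemma poly_exp_tendsto_0: "((\<lambda>y. poly P y * exp (- y)) \<longlongrightarrow> (0::real)) at_top"
proof -
  have "((\<lambda>y. \<Sum>i\<le>degree P. coeff P i * (y ^ i / exp y)) \<longlongrightarrow> (\<Sum>i\<le>degree P. coeff P i * 0)) at_top"
    by (intro tendsto_intros tendsto_power_div_exp_0)
  moreover have "(\<lambda>y. \<Sum>i\<le>degree P. coeff P i * (y ^ i / exp y)) = (\<lambda>y. poly P y * exp (- y))"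
    by (simp add: poly_altdef exp_minus sum_distrib_right divide_inverse mult.assoc)
  ultimately show ?thesis by simp
qed

text \<open>For \<open>x > 0\<close>, differentiating the polynomial in \<open>1 / x\<close> brings
  \<open>pderiv P\<close> with the factor \<open>- 1 / x^2\<close>, and the exponential brings
  \<open>1 / x^2\<close>; hence \<open>monom 1 2 * (P - pderiv P)\<close>. At 0 the exponential
  beats every polynomial in \<open>1 / h\<close>.\<close>

lemma bump_deriv: "(bump P has_real_derivative bump (monom 1 2 * (P - pderiv P)) x) (at x)"
proof -
  consider "x > 0" | "x < 0" | "x = 0" by linarith
  then show ?thesis
  proof cases
    case 1
    have "((\<lambda>x. poly P (1 / x) * exp (- (1 / x))) has_real_derivative
        bump (monom 1 2 * (P - pderiv P)) x) (at x)"
      using 1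
      by (auto intro!: derivative_eq_intros poly_DERIV[THEN DERIV_chain2]
          simp: bump_def poly_monom field_simps power2_eq_square)
    moreover have "eventually (\<lambda>y. bump P y = poly P (1 / y) * exp (- (1 / y))) (nhds x)"
      using eventually_nhds_in_open[of "{0<..}" x] 1 by (auto elim!: eventually_mono simp: bump_def)
    ultimately show ?thesis by (simp only: DERIV_cong_ev[OF refl _ refl])
  next
    case 2
    have "((\<lambda>x. 0) has_real_derivative bump (monom 1 2 * (P - pderiv P)) x) (at x)"
      using 2 by (simp add: bump_def)
    moreover have "eventually (\<lambda>y. bump P y = 0) (nhds x)"
      using eventually_nhds_in_open[of "{..<0}" x] 2 by (auto elim!: eventually_mono simp: bump_def)
    ultimately show ?thesis by (simp only: DERIV_cong_ev[OF refl _ refl])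
  next
    case 3
    have "((\<lambda>h. bump P h / h) \<longlongrightarrow> 0) (at_right 0)"
    proof -
      \<comment> \<open>The division by \<open>h\<close> is absorbed into the polynomial:
        \<open>pCons 0 P\<close> multiplies \<open>P\<close> by its variable, which takes the value
        \<open>1 / h\<close>.\<close>
      have "((\<lambda>h. poly (pCons 0 P) (inverse h) * exp (- inverse h)) \<longlongrightarrow> 0) (at_right 0)"
        by (rule filterlim_compose[OF poly_exp_tendsto_0 filterlim_inverse_at_top_right])
      moreover have "eventually (\<lambda>h::real. poly (pCons 0 P) (inverse h) * exp (- inverse h) = bump P h / h) (at_right 0)"
        by (simp add: eventually_at_filter bump_def field_simps)
      ultimately show ?thesis by (rule Lim_transform_eventually)
    qed
    moreover have "((\<lambda>h. bump P h / h) \<longlongrightarrow> 0) (at_left 0)"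
      by (rule tendsto_eventually) (simp add: eventually_at_filter bump_def)
    ultimately have "((\<lambda>h. bump P h / h) \<longlongrightarrow> 0) (at 0)"
      by (simp add: filterlim_split_at)
    then show ?thesis using 3 by (simp add: DERIV_def bump_def)
  qed
qed

lemma dir_deriv_real: "(\<theta> has_real_derivative d) (at x) \<Longrightarrow> dir_deriv b \<theta> x = d * b"
  using dir_deriv_eqI[of \<theta> "(*) d" x b] by (simp add: has_field_derivative_def)

lemma smooth_bump: "smooth (bump P)"
proof (rule smooth_coinduct)
  show "bump P \<in> range bump" by simp
  fix \<psi> assume "\<psi> \<in> range bump"
  then obtain Q where Q: "\<psi> = bump Q" by auto
  have "dir_deriv 1 \<psi> = bump (monom 1 2 * (Q - pderiv Q))"
    unfolding Q by (rule ext) (simp add: dir_deriv_real[OF bump_deriv])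
  moreover have "\<psi> differentiable (at x)" for x
    using bump_deriv[of Q x] unfolding Q by (auto simp: differentiable_def has_field_derivative_def)
  ultimately show "(\<forall>x. \<psi> differentiable (at x)) \<and> (\<forall>b\<in>Basis. dir_deriv b \<psi> \<in> range bump)"
    by auto
qed

definition flat :: "real \<Rightarrow> real" where "flat x = (if x > 0 then exp (- (1 / x)) else 0)"

lemma smooth_flat: "smooth flat"
proof -
  have "flat = bump 1" by (auto simp: flat_def bump_def)
  then show ?thesis using smooth_bump[of 1] by simp
qed

lemma flat_pos_iff: "flat x > 0 \<longleftrightarrow> x > 0" and flat_nonneg: "flat x \<ge> 0" and flat_le_1: "flat x \<le> 1"
  and flat_nonpos: "x \<le> 0 \<Longrightarrow> flat x = 0"
  by (auto simp: flat_def)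

definition step :: "real \<Rightarrow> real" where "step x = flat x * inverse (flat x + flat (1 - x))"

lemma flat_sum_pos: "flat x + flat (1 - x) > 0"
  by (cases "x > 0") (auto simp: flat_pos_iff intro: add_pos_nonneg add_nonneg_pos flat_nonneg)

lemma smooth_step: "smooth step"
proof -
  have "smooth (\<lambda>x::real. 1 - x)" using smooth_affine[of "-1::real" 1] by simp
  then have "smooth (\<lambda>x. flat (1 - x))" by (rule smooth_comp[OF smooth_flat])
  then have "smooth (\<lambda>x. inverse (flat x + flat (1 - x)))"
    using flat_sum_pos by (intro smooth_inverse smooth_add smooth_flat) (auto simp: less_le)
  then have "smooth (\<lambda>x. flat x * inverse (flat x + flat (1 - x)))"
    by (intro smooth_mult smooth_flat)
  then show ?thesis by (simp add: step_def[abs_def])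
qed

lemma step_0: "x \<le> 0 \<Longrightarrow> step x = 0" and step_1: "x \<ge> 1 \<Longrightarrow> step x = 1"
  using flat_pos_iff[of x] by (auto simp: step_def flat_nonpos)

lemma compact_support_iff: "compact (closure S) \<longleftrightarrow> bounded (S :: 'a::euclidean_space set)"
  by (metis bounded_closure bounded_subset closed_closure closure_subset compact_eq_bounded_closed)

lemma test_functionI: "smooth \<phi> \<Longrightarrow> bounded {x. \<phi> x \<noteq> 0} \<Longrightarrow> test_function \<phi>"
  by (simp add: test_function_def compact_support_iff)

lemma test_function_smooth: "test_function \<phi> \<Longrightarrow> smooth \<phi>"
  and test_function_bounded_support: "test_function \<phi> \<Longrightarrow> bounded {x. \<phi> x \<noteq> 0}"
  by (simp_all add: test_function_def compact_support_iff)

lemma test_function_mult_left: "smooth \<phi> \<Longrightarrow> test_function \<psi> \<Longrightarrow> test_function (\<lambda>x. \<phi> x * \<psi> x)"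
  by (rule test_functionI[OF smooth_mult])
    (auto intro: test_function_smooth bounded_subset[OF test_function_bounded_support])

lemma test_function_shift:
  assumes "test_function \<phi>" shows "test_function (\<lambda>x. \<phi> (x + a))"
proof (rule test_functionI)
  show "smooth (\<lambda>x. \<phi> (x + a))" using assms by (intro smooth_shift test_function_smooth)
  have "{x. \<phi> (x + a) \<noteq> 0} = (\<lambda>x. x - a) ` {x. \<phi> x \<noteq> 0}"
  proof safe
    fix x assume "\<phi> (x + a) \<noteq> 0"
    then show "x \<in> (\<lambda>x. x - a) ` {x. \<phi> x \<noteq> 0}" by (intro image_eqI[of _ _ "x + a"]) auto
  qed auto
  then show "bounded {x. \<phi> (x + a) \<noteq> 0}"
    using bounded_translation_minus[OF test_function_bounded_support[OF assms]] by simp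
qed

lemma dir_deriv_eq_0:
  assumes "open U" "x \<in> U" "\<And>y. y \<in> U \<Longrightarrow> \<phi> y = 0" shows "dir_deriv b \<phi> x = 0"
proof -
  have "((\<lambda>_. 0) has_derivative (\<lambda>_. 0)) (at x)" by simp
  then have "(\<phi> has_derivative (\<lambda>_. 0)) (at x)"
    by (rule has_derivative_transform_within_open[OF _ assms(1,2)]) (use assms(3) in simp)
  then show ?thesis by (rule dir_deriv_eqI)
qed

lemma dir_deriv_support: "{x. dir_deriv b \<phi> x \<noteq> 0} \<subseteq> closure {x. \<phi> x \<noteq> 0}"
proof
  fix x assume x: "x \<in> {x. dir_deriv b \<phi> x \<noteq> 0}"
  show "x \<in> closure {x. \<phi> x \<noteq> 0}"
  proof (rule ccontr)
    assume "x \<notin> closure {x. \<phi> x \<noteq> 0}"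
    then have U: "x \<in> - closure {x. \<phi> x \<noteq> 0}" "open (- closure {x. \<phi> x \<noteq> 0})" by auto
    have Z: "\<phi> y = 0" if "y \<in> - closure {x. \<phi> x \<noteq> 0}" for y
      using that closure_subset[of "{x. \<phi> x \<noteq> 0}"] by auto
    have "dir_deriv b \<phi> x = 0"
      by (rule dir_deriv_eq_0[OF U(2) U(1) Z])
    then show False using x by simp
  qed
qed

lemma test_function_dir_deriv:
  assumes "test_function \<phi>" "b \<in> Basis" shows "test_function (dir_deriv b \<phi>)"
proof (rule test_functionI)
  show "smooth (dir_deriv b \<phi>)" using assms by (intro smooth_dir_deriv test_function_smooth)
  show "bounded {x. dir_deriv b \<phi> x \<noteq> 0}"
    by (rule bounded_subset[OF bounded_closure[OF test_function_bounded_support[OF assms(1)]] dir_deriv_support])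
qed

lemma test_function_iter_deriv: "test_function \<phi> \<Longrightarrow> set bs \<subseteq> Basis \<Longrightarrow> test_function (iter_deriv bs \<phi>)"
  by (induction bs) (auto intro: test_function_dir_deriv)

lemma test_function_continuous: "test_function \<phi> \<Longrightarrow> continuous_on S \<phi>"
  by (rule smooth_continuous[OF test_function_smooth])

lemma test_function_cball:
  assumes "test_function \<phi>" obtains R where "R > 0" "{x. \<phi> x \<noteq> 0} \<subseteq> cball 0 R"
proof -
  obtain R where "\<forall>x\<in>{x. \<phi> x \<noteq> 0}. norm x \<le> R"
    using test_function_bounded_support[OF assms] unfolding bounded_iff by blast
  then show ?thesis by (intro that[of "max R 1"]) (auto simp: le_max_iff_disj)
qed

lemma test_function_bounded:
  assumes "test_function \<phi>" obtains B where "B > 0" "\<forall>x. \<bar>\<phi> x\<bar> \<le> B"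
proof -
  obtain R where R: "R > 0" "{x. \<phi> x \<noteq> 0} \<subseteq> cball 0 R" by (rule test_function_cball[OF assms])
  have "bounded (\<phi> ` cball 0 R)"
    by (intro compact_imp_bounded compact_continuous_image test_function_continuous assms compact_cball)
  then obtain B where B: "B > 0" "\<forall>y\<in>\<phi> ` cball 0 R. norm y \<le> B" unfolding bounded_pos by auto
  have "\<bar>\<phi> x\<bar> \<le> B" for x
  proof (cases "\<phi> x = 0")
    case False
    then have "x \<in> cball 0 R" using R(2) by blast
    then show ?thesis using B(2) by simp
  qed (use B(1) in simp)
  then show ?thesis using that B(1) by blast
qed

section \<open>Locally integrable functions and distributional derivatives\<close>

text \<open>Borel functions and the uncompleted measure, because restriction to lines and Fubini's
  theorem need joint measurability, which a Lebesgue measurable representative does not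
  give.\<close>

definition loc_borel :: "('a::euclidean_space \<Rightarrow> real) \<Rightarrow> bool" where
  "loc_borel g \<longleftrightarrow> g \<in> borel_measurable borel \<and>
    (\<forall>R. integrable lborel (\<lambda>x. indicator (cball 0 R) x * g x))"

lemma loc_borel_measurable [measurable_dest]: "loc_borel g \<Longrightarrow> g \<in> borel_measurable borel"
  by (simp add: loc_borel_def)

lemma borel_measurable_lebesgue_cong_AE:
  fixes g g' :: "'a::euclidean_space \<Rightarrow> 'b::topological_space"
  assumes "g \<in> borel_measurable lebesgue" "AE x in lebesgue. g x = g' x"
  shows "g' \<in> borel_measurable lebesgue"
proof (rule measurableI)
  fix A :: "'b set" assume "A \<in> sets borel"
  with assms(1) have "g -` A \<inter> space lebesgue \<in> sets lebesgue" by (rule measurable_sets)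
  moreover have "AE x in lebesgue. x \<in> g -` A \<inter> space lebesgue \<longleftrightarrow> x \<in> g' -` A \<inter> space lebesgue"
    using assms(2) by eventually_elim auto
  ultimately show "g' -` A \<inter> space lebesgue \<in> sets lebesgue"
    by (intro completion.in_sets_AE[of "g -` A \<inter> space lebesgue" "g' -` A \<inter> space lebesgue" lborel]) auto
qed simp

lemma locally_integrable_cong_AE:
  assumes "locally_integrable g" "AE x in lebesgue. g x = g' x"
  shows "locally_integrable g'"
  unfolding locally_integrable_def set_integrable_def
proof (intro allI impI)
  fix K :: "'a set" assume "compact K"
  then have *: "integrable lebesgue (\<lambda>x. indicator K x *\<^sub>R g x)"
    using assms(1) by (simp add: locally_integrable_def set_integrable_def)
  have AE: "AE x in lebesgue. indicator K x *\<^sub>R g x = indicator K x *\<^sub>R g' x"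
    using assms(2) by eventually_elim simp
  show "integrable lebesgue (\<lambda>x. indicator K x *\<^sub>R g' x)"
    using * borel_measurable_lebesgue_cong_AE[OF borel_measurable_integrable[OF *] AE] AE
    by (subst integrable_cong_AE[of _ _ "\<lambda>x. indicator K x *\<^sub>R g x"]) auto
qed

lemma locally_integrable_measurable:
  assumes "locally_integrable (g :: 'a::euclidean_space \<Rightarrow> real)"
  shows "g \<in> borel_measurable lebesgue"
proof (rule borel_measurable_LIMSEQ_real)
  fix x :: 'a
  obtain N :: nat where N: "norm x \<le> real N" using real_arch_simple by blast
  have "(\<lambda>n. indicator (cball 0 (real n)) x *\<^sub>R g x) \<longlonglongrightarrow> g x"
    by (rule tendsto_eventually, rule eventually_sequentiallyI[of N]) (use N in \<open>auto simp: indicator_def\<close>)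
  then show "(\<lambda>n. indicator (cball 0 (real n)) x *\<^sub>R g x) \<longlonglongrightarrow> g x" .
next
  fix n :: nat
  show "(\<lambda>x. indicator (cball 0 (real n)) x *\<^sub>R g x) \<in> borel_measurable lebesgue"
    using assms by (intro borel_measurable_integrable) (simp add: locally_integrable_def set_integrable_def)
qed

lemma indicator_cball_mult_measurable:
  "g \<in> borel_measurable borel \<Longrightarrow> (\<lambda>x. indicator (cball 0 R) x * g x :: real) \<in> borel_measurable lborel"
  by (simp add: borel_measurable_times borel_measurable_indicator)

lemma loc_borel_imp_locally_integrable:
  assumes "loc_borel g" shows "locally_integrable g"
  unfolding locally_integrable_def
proof (intro allI impI)
  fix K :: "'a set" assume K: "compact K"
  then obtain R where R: "K \<subseteq> cball 0 R"
    using compact_imp_bounded[OF K] by (auto simp: bounded_iff mem_cball subset_iff)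
  have "set_integrable lebesgue (cball 0 R) g"
    unfolding set_integrable_def
    using assms indicator_cball_mult_measurable[of g R] by (subst integrable_completion) (auto simp: loc_borel_def)
  then show "set_integrable lebesgue K g"
    by (rule set_integrable_subset) (use K R in \<open>auto intro: lmeasurable_compact fmeasurableD\<close>)
qed

lemma loc_borel_rep:
  assumes "locally_integrable (g :: 'a::euclidean_space \<Rightarrow> real)"
  shows "\<exists>g0. loc_borel g0 \<and> (AE x in lebesgue. g x = g0 x)"
proof -
  obtain g0 where g0: "g0 \<in> borel_measurable lborel" "AE x in lborel. g x = g0 x"
    using completion_ex_borel_measurable_real[OF locally_integrable_measurable[OF assms]] by auto
  have AE: "AE x in lebesgue. g x = g0 x" using g0(2) by (rule AE_completion)
  have "locally_integrable g0" by (rule locally_integrable_cong_AE[OF assms AE])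
  then have "integrable lebesgue (\<lambda>x. indicator (cball 0 R) x * g0 x)" for R
    by (simp add: locally_integrable_def set_integrable_def)
  then have "loc_borel g0"
    using g0(1) integrable_completion[OF indicator_cball_mult_measurable[of g0]] by (simp add: loc_borel_def)
  with AE show ?thesis by blast
qed

lemma loc_borel_mult_integrable:
  assumes g: "loc_borel g" and [measurable]: "\<psi> \<in> borel_measurable borel"
    and B: "\<And>x. \<bar>\<psi> x\<bar> \<le> B" and bd: "bounded {x. \<psi> x \<noteq> 0}"
  shows "integrable lborel (\<lambda>x. g x * \<psi> x)"
proof -
  have [measurable]: "g \<in> borel_measurable borel" using g by (simp add: loc_borel_def)
  obtain R where R: "\<forall>x\<in>{x. \<psi> x \<noteq> 0}. norm x \<le> R" using bd unfolding bounded_iff by blast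
  have B0: "B \<ge> 0" using B[of 0] by linarith
  have "integrable lborel (\<lambda>x. B * (indicator (cball 0 R) x * g x))"
    using g by (intro integrable_mult_right) (simp add: loc_borel_def)
  then show ?thesis
  proof (rule Bochner_Integration.integrable_bound)
    show "AE x in lborel. norm (g x * \<psi> x) \<le> norm (B * (indicator (cball 0 R) x * g x))"
    proof (rule AE_I2)
      fix x
      show "norm (g x * \<psi> x) \<le> norm (B * (indicator (cball 0 R) x * g x))"
      proof (cases "\<psi> x = 0")
        case False
        then have "x \<in> cball 0 R" using R by simp
        moreover have "\<bar>g x\<bar> * \<bar>\<psi> x\<bar> \<le> \<bar>g x\<bar> * B" by (rule mult_left_mono[OF B]) simp
        ultimately show ?thesis using B0 by (simp add: abs_mult mult.commute)
      qed simp
    qed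
  qed simp
qed

lemma test_function_borel [measurable_dest]:
  "test_function \<phi> \<Longrightarrow> \<phi> \<in> borel_measurable borel"
  by (intro borel_measurable_continuous_onI test_function_continuous)

lemma loc_borel_test_integrable:
  assumes "loc_borel g" "test_function \<phi>" shows "integrable lborel (\<lambda>x. g x * \<phi> x)"
proof -
  obtain B where "B > 0" and B: "\<forall>x. \<bar>\<phi> x\<bar> \<le> B" by (rule test_function_bounded[OF assms(2)])
  show ?thesis
    by (rule loc_borel_mult_integrable[OF assms(1) test_function_borel[OF assms(2)] B[rule_format]
        test_function_bounded_support[OF assms(2)]])
qed

lemma test_function_box:
  fixes a b :: "'a::euclidean_space"
  shows "\<exists>\<phi>. test_function \<phi> \<and> (\<forall>x. 0 \<le> \<phi> x \<and> \<phi> x \<le> 1 \<and> (\<phi> x > 0 \<longleftrightarrow> x \<in> box a b))"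
proof -
  define \<phi> where "\<phi> x = (\<Prod>i\<in>Basis. flat (x \<bullet> i + (- (a \<bullet> i))) * flat (x \<bullet> (-i) + b \<bullet> i))" for x
  have nn: "0 \<le> flat (x \<bullet> i + (- (a \<bullet> i))) * flat (x \<bullet> (-i) + b \<bullet> i)" for x i
    by (intro mult_nonneg_nonneg flat_nonneg)
  have pos: "\<phi> x > 0 \<longleftrightarrow> x \<in> box a b" for x
  proof -
    have "\<phi> x > 0 \<longleftrightarrow> (\<forall>i\<in>Basis. flat (x \<bullet> i + (- (a \<bullet> i))) * flat (x \<bullet> (-i) + b \<bullet> i) > 0)"
    proof
      assume "\<phi> x > 0"
      then show "\<forall>i\<in>Basis. flat (x \<bullet> i + (- (a \<bullet> i))) * flat (x \<bullet> (-i) + b \<bullet> i) > 0"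
        using nn[of x] unfolding \<phi>_def by (metis (no_types, lifting) finite_Basis less_irrefl order_le_less prod_zero_iff)
    qed (auto simp: \<phi>_def intro!: prod_pos)
    also have "\<dots> \<longleftrightarrow> (\<forall>i\<in>Basis. x \<bullet> i + (- (a \<bullet> i)) > 0 \<and> x \<bullet> (-i) + b \<bullet> i > 0)"
      using flat_pos_iff flat_nonneg by (simp add: zero_less_mult_iff not_less[symmetric] del: not_less)
    also have "\<dots> \<longleftrightarrow> x \<in> box a b" by (auto simp: mem_box)
    finally show ?thesis .
  qed
  have nn\<phi>: "\<phi> x \<ge> 0" for x unfolding \<phi>_def by (intro prod_nonneg nn)
  have "smooth \<phi>"
    unfolding \<phi>_def[abs_def]
    by (intro smooth_prod smooth_mult smooth_comp[OF smooth_flat] smooth_affine) simp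
  moreover have "bounded {x. \<phi> x \<noteq> 0}"
    by (rule bounded_subset[OF bounded_box[of a b]]) (use pos nn\<phi> in \<open>auto simp: less_le\<close>)
  moreover have "\<phi> x \<le> 1" for x
    unfolding \<phi>_def by (intro prod_le_1 conjI nn mult_le_one flat_le_1 flat_nonneg)
  ultimately show ?thesis using pos nn\<phi> test_functionI by (intro exI[of _ \<phi>]) auto
qed

text \<open>Indicators of boxes are limits of the test functions \<open>1 - (1 - \<phi>) ^ j\<close>.\<close>

lemma fundamental_lemma:
  fixes k :: "'a::euclidean_space \<Rightarrow> real"
  assumes k: "loc_borel k" and zero: "\<And>\<phi>. test_function \<phi> \<Longrightarrow> (\<integral>x. k x * \<phi> x \<partial>lborel) = 0"
  shows "AE x in lborel. k x = 0"
proof -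
  have [measurable]: "k \<in> borel_measurable borel" using k by (simp add: loc_borel_def)
  have int: "integrable lborel (\<lambda>x. k x * indicator (box a b) x)" for a b
    by (rule loc_borel_mult_integrable[OF k, of _ 1]) (auto simp: indicator_def intro: bounded_subset[OF bounded_box[of a b]])
  have box: "(\<integral>x. k x * indicator (box a b) x \<partial>lborel) = 0" for a b
  proof -
    obtain \<phi> where \<phi>: "test_function \<phi>" and \<phi>b: "\<forall>x. 0 \<le> \<phi> x \<and> \<phi> x \<le> 1 \<and> (\<phi> x > 0 \<longleftrightarrow> x \<in> box a b)"
      using test_function_box[of a b] by blast
    have [measurable]: "\<phi> \<in> borel_measurable borel" using \<phi> by (rule test_function_borel)
    define \<psi> where "\<psi> j x = 1 - (1 - \<phi> x) ^ j" for j x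
    have bd: "\<bar>\<psi> j x\<bar> \<le> indicator (box a b) x" for j x
    proof (cases "x \<in> box a b")
      case True
      have "0 \<le> (1 - \<phi> x) ^ j" "(1 - \<phi> x) ^ j \<le> 1"
        using \<phi>b by (auto intro!: zero_le_power power_le_one)
      then show ?thesis using True by (simp add: \<psi>_def)
    next
      case False
      then have "\<phi> x = 0" using \<phi>b by (metis less_le)
      then show ?thesis by (simp add: \<psi>_def)
    qed
    have test: "test_function (\<psi> j)" for j
    proof (rule test_functionI)
      show "smooth (\<psi> j)" unfolding \<psi>_def[abs_def]
        by (intro smooth_diff smooth_power smooth_const test_function_smooth \<phi>)
      show "bounded {x. \<psi> j x \<noteq> 0}"
      proof (rule bounded_subset[OF bounded_box[of a b]], rule subsetI, rule ccontr)
        fix x assume "x \<in> {x. \<psi> j x \<noteq> 0}" "x \<notin> box a b"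
        then show False using bd[of j x] by simp
      qed
    qed
    have lim: "(\<lambda>j. \<psi> j x) \<longlonglongrightarrow> indicator (box a b) x" for x
    proof (cases "x \<in> box a b")
      case True
      then have "0 \<le> 1 - \<phi> x" "1 - \<phi> x < 1" using \<phi>b by auto
      then have "(\<lambda>j. 1 - (1 - \<phi> x) ^ j) \<longlonglongrightarrow> 1 - 0" by (intro tendsto_intros LIMSEQ_power_zero) auto
      then show ?thesis using True by (simp add: \<psi>_def)
    next
      case False
      then show ?thesis using bd[of _ x] by simp
    qed
    have "(\<lambda>j. \<integral>x. k x * \<psi> j x \<partial>lborel) \<longlonglongrightarrow> (\<integral>x. k x * indicator (box a b) x \<partial>lborel)"
    proof (rule integral_dominated_convergence)
      show "integrable lborel (\<lambda>x. \<bar>k x * indicator (box a b) x\<bar>)" using int by (rule integrable_abs)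
      show "AE x in lborel. (\<lambda>j. k x * \<psi> j x) \<longlonglongrightarrow> k x * indicator (box a b) x"
        by (intro AE_I2 tendsto_intros lim)
      show "AE x in lborel. norm (k x * \<psi> j x) \<le> \<bar>k x * indicator (box a b) x\<bar>" for j
        using bd[of j] by (intro AE_I2) (auto simp: abs_mult intro!: mult_left_mono)
    qed (auto simp: \<psi>_def)
    then have "(\<lambda>j::nat. 0) \<longlonglongrightarrow> (\<integral>x. k x * indicator (box a b) x \<partial>lborel)"
      using zero[OF test] by simp
    then show ?thesis using LIMSEQ_unique tendsto_const by blast
  qed
  \<comment> \<open>Positive and negative part of \<open>k\<close> as densities. The two measures
    agree on boxes, which are stable under intersection and generate the Borel sets; so they
    coincide, and densities are unique almost everywhere.\<close>
  define M where "M s = density lborel (\<lambda>x. ennreal (max 0 (s * k x)))" for s :: real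
  have em: "emeasure (M s) A = (\<integral>\<^sup>+x. ennreal (max 0 (s * k x) * indicator A x) \<partial>lborel)"
    if "A \<in> sets borel" for A s
    using that unfolding M_def by (subst emeasure_density) (auto intro!: nn_integral_cong simp: indicator_def)
  have intm: "integrable lborel (\<lambda>x. max 0 (s * k x) * indicator (box a b) x)" for a b s
  proof (rule Bochner_Integration.integrable_bound[OF integrable_mult_right[OF int, of "\<bar>s\<bar>" a b]])
    have "max 0 (s * k x) \<le> \<bar>s\<bar> * \<bar>k x\<bar>" for x
      by (simp add: abs_mult[symmetric])
    then show "AE x in lborel. norm (max 0 (s * k x) * indicator (box a b) x) \<le>
        norm (\<bar>s\<bar> * (k x * indicator (box a b) x))"
      by (intro AE_I2) (auto simp: indicator_def abs_mult)
  qed simp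
  have embox: "emeasure (M s) (box a b) = ennreal (\<integral>x. max 0 (s * k x) * indicator (box a b) x \<partial>lborel)" for a b s
    by (subst em) (auto intro!: nn_integral_eq_integral intm simp: box_borel)
  have eqbox: "emeasure (M 1) (box a b) = emeasure (M (-1)) (box a b)" for a b
  proof -
    have "(\<integral>x. max 0 (1 * k x) * indicator (box a b) x \<partial>lborel) - (\<integral>x. max 0 (-1 * k x) * indicator (box a b) x \<partial>lborel)
      = (\<integral>x. max 0 (1 * k x) * indicator (box a b) x - max 0 (-1 * k x) * indicator (box a b) x \<partial>lborel)"
      by (rule Bochner_Integration.integral_diff[symmetric]) (rule intm)+
    also have "\<dots> = (\<integral>x. k x * indicator (box a b) x \<partial>lborel)"
      by (rule Bochner_Integration.integral_cong) (auto simp: indicator_def)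
    finally show ?thesis unfolding embox using box[of a b] by simp
  qed
  have "M 1 = M (-1)"
  proof (rule measure_eqI_generator_eq)
    let ?E = "range (\<lambda>(a, b). box a b :: 'a set)"
    show "Int_stable ?E" by (auto simp: Int_stable_def box_Int_box)
    show "?E \<subseteq> Pow UNIV" "sets (M 1) = sigma_sets UNIV ?E" "sets (M (-1)) = sigma_sets UNIV ?E"
      by (simp_all add: M_def borel_eq_box)
    let ?A = "\<lambda>n::nat. box (- (real n *\<^sub>R One)) (real n *\<^sub>R One) :: 'a set"
    show "range ?A \<subseteq> ?E" "(\<Union>i. ?A i) = UNIV"
      unfolding UN_box_eq_UNIV by auto
    show "emeasure (M 1) X = emeasure (M (-1)) X" if "X \<in> ?E" for X
      using that eqbox by auto
    show "emeasure (M 1) (?A i) \<noteq> \<infinity>" for i unfolding embox by simp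
  qed
  then have "AE x in lborel. ennreal (max 0 (1 * k x)) = ennreal (max 0 (-1 * k x))"
    unfolding M_def by (intro sigma_finite_measure.density_unique[OF sigma_finite_lborel]) auto
  then show ?thesis
    by eventually_elim (auto simp: max_def split: if_splits)
qed

lemma lebesgue_integral_cong_borel:
  assumes "AE x in lebesgue. g x = g0 x" "g0 \<in> borel_measurable borel" "\<phi> \<in> borel_measurable borel"
  shows "(\<integral>x. g x * \<phi> x \<partial>lebesgue) = (\<integral>x. g0 x * \<phi> x \<partial>lborel :: real)"
proof -
  have m: "(\<lambda>x. g0 x * \<phi> x) \<in> borel_measurable lborel" using assms by simp
  have AE: "AE x in lebesgue. g0 x * \<phi> x = g x * \<phi> x" using assms(1) by eventually_elim simp
  have "(\<integral>x. g x * \<phi> x \<partial>lebesgue) = (\<integral>x. g0 x * \<phi> x \<partial>lebesgue)"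
    using borel_measurable_lebesgue_cong_AE[OF measurable_completion[OF m] AE] AE measurable_completion[OF m]
    by (intro integral_cong_AE) (auto elim: eventually_mono)
  also have "\<dots> = (\<integral>x. g0 x * \<phi> x \<partial>lborel)" using m by (rule integral_completion)
  finally show ?thesis .
qed

section \<open>Distributional derivatives on Borel representatives\<close>

definition borel_deriv :: "'a::euclidean_space list \<Rightarrow> ('a \<Rightarrow> real) \<Rightarrow> ('a \<Rightarrow> real) \<Rightarrow> bool" where
  "borel_deriv bs g h \<longleftrightarrow> loc_borel g \<and> loc_borel h \<and>
     (\<forall>\<phi>. test_function \<phi> \<longrightarrow> (\<integral>x. g x * iter_deriv bs \<phi> x \<partial>lborel) =
        (-1) ^ length bs * (\<integral>x. h x * \<phi> x \<partial>lborel))"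

lemma distr_deriv_iff_borel:
  assumes "loc_borel g0" "loc_borel h0" "AE x in lebesgue. g x = g0 x" "AE x in lebesgue. h x = h0 x"
    and "set bs \<subseteq> Basis"
  shows "distr_deriv bs g h \<longleftrightarrow> borel_deriv bs g0 h0"
proof -
  have "AE x in lebesgue. g0 x = g x" "AE x in lebesgue. h0 x = h x"
    using assms(3,4) by (auto elim: eventually_mono)
  then have "locally_integrable g" "locally_integrable h"
    using assms(1,2) by (auto intro: locally_integrable_cong_AE loc_borel_imp_locally_integrable)
  then show ?thesis
    using assms
    by (simp add: distr_deriv_def borel_deriv_def loc_borel_measurable test_function_borel
        test_function_iter_deriv lebesgue_integral_cong_borel[of g g0] lebesgue_integral_cong_borel[of h h0])
qed

lemma distr_deriv_cong:
  assumes "distr_deriv bs g h" "AE x in lebesgue. g x = g' x" "AE x in lebesgue. h x = h' x" "set bs \<subseteq> Basis"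
  shows "distr_deriv bs g' h'"
proof -
  obtain g0 h0 where g0: "loc_borel g0" "AE x in lebesgue. g x = g0 x"
    and h0: "loc_borel h0" "AE x in lebesgue. h x = h0 x"
    using assms(1) loc_borel_rep unfolding distr_deriv_def by metis
  have 1: "AE x in lebesgue. g' x = g0 x" using g0(2) assms(2) by eventually_elim simp
  have 2: "AE x in lebesgue. h' x = h0 x" using h0(2) assms(3) by eventually_elim simp
  show ?thesis
    using assms(1) distr_deriv_iff_borel[OF g0(1) h0(1) g0(2) h0(2) assms(4)]
      distr_deriv_iff_borel[OF g0(1) h0(1) 1 2 assms(4)] by simp
qed

lemma borel_deriv_unique:
  assumes "borel_deriv bs g h" "borel_deriv bs g h'" shows "AE x in lborel. h x = h' x"
proof -
  have l: "loc_borel h" "loc_borel h'" using assms by (auto simp: borel_deriv_def)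
  have "loc_borel (\<lambda>x. h x - h' x)"
    using l by (auto simp: loc_borel_def right_diff_distrib)
  moreover have "(\<integral>x. (h x - h' x) * \<phi> x \<partial>lborel) = 0" if \<phi>: "test_function \<phi>" for \<phi>
  proof -
    have "(-1) ^ length bs * (\<integral>x. h x * \<phi> x \<partial>lborel) = (-1) ^ length bs * (\<integral>x. h' x * \<phi> x \<partial>lborel)"
      using assms \<phi> unfolding borel_deriv_def by metis
    then have "(\<integral>x. h x * \<phi> x \<partial>lborel) = (\<integral>x. h' x * \<phi> x \<partial>lborel)" by simp
    then show ?thesis using l \<phi> by (simp add: left_diff_distrib loc_borel_test_integrable)
  qed
  ultimately have "AE x in lborel. h x - h' x = 0" by (rule fundamental_lemma)
  then show ?thesis by simp
qed

lemma distr_deriv_unique: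
  assumes "distr_deriv bs g h" "distr_deriv bs g h'" "set bs \<subseteq> Basis"
  shows "AE x in lebesgue. h x = h' x"
proof -
  obtain g0 h0 h0' where g0: "loc_borel g0" "AE x in lebesgue. g x = g0 x"
    and h0: "loc_borel h0" "AE x in lebesgue. h x = h0 x"
    and h0': "loc_borel h0'" "AE x in lebesgue. h' x = h0' x"
    using assms(1,2) loc_borel_rep unfolding distr_deriv_def by metis
  have "AE x in lborel. h0 x = h0' x"
    using borel_deriv_unique distr_deriv_iff_borel[OF g0(1) h0(1) g0(2) h0(2) assms(3)]
      distr_deriv_iff_borel[OF g0(1) h0'(1) g0(2) h0'(2) assms(3)] assms by blast
  then have "AE x in lebesgue. h0 x = h0' x" by (rule AE_completion)
  then show ?thesis using h0(2) h0'(2) by eventually_elim simp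
qed

section \<open>Restriction to lines\<close>

lemma lborel_shift:
  fixes f :: "'a::euclidean_space \<Rightarrow> real"
  assumes [measurable]: "f \<in> borel_measurable borel"
  shows lborel_integrable_shift: "integrable lborel (\<lambda>x. f (x + a)) \<longleftrightarrow> integrable lborel f"
    and lborel_integral_shift: "(\<integral>x. f (x + a) \<partial>lborel) = (\<integral>x. f x \<partial>lborel)"
proof -
  have m: "(+) a \<in> lborel \<rightarrow>\<^sub>M borel" by simp
  have "integrable (distr lborel borel ((+) a)) f \<longleftrightarrow> integrable lborel (\<lambda>x. f (a + x))"
    by (rule integrable_distr_eq[OF m]) simp
  then show "integrable lborel (\<lambda>x. f (x + a)) \<longleftrightarrow> integrable lborel f"
    by (simp add: lborel_distr_plus add.commute)
  have "integral\<^sup>L (distr lborel borel ((+) a)) f = (\<integral>x. f (a + x) \<partial>lborel)"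
    by (rule integral_distr[OF m]) simp
  then show "(\<integral>x. f (x + a) \<partial>lborel) = (\<integral>x. f x \<partial>lborel)"
    by (simp add: lborel_distr_plus add.commute)
qed

lemma AE_shift:
  fixes N :: "'a::euclidean_space set"
  assumes "AE x in lborel. x \<notin> N" "N \<in> sets borel" shows "AE x in lborel. x + a \<notin> N"
proof -
  have m: "(+) a \<in> lborel \<rightarrow>\<^sub>M borel" by simp
  have "(AE x in distr lborel borel ((+) a). x \<notin> N) \<longleftrightarrow> (AE x in lborel. a + x \<notin> N)"
    by (rule AE_distr_iff[OF m]) (use assms in auto)
  moreover have "AE x in distr lborel borel ((+) a). x \<notin> N"
    unfolding lborel_distr_plus by (rule assms(1))
  ultimately show ?thesis by (simp add: add.commute)
qed

text \<open>Translating by all multiples of \<open>e\<close> and applying Fubini to \<open>(t, x)\<close> replaces the splitting of a coordinate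
  off the space.\<close>

lemma AE_lines:
  fixes e :: "'a::euclidean_space"
  assumes "AE x in lborel. P x"
  shows "AE x in lborel. AE t in lborel. P (x + t *\<^sub>R e)"
proof -
  obtain N where N: "{x. \<not> P x} \<subseteq> N" "N \<in> sets borel" "emeasure lborel N = 0"
    using assms by (auto elim!: AE_E)
  have notN: "AE x in lborel. x \<notin> N" by (rule AE_not_in) (use N in \<open>auto simp: null_sets_def\<close>)
  have "AE t in lborel. AE x in lborel. x + t *\<^sub>R e \<notin> N"
    by (rule AE_I2) (rule AE_shift[OF notN N(2)])
  moreover have "{p \<in> space (lborel \<Otimes>\<^sub>M lborel). snd p + fst p *\<^sub>R e \<notin> N} \<in> sets (lborel \<Otimes>\<^sub>M lborel)"
    using N(2) by measurable
  ultimately have "AE x in lborel. AE t in lborel. x + t *\<^sub>R e \<notin> N"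
    by (subst (asm) lborel_pair.AE_commute) auto
  then show ?thesis
    by eventually_elim (use N(1) in \<open>auto elim!: eventually_mono\<close>)
qed

text \<open>After an exchange of quantifiers by Fubini's theorem, for which \<open>P\<close> has to
  be measurable, almost every \<open>t\<close> is such that the translated property holds almost
  everywhere. As the real line is not null, such a \<open>t\<close> exists, and translating back by
  it finishes.\<close>

lemma AE_lines_conv:
  fixes e :: "'a::euclidean_space"
  assumes [measurable]: "Measurable.pred borel P"
    and "AE x in lborel. AE t in lborel. P (x + t *\<^sub>R e)"
  shows "AE x in lborel. P x"
proof -
  have "{p \<in> space (lborel \<Otimes>\<^sub>M lborel). P (snd p + fst p *\<^sub>R e)} \<in> sets (lborel \<Otimes>\<^sub>M lborel)"
    by measurable
  then have "AE t in lborel. AE x in lborel. P (x + t *\<^sub>R e)"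
    using assms(2) by (subst lborel_pair.AE_commute) auto
  moreover have "\<not> (AE t in (lborel :: real measure). False)"
  proof
    assume "AE t in (lborel :: real measure). False"
    then have "(UNIV :: real set) \<in> null_sets lborel" by (subst (asm) AE_iff_null) auto
    then show False by (simp add: null_sets_def)
  qed
  ultimately obtain t :: real where t: "AE x in lborel. P (x + t *\<^sub>R e)"
    by (metis (mono_tags, lifting) eventually_mono)
  have "AE x in lborel. x \<notin> {x. \<not> P (x + t *\<^sub>R e)}" using t by simp
  then have "AE x in lborel. x + (- (t *\<^sub>R e)) \<notin> {x. \<not> P (x + t *\<^sub>R e)}"
    by (rule AE_shift) measurable
  then show ?thesis by simp
qed

text \<open>The signed indicator of the interval between 0 and \<open>s\<close>: 1 on
  \<open>{0<..s}\<close> for positive \<open>s\<close>, and -1 on \<open>{s<..0}\<close> for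
  negative \<open>s\<close>. It turns the oriented integral from 0 to \<open>s\<close> into one over
  the whole line whose integrand is jointly measurable in \<open>s\<close> and
  \<open>\<tau>\<close>.\<close>

definition kern :: "real \<Rightarrow> real \<Rightarrow> real" where
  "kern s \<tau> = (if 0 < \<tau> \<and> \<tau> \<le> s then 1 else 0) - (if s < \<tau> \<and> \<tau> \<le> 0 then 1 else 0)"

definition signed_integral :: "real \<Rightarrow> (real \<Rightarrow> real) \<Rightarrow> real" where
  "signed_integral s h = (\<integral>\<tau>. kern s \<tau> * h \<tau> \<partial>lborel)"

lemma kern_measurable_pair [measurable]:
  assumes [measurable]: "f \<in> borel_measurable M" "g \<in> borel_measurable M"
  shows "(\<lambda>x. kern (f x) (g x)) \<in> borel_measurable M"
  unfolding kern_def by measurable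

lemma kern_bound: "\<bar>kern s \<tau>\<bar> \<le> indicator {- \<bar>s\<bar>..\<bar>s\<bar>} \<tau>"
  by (auto simp: kern_def indicator_def)

lemma kern_mult_integrable:
  assumes [measurable]: "h \<in> borel_measurable borel" and h: "\<And>a b. set_integrable lborel {a..b} h"
  shows "integrable lborel (\<lambda>\<tau>. kern s \<tau> * h \<tau>)"
proof (rule Bochner_Integration.integrable_bound[OF h[of "- \<bar>s\<bar>" "\<bar>s\<bar>", unfolded set_integrable_def]])
  show "AE \<tau> in lborel. norm (kern s \<tau> * h \<tau>) \<le> norm (indicator {- \<bar>s\<bar>..\<bar>s\<bar>} \<tau> *\<^sub>R h \<tau>)"
    using kern_bound[of s] by (intro AE_I2) (simp add: abs_mult mult_right_mono)
qed simp

lemma signed_integral_primitive: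
  assumes [measurable]: "h \<in> borel_measurable borel" and h: "\<And>a b. set_integrable lborel {a..b} h"
  shows "primitive (\<lambda>s. c + signed_integral s h) h"
  unfolding primitive_def
proof (intro allI impI)
  fix a b :: real assume ab: "a \<le> b"
  have "signed_integral b h - signed_integral a h = (\<integral>\<tau>. kern b \<tau> * h \<tau> - kern a \<tau> * h \<tau> \<partial>lborel)"
    unfolding signed_integral_def
    by (intro Bochner_Integration.integral_diff[symmetric] kern_mult_integrable h) simp_all
  also have "\<dots> = (\<integral>\<tau>. indicator {a..b} \<tau> *\<^sub>R h \<tau> \<partial>lborel)"
  proof (rule integral_cong_AE)
    show "AE \<tau> in lborel. kern b \<tau> * h \<tau> - kern a \<tau> * h \<tau> = indicator {a..b} \<tau> *\<^sub>R h \<tau>"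
      using AE_lborel_singleton[of a]
      by eventually_elim (use ab in \<open>auto simp: kern_def indicator_def\<close>)
  qed simp_all
  also have "\<dots> = integral {a..b} h"
    using set_borel_integral_eq_integral(2)[OF h[of a b]] by (simp add: set_lebesgue_integral_def)
  finally show "(h has_integral (c + signed_integral b h) - (c + signed_integral a h)) {a..b}"
    using set_borel_integral_eq_integral(1)[OF h[of a b]] by (simp add: has_integral_integral)
qed

lemma primitive_signed_integral:
  assumes "primitive F h" "h \<in> borel_measurable borel" "\<And>a b. set_integrable lborel {a..b} h"
  shows "signed_integral s h = F s - F 0"
proof -
  have S: "primitive (\<lambda>s. 0 + signed_integral s h) h" by (rule signed_integral_primitive) (use assms in auto)
  have "signed_integral b h - signed_integral a h = F b - F a" if "a \<le> b" for a b
    using has_integral_unique[OF primitiveD[OF S that] primitiveD[OF assms(1) that]] by simp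
  from this[of 0 s] this[of s 0] have "signed_integral s h - signed_integral 0 h = F s - F 0"
    by (cases "s \<ge> 0") auto
  moreover have "signed_integral 0 h = 0" by (simp add: signed_integral_def kern_def)
  ultimately show ?thesis by simp
qed

lemma smooth_line_signed_integral:
  assumes "smooth \<phi>" "b \<in> Basis"
  shows "signed_integral s (\<lambda>\<tau>. dir_deriv b \<phi> (x - \<tau> *\<^sub>R b)) = \<phi> x - \<phi> (x - s *\<^sub>R b)"
proof -
  let ?h = "\<lambda>\<tau>. dir_deriv b \<phi> (x - \<tau> *\<^sub>R b)"
  have cont: "continuous_on S ?h" for S
    by (rule continuous_on_compose2[OF smooth_continuous[OF smooth_dir_deriv[OF assms], of UNIV]])
      (auto intro!: continuous_intros)
  have "((\<lambda>s. - \<phi> (x - s *\<^sub>R b)) has_real_derivative ?h s) (at s)" for s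
    using DERIV_minus[OF DERIV_chain2[OF smooth_line_deriv[OF assms(1), of x b "- s"] DERIV_minus[OF DERIV_ident]]]
    by simp
  then have "primitive (\<lambda>s. - \<phi> (x - s *\<^sub>R b)) ?h"
    unfolding primitive_def
    by (intro allI impI fundamental_theorem_of_calculus)
      (auto simp: has_real_derivative_iff_has_vector_derivative[symmetric] intro: has_field_derivative_at_within)
  moreover have "set_integrable lborel {a..c} ?h" for a c
    by (rule borel_integrable_atLeastAtMost') (rule cont)
  ultimately show ?thesis
    by (subst primitive_signed_integral[where F = "\<lambda>s. - \<phi> (x - s *\<^sub>R b)"])
      (auto intro: borel_measurable_continuous_onI cont)
qed

lemma pair_integrableI:
  fixes F :: "real \<times> 'a::euclidean_space \<Rightarrow> real"
  assumes [measurable]: "F \<in> borel_measurable (lborel \<Otimes>\<^sub>M lborel)"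
    and int: "\<And>t. integrable lborel (\<lambda>x. F (t, x))"
    and bound: "\<And>t. (\<integral>x. \<bar>F (t, x)\<bar> \<partial>lborel) \<le> C * indicator {-T..T} t"
  shows "integrable (lborel \<Otimes>\<^sub>M lborel) F"
proof (rule lborel_pair.Fubini_integrable)
  have "integrable lborel (\<lambda>t. C * indicator {-T..T} t :: real)"
    by (intro integrable_mult_right integrable_real_indicator) (auto simp: emeasure_lborel_Icc_eq)
  then show "integrable lborel (\<lambda>t. \<integral>x. norm (F (t, x)) \<partial>lborel)"
  proof (rule Bochner_Integration.integrable_bound)
    show "AE t in lborel. norm (\<integral>x. norm (F (t, x)) \<partial>lborel) \<le> norm (C * indicator {-T..T} t)"
    proof (rule AE_I2)
      fix t
      have "(\<integral>x. \<bar>F (t, x)\<bar> \<partial>lborel) \<ge> 0" by (rule Bochner_Integration.integral_nonneg) simp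
      then show "norm (\<integral>x. norm (F (t, x)) \<partial>lborel) \<le> norm (C * indicator {-T..T} t)"
        using bound[of t] by simp
    qed
  qed simp
qed (use int in auto)

text \<open>The translation is moved onto the bounded factor \<open>\<psi>\<close>: for
  \<open>\<bar>t\<bar> \<le> T\<close> its translated support stays in the ball of radius
  \<open>R + T\<close>, which gives one bound for all these \<open>t\<close>.\<close>

lemma loc_borel_shift_bound:
  fixes h \<psi> :: "'a::euclidean_space \<Rightarrow> real"
  assumes h: "loc_borel h" and \<psi>: "\<psi> \<in> borel_measurable borel" "\<And>x. \<bar>\<psi> x\<bar> \<le> B * indicator (cball 0 R) x"
    and B: "B \<ge> 0" and e: "norm e = 1"
  obtains C where "\<forall>t. integrable lborel (\<lambda>x. h (x + t *\<^sub>R e) * \<psi> x) \<and>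
    (\<bar>t\<bar> \<le> T \<longrightarrow> (\<integral>x. \<bar>h (x + t *\<^sub>R e) * \<psi> x\<bar> \<partial>lborel) \<le> C)"
proof -
  have [measurable]: "h \<in> borel_measurable borel" "\<psi> \<in> borel_measurable borel" using h \<psi> by (auto simp: loc_borel_def)
  let ?k = "\<lambda>Q x. B * \<bar>indicator (cball 0 Q) x * h x\<bar>"
  have k: "integrable lborel (?k Q)" for Q
    using h by (intro integrable_mult_right integrable_abs) (simp add: loc_borel_def)
  have bd: "\<bar>h x * \<psi> (x + - (t *\<^sub>R e))\<bar> \<le> ?k (R + T) x" if "\<bar>t\<bar> \<le> T" for t x T
  proof (cases "x \<in> cball 0 (R + T)")
    case True
    have "\<bar>\<psi> (x + - (t *\<^sub>R e))\<bar> \<le> B" using order_trans[OF \<psi>(2)] B by (simp add: indicator_def)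
    then have "\<bar>h x\<bar> * \<bar>\<psi> (x + - (t *\<^sub>R e))\<bar> \<le> \<bar>h x\<bar> * B" by (rule mult_left_mono) simp
    then show ?thesis using True by (simp add: abs_mult mult.commute)
  next
    case False
    have "x + - (t *\<^sub>R e) \<notin> cball 0 R"
    proof
      assume "x + - (t *\<^sub>R e) \<in> cball 0 R"
      then have "norm x \<le> R + T" using norm_triangle_ineq2[of x "t *\<^sub>R e"] that e by simp
      then show False using False by simp
    qed
    then show ?thesis using \<psi>(2)[of "x + - (t *\<^sub>R e)"] B by simp
  qed
  have 1: "integrable lborel (\<lambda>x. h x * \<psi> (x + - (t *\<^sub>R e)))" for t
    by (rule Bochner_Integration.integrable_bound[OF k[of "R + \<bar>t\<bar>"]])
      (use bd[of t "\<bar>t\<bar>"] B in \<open>auto intro!: AE_I2 simp: abs_mult\<close>)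
  have shift: "(\<lambda>x. h (x + t *\<^sub>R e) * \<psi> x) = (\<lambda>x. (\<lambda>x. h x * \<psi> (x + - (t *\<^sub>R e))) (x + t *\<^sub>R e))" for t
    by simp
  have 2: "integrable lborel (\<lambda>x. h (x + t *\<^sub>R e) * \<psi> x)" for t
    unfolding shift by (subst lborel_integrable_shift) (use 1 in auto)
  have 3: "(\<integral>x. \<bar>h (x + t *\<^sub>R e) * \<psi> x\<bar> \<partial>lborel) \<le> (\<integral>x. ?k (R + T) x \<partial>lborel)" if "\<bar>t\<bar> \<le> T" for t
  proof -
    have "(\<integral>x. \<bar>h (x + t *\<^sub>R e) * \<psi> x\<bar> \<partial>lborel) = (\<integral>x. (\<lambda>x. \<bar>h x * \<psi> (x + - (t *\<^sub>R e))\<bar>) (x + t *\<^sub>R e) \<partial>lborel)"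
      by simp
    also have "\<dots> = (\<integral>x. \<bar>h x * \<psi> (x + - (t *\<^sub>R e))\<bar> \<partial>lborel)"
      by (rule lborel_integral_shift) simp
    also have "\<dots> \<le> (\<integral>x. ?k (R + T) x \<partial>lborel)"
      using bd[OF that] by (intro integral_mono integrable_abs 1 k) auto
    finally show ?thesis .
  qed
  show ?thesis using 2 3 by (intro that[of "\<integral>x. ?k (R + T) x \<partial>lborel"]) auto
qed

lemma loc_borel_pair_integrable:
  fixes h \<psi> :: "'a::euclidean_space \<Rightarrow> real"
  assumes h: "loc_borel h" and \<psi>: "\<psi> \<in> borel_measurable borel" "\<And>x. \<bar>\<psi> x\<bar> \<le> B * indicator (cball 0 R) x"
    and B: "B \<ge> 0" and e: "norm e = 1"
    and \<theta>: "\<theta> \<in> borel_measurable borel" "\<And>t. \<bar>\<theta> t\<bar> \<le> indicator {-T..T} t"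
  shows "integrable (lborel \<Otimes>\<^sub>M lborel) (\<lambda>(t, x). \<theta> t * (h (x + t *\<^sub>R e) * \<psi> x))"
    and "integrable (lborel \<Otimes>\<^sub>M lborel) (\<lambda>(t, x). \<theta> t * (h x * \<psi> (x - t *\<^sub>R e)))"
proof -
  have [measurable]: "h \<in> borel_measurable borel" "\<psi> \<in> borel_measurable borel" "\<theta> \<in> borel_measurable borel"
    using h \<psi> \<theta> by (auto simp: loc_borel_def)
  obtain C where C: "\<forall>t. integrable lborel (\<lambda>x. h (x + t *\<^sub>R e) * \<psi> x) \<and>
    (\<bar>t\<bar> \<le> T \<longrightarrow> (\<integral>x. \<bar>h (x + t *\<^sub>R e) * \<psi> x\<bar> \<partial>lborel) \<le> C)"
    by (rule loc_borel_shift_bound[OF h \<psi> B e])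
  have bound: "(\<integral>x. \<bar>\<theta> t * (h (x + t *\<^sub>R e) * \<psi> x)\<bar> \<partial>lborel) \<le> C * indicator {-T..T} t" for t
  proof (cases "t \<in> {-T..T}")
    case True
    then have t: "\<bar>t\<bar> \<le> T" "\<bar>\<theta> t\<bar> \<le> 1" using \<theta>(2)[of t] by auto
    have "(\<integral>x. \<bar>\<theta> t * (h (x + t *\<^sub>R e) * \<psi> x)\<bar> \<partial>lborel) = \<bar>\<theta> t\<bar> * (\<integral>x. \<bar>h (x + t *\<^sub>R e) * \<psi> x\<bar> \<partial>lborel)"
      by (simp add: abs_mult[of "\<theta> t"])
    also have "\<dots> \<le> 1 * (\<integral>x. \<bar>h (x + t *\<^sub>R e) * \<psi> x\<bar> \<partial>lborel)"
      by (rule mult_right_mono[OF t(2)]) (rule Bochner_Integration.integral_nonneg, simp)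
    also have "\<dots> \<le> C" using C t(1) by simp
    finally show ?thesis using True by simp
  next
    case False
    then have "\<theta> t = 0" using \<theta>(2)[of t] by simp
    then show ?thesis using False by simp
  qed
  show "integrable (lborel \<Otimes>\<^sub>M lborel) (\<lambda>(t, x). \<theta> t * (h (x + t *\<^sub>R e) * \<psi> x))"
    by (rule pair_integrableI[where C = C and T = T]) (use bound C in auto)
  have int: "integrable lborel (\<lambda>x. h x * \<psi> (x - t *\<^sub>R e))" for t
  proof -
    have "integrable lborel (\<lambda>x. (\<lambda>x. h x * \<psi> (x - t *\<^sub>R e)) (x + t *\<^sub>R e))" using C by simp
    then show ?thesis by (subst (asm) lborel_integrable_shift) auto
  qed
  have "(\<integral>x. \<bar>\<theta> t * (h x * \<psi> (x - t *\<^sub>R e))\<bar> \<partial>lborel) \<le> C * indicator {-T..T} t" for t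
    using lborel_integral_shift[of "\<lambda>x. \<bar>\<theta> t * (h x * \<psi> (x - t *\<^sub>R e))\<bar>" "t *\<^sub>R e"] bound[of t] by simp
  then show "integrable (lborel \<Otimes>\<^sub>M lborel) (\<lambda>(t, x). \<theta> t * (h x * \<psi> (x - t *\<^sub>R e)))"
    by (intro pair_integrableI[where C = C and T = T]) (use int in auto)
qed

lemma test_function_dominated:
  assumes "test_function \<phi>"
  obtains B R where "B \<ge> 0" "\<forall>x. \<bar>\<phi> x\<bar> \<le> B * indicator (cball 0 R) x"
proof -
  obtain B where B: "B > 0" "\<forall>x. \<bar>\<phi> x\<bar> \<le> B" by (rule test_function_bounded[OF assms])
  obtain R where R: "R > 0" "{x. \<phi> x \<noteq> 0} \<subseteq> cball 0 R" by (rule test_function_cball[OF assms])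
  have "\<bar>\<phi> x\<bar> \<le> B * indicator (cball 0 R) x" for x
    using B R by (cases "\<phi> x = 0") (auto simp: indicator_def)
  then show ?thesis using B(1) by (intro that[of B R]) auto
qed

lemma indicator_cball_borel: "indicator (cball a R) \<in> borel_measurable borel"
  by (rule borel_measurable_indicator) simp

text \<open>Fubini's theorem for \<open>h\<close> cut off both in \<open>t\<close> and in
  \<open>x\<close>; countably many cut-offs exhaust all intervals and all base points, so a single
  null set suffices.\<close>

lemma loc_borel_line_integrable:
  assumes h: "loc_borel h" and e: "norm e = 1"
  shows "AE x in lborel. \<forall>a b. set_integrable lborel {a..b} (\<lambda>t. h (x + t *\<^sub>R e))"
proof -
  have [measurable]: "h \<in> borel_measurable borel" using h by (simp add: loc_borel_def)
  have "AE x in lborel. \<forall>n::nat. integrable lborel (\<lambda>t. indicator {- real n..real n} t * (h (x + t *\<^sub>R e) * indicator (cball 0 (real n)) x))"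
    unfolding AE_all_countable
  proof
    fix n :: nat
    have "integrable (lborel \<Otimes>\<^sub>M lborel) (\<lambda>(t, x). indicator {- real n..real n} t * (h (x + t *\<^sub>R e) * indicator (cball 0 (real n)) x))"
      by (rule loc_borel_pair_integrable(1)[OF h _ _ _ e, where B = 1 and R = "real n" and T = "real n"])
        (auto simp: indicator_cball_borel)
    from lborel_pair.integrable_product_swap[OF this]
    have "integrable (lborel \<Otimes>\<^sub>M lborel) (\<lambda>(x, t). indicator {- real n..real n} t * (h (x + t *\<^sub>R e) * indicator (cball 0 (real n)) x))"
      by simp
    from lborel_pair.AE_integrable_fst'[OF this]
    show "AE x in lborel. integrable lborel (\<lambda>t. indicator {- real n..real n} t * (h (x + t *\<^sub>R e) * indicator (cball 0 (real n)) x))"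
      by simp
  qed
  then show ?thesis
  proof eventually_elim
    case (elim x)
    show ?case
    proof (intro allI)
      fix a b :: real
      obtain n :: nat where n: "max (norm x) (max \<bar>a\<bar> \<bar>b\<bar>) \<le> real n" using real_arch_simple by blast
      then have "set_integrable lborel {- real n..real n} (\<lambda>t. h (x + t *\<^sub>R e))"
        using elim[rule_format, of n] by (simp add: set_integrable_def)
      then show "set_integrable lborel {a..b} (\<lambda>t. h (x + t *\<^sub>R e))"
        by (rule set_integrable_subset) (use n in auto)
    qed
  qed
qed

lemma signed_integral_line_measurable [measurable]:
  fixes h :: "'a::euclidean_space \<Rightarrow> real"
  assumes [measurable]: "h \<in> borel_measurable borel"
    and [measurable]: "f \<in> borel_measurable M" "g \<in> borel_measurable M"
  shows "(\<lambda>p. signed_integral (f p) (\<lambda>\<tau>. h (g p + \<tau> *\<^sub>R e))) \<in> borel_measurable M"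
  unfolding signed_integral_def by measurable

text \<open>By duality: tested with \<open>\<phi>\<close>, the left side becomes \<open>g\<close>
  integrated against \<open>\<phi> (x - s *\<^sub>R e) - \<phi> x\<close>. That increment is an
  integral of translates of \<open>dir_deriv e \<phi>\<close> along a segment, and the definition of
  the weak derivative applies to each translate.\<close>

lemma borel_deriv_increment:
  fixes g h :: "'a::euclidean_space \<Rightarrow> real"
  assumes D: "borel_deriv [e] g h" and e: "e \<in> Basis"
  shows "AE x in lborel. g (x + s *\<^sub>R e) - g x = signed_integral s (\<lambda>\<tau>. h (x + \<tau> *\<^sub>R e))"
proof -
  have g: "loc_borel g" and h: "loc_borel h" using D by (auto simp: borel_deriv_def)
  have [measurable]: "h \<in> borel_measurable borel" "g \<in> borel_measurable borel"
    using g h by (auto simp: loc_borel_def)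
  have ne: "norm e = 1" using e by (rule norm_Basis)
  have kb: "\<bar>kern s t\<bar> \<le> indicator {-\<bar>s\<bar>..\<bar>s\<bar>} t" for t by (rule kern_bound)
  have km: "kern s \<in> borel_measurable borel" by measurable
  note pair = loc_borel_pair_integrable[OF _ _ _ _ ne km kb]
  define J where "J x = signed_integral s (\<lambda>\<tau>. h (x + \<tau> *\<^sub>R e))" for x
  have Jm [measurable]: "J \<in> borel_measurable borel" unfolding J_def[abs_def] by measurable
  have J: "integrable lborel (\<lambda>x. J x * \<psi> x) \<and>
      (\<integral>x. J x * \<psi> x \<partial>lborel) = (\<integral>\<tau>. kern s \<tau> * (\<integral>x. h (x + \<tau> *\<^sub>R e) * \<psi> x \<partial>lborel) \<partial>lborel)"
    if \<psi>: "\<psi> \<in> borel_measurable borel" "\<And>x. \<bar>\<psi> x\<bar> \<le> B * indicator (cball 0 R) x" "B \<ge> 0" for \<psi> B R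
  proof -
    have [measurable]: "\<psi> \<in> borel_measurable borel" using \<psi> by simp
    have P: "integrable (lborel \<Otimes>\<^sub>M lborel) (\<lambda>(t, x). kern s t * (h (x + t *\<^sub>R e) * \<psi> x))"
      by (rule pair(1)[OF h \<psi>])
    have eq: "(\<integral>t. kern s t * (h (x + t *\<^sub>R e) * \<psi> x) \<partial>lborel) = J x * \<psi> x" for x
      unfolding J_def signed_integral_def by (simp add: mult.assoc[symmetric])
    have "integrable lborel (\<lambda>x. \<integral>t. kern s t * (h (x + t *\<^sub>R e) * \<psi> x) \<partial>lborel)"
      using lborel_pair.integrable_snd[OF P] by simp
    moreover have "(\<integral>x. (\<integral>t. kern s t * (h (x + t *\<^sub>R e) * \<psi> x) \<partial>lborel) \<partial>lborel) =
        (\<integral>t. (\<integral>x. kern s t * (h (x + t *\<^sub>R e) * \<psi> x) \<partial>lborel) \<partial>lborel)"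
      using lborel_pair.Fubini_integral[OF P] by simp
    ultimately show ?thesis unfolding eq by simp
  qed
  have "loc_borel J"
    unfolding loc_borel_def
  proof (intro conjI allI Jm)
    fix R
    have "integrable lborel (\<lambda>x. J x * indicator (cball 0 R) x)"
      using J[OF indicator_cball_borel, of 0 R 1 R] by auto
    then show "integrable lborel (\<lambda>x. indicator (cball 0 R) x * J x)" by (simp add: mult.commute)
  qed
  have gs: "loc_borel (\<lambda>x. g (x + s *\<^sub>R e))"
    unfolding loc_borel_def
  proof (intro conjI allI)
    fix R
    obtain C where "\<forall>t. integrable lborel (\<lambda>x. g (x + t *\<^sub>R e) * indicator (cball 0 R) x) \<and>
      (\<bar>t\<bar> \<le> 0 \<longrightarrow> (\<integral>x. \<bar>g (x + t *\<^sub>R e) * indicator (cball 0 R) x\<bar> \<partial>lborel) \<le> C)"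
      by (rule loc_borel_shift_bound[OF g indicator_cball_borel, of 0 R 1 R e 0]) (auto simp: ne)
    then show "integrable lborel (\<lambda>x. indicator (cball 0 R) x * g (x + s *\<^sub>R e))"
      by (simp add: mult.commute)
  qed measurable
  have "loc_borel (\<lambda>x. g (x + s *\<^sub>R e) - g x - J x)"
    using g gs \<open>loc_borel J\<close> by (auto simp: loc_borel_def right_diff_distrib)
  moreover have "(\<integral>x. (g (x + s *\<^sub>R e) - g x - J x) * \<phi> x \<partial>lborel) = 0" if \<phi>: "test_function \<phi>" for \<phi>
  proof -
    let ?d = "dir_deriv e \<phi>"
    have d: "test_function ?d" using \<phi> e by (rule test_function_dir_deriv)
    have [measurable]: "\<phi> \<in> borel_measurable borel" "?d \<in> borel_measurable borel"
      using \<phi> d by (auto intro: test_function_borel)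
    obtain B R where B: "B \<ge> 0" "\<forall>x. \<bar>\<phi> x\<bar> \<le> B * indicator (cball 0 R) x" by (rule test_function_dominated[OF \<phi>])
    obtain B' R' where B': "B' \<ge> 0" "\<forall>x. \<bar>?d x\<bar> \<le> B' * indicator (cball 0 R') x" by (rule test_function_dominated[OF d])
    have shift: "test_function (\<lambda>x. \<phi> (x - t *\<^sub>R e))" for t
      using test_function_shift[OF \<phi>, of "- (t *\<^sub>R e)"] by simp
    have P: "integrable (lborel \<Otimes>\<^sub>M lborel) (\<lambda>(t, x). kern s t * (g x * ?d (x - t *\<^sub>R e)))"
      by (rule pair(2)[OF g _ B'(2)[rule_format] B'(1)]) simp
    have weak: "(\<integral>x. g x * ?d (x - t *\<^sub>R e) \<partial>lborel) = - (\<integral>x. h (x + t *\<^sub>R e) * \<phi> x \<partial>lborel)" for t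
    proof -
      have "(\<integral>x. g x * ?d (x - t *\<^sub>R e) \<partial>lborel) = - (\<integral>x. h x * \<phi> (x - t *\<^sub>R e) \<partial>lborel)"
        using D shift[of t] dir_deriv_shift[OF test_function_smooth[OF \<phi>], of e "- (t *\<^sub>R e)"]
        by (auto simp: borel_deriv_def)
      also have "(\<integral>x. h x * \<phi> (x - t *\<^sub>R e) \<partial>lborel) = (\<integral>x. h (x + t *\<^sub>R e) * \<phi> x \<partial>lborel)"
        using lborel_integral_shift[of "\<lambda>x. h x * \<phi> (x - t *\<^sub>R e)" "t *\<^sub>R e"] by simp
      finally show ?thesis .
    qed
    have "(\<integral>x. g (x + s *\<^sub>R e) * \<phi> x \<partial>lborel) - (\<integral>x. g x * \<phi> x \<partial>lborel) =
        (\<integral>x. g x * \<phi> (x - s *\<^sub>R e) \<partial>lborel) - (\<integral>x. g x * \<phi> x \<partial>lborel)"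
      using lborel_integral_shift[of "\<lambda>x. g x * \<phi> (x - s *\<^sub>R e)" "s *\<^sub>R e"] by simp
    also have "\<dots> = (\<integral>x. g x * \<phi> (x - s *\<^sub>R e) - g x * \<phi> x \<partial>lborel)"
      by (rule Bochner_Integration.integral_diff[symmetric]) (intro loc_borel_test_integrable g \<phi> shift)+
    also have "\<dots> = (\<integral>x. - (\<integral>t. kern s t * (g x * ?d (x - t *\<^sub>R e)) \<partial>lborel) \<partial>lborel)"
    proof (rule Bochner_Integration.integral_cong[OF refl])
      fix x
      have "(\<integral>t. kern s t * (g x * ?d (x - t *\<^sub>R e)) \<partial>lborel) =
          g x * signed_integral s (\<lambda>t. ?d (x - t *\<^sub>R e))"
        unfolding signed_integral_def by (simp add: mult.left_commute)
      also have "\<dots> = g x * (\<phi> x - \<phi> (x - s *\<^sub>R e))"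
        by (subst smooth_line_signed_integral[OF test_function_smooth[OF \<phi>] e]) simp
      finally show "g x * \<phi> (x - s *\<^sub>R e) - g x * \<phi> x = - (\<integral>t. kern s t * (g x * ?d (x - t *\<^sub>R e)) \<partial>lborel)"
        by (simp add: algebra_simps)
    qed
    also have "\<dots> = - (\<integral>t. (\<integral>x. kern s t * (g x * ?d (x - t *\<^sub>R e)) \<partial>lborel) \<partial>lborel)"
      using lborel_pair.Fubini_integral[OF P] by simp
    also have "\<dots> = (\<integral>t. kern s t * (\<integral>x. h (x + t *\<^sub>R e) * \<phi> x \<partial>lborel) \<partial>lborel)"
      by (simp add: weak)
    also have "\<dots> = (\<integral>x. J x * \<phi> x \<partial>lborel)"
      using J[of \<phi> B R] B by simp
    finally show ?thesis
      using loc_borel_test_integrable[OF g \<phi>] loc_borel_test_integrable[OF gs \<phi>]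
        loc_borel_test_integrable[OF \<open>loc_borel J\<close> \<phi>]
      by (simp add: left_diff_distrib)
  qed
  ultimately have "AE x in lborel. g (x + s *\<^sub>R e) - g x - J x = 0" by (rule fundamental_lemma)
  then show ?thesis by (simp add: J_def)
qed

text \<open>Absolute continuity on lines. \<open>borel_deriv_increment\<close> has an exceptional
  null set of points for every \<open>s\<close>; Fubini's theorem trades this for an exceptional
  null set of parameters on almost every line, so \<open>g\<close> is there replaced by a primitive
  \<open>G\<close>.\<close>

lemma borel_deriv_lines:
  fixes g h :: "'a::euclidean_space \<Rightarrow> real"
  assumes D: "borel_deriv [e] g h" and e: "e \<in> Basis"
  shows "AE x in lborel. \<exists>G. primitive G (\<lambda>t. h (x + t *\<^sub>R e)) \<and> (AE t in lborel. g (x + t *\<^sub>R e) = G t)"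
proof -
  have h: "loc_borel h" using D by (auto simp: borel_deriv_def)
  have [measurable]: "h \<in> borel_measurable borel" "g \<in> borel_measurable borel"
    using D by (auto simp: loc_borel_def borel_deriv_def)
  have m: "{p \<in> space (lborel \<Otimes>\<^sub>M lborel). g (snd p + fst p *\<^sub>R e) - g (snd p) =
      signed_integral (fst p) (\<lambda>\<tau>. h (snd p + \<tau> *\<^sub>R e))} \<in> sets (lborel \<Otimes>\<^sub>M lborel)"
    by measurable
  have "AE s in lborel. AE x in lborel. g (x + s *\<^sub>R e) - g x = signed_integral s (\<lambda>\<tau>. h (x + \<tau> *\<^sub>R e))"
    by (intro AE_I2 borel_deriv_increment D e)
  then have "AE x in lborel. AE s in lborel. g (x + s *\<^sub>R e) - g x = signed_integral s (\<lambda>\<tau>. h (x + \<tau> *\<^sub>R e))"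
    using m by (subst (asm) lborel_pair.AE_commute) auto
  then show ?thesis using loc_borel_line_integrable[OF h norm_Basis[OF e]]
  proof eventually_elim
    case (elim x)
    have "primitive (\<lambda>s. g x + signed_integral s (\<lambda>\<tau>. h (x + \<tau> *\<^sub>R e))) (\<lambda>t. h (x + t *\<^sub>R e))"
      by (rule signed_integral_primitive) (use elim in auto)
    moreover have "AE t in lborel. g (x + t *\<^sub>R e) = g x + signed_integral t (\<lambda>\<tau>. h (x + \<tau> *\<^sub>R e))"
      using elim(1) by eventually_elim simp
    ultimately show ?case by blast
  qed
qed

section \<open>Examples and composition of distributional derivatives\<close>

lemma loc_borel_continuous:
  assumes "continuous_on UNIV g" shows "loc_borel g"
proof -
  have "integrable lborel (\<lambda>x. indicator (cball 0 R) x *\<^sub>R g x)" for R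
    by (rule borel_integrable_compact) (auto intro: continuous_on_subset[OF assms])
  then show ?thesis
    unfolding loc_borel_def using borel_measurable_continuous_onI[OF assms] by simp
qed

text \<open>Averaging over the translations by \<open>t *\<^sub>R e\<close> with
  \<open>0 < t \<le> 1\<close> leaves the integral unchanged, and Fubini's theorem turns the average
  into the integral of \<open>\<psi> x - \<psi> (x - e)\<close>, which is zero by translation
  invariance.\<close>

lemma integral_dir_deriv_test:
  assumes \<psi>: "test_function \<psi>" and e: "e \<in> Basis"
  shows "(\<integral>x. dir_deriv e \<psi> x \<partial>lborel) = 0"
proof -
  let ?d = "dir_deriv e \<psi>"
  have d: "test_function ?d" using \<psi> e by (rule test_function_dir_deriv)
  have [measurable]: "?d \<in> borel_measurable borel" "\<psi> \<in> borel_measurable borel"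
    using \<psi> d by (auto intro: test_function_borel)
  have one: "loc_borel (\<lambda>_. 1)" by (rule loc_borel_continuous) simp
  obtain B R where B: "B \<ge> 0" "\<forall>x. \<bar>?d x\<bar> \<le> B * indicator (cball 0 R) x" by (rule test_function_dominated[OF d])
  have kb: "\<bar>kern 1 t\<bar> \<le> indicator {-\<bar>1\<bar>..\<bar>1\<bar>} t" for t by (rule kern_bound)
  have km: "kern 1 \<in> borel_measurable borel" by measurable
  have P: "integrable (lborel \<Otimes>\<^sub>M lborel) (\<lambda>(t, x). kern 1 t * (1 * ?d (x - t *\<^sub>R e)))"
    by (rule loc_borel_pair_integrable(2)[OF one _ B(2)[rule_format] B(1) norm_Basis[OF e] km kb]) simp
  have sh: "(\<integral>x. ?d (x - t *\<^sub>R e) \<partial>lborel) = (\<integral>x. ?d x \<partial>lborel)" for t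
    using lborel_integral_shift[of ?d "- (t *\<^sub>R e)"] by simp
  have i1: "integrable lborel (\<lambda>x. \<psi> x)" using loc_borel_test_integrable[OF one \<psi>] by simp
  then have i2: "integrable lborel (\<lambda>x. \<psi> (x - 1 *\<^sub>R e))"
    using lborel_integrable_shift[of \<psi> "- (1 *\<^sub>R e)"] by simp
  have "kern 1 = indicator {0<..1}"
    by (auto simp: kern_def indicator_def)
  then have k1: "(\<integral>t. kern 1 t \<partial>lborel) = 1" by simp
  have "(\<integral>x. ?d x \<partial>lborel) = (\<integral>t. kern 1 t * (\<integral>x. ?d x \<partial>lborel) \<partial>lborel)"
    using k1 by simp
  also have "\<dots> = (\<integral>t. (\<integral>x. kern 1 t * (1 * ?d (x - t *\<^sub>R e)) \<partial>lborel) \<partial>lborel)"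
    by (simp add: sh)
  also have "\<dots> = (\<integral>x. (\<integral>t. kern 1 t * (1 * ?d (x - t *\<^sub>R e)) \<partial>lborel) \<partial>lborel)"
    using lborel_pair.Fubini_integral[OF P] by simp
  also have "\<dots> = (\<integral>x. \<psi> x - \<psi> (x - 1 *\<^sub>R e) \<partial>lborel)"
    using smooth_line_signed_integral[OF test_function_smooth[OF \<psi>] e, of 1]
    by (simp add: signed_integral_def)
  also have "\<dots> = (\<integral>x. \<psi> x \<partial>lborel) - (\<integral>x. \<psi> (x - 1 *\<^sub>R e) \<partial>lborel)"
    by (rule Bochner_Integration.integral_diff[OF i1 i2])
  also have "\<dots> = 0" using lborel_integral_shift[of \<psi> "- (1 *\<^sub>R e)"] by simp
  finally show ?thesis .
qed

lemma borel_deriv_test: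
  assumes g: "test_function g" and e: "e \<in> Basis" shows "borel_deriv [e] g (dir_deriv e g)"
proof -
  have l: "loc_borel g" "loc_borel (dir_deriv e g)"
    by (rule loc_borel_continuous, rule test_function_continuous, rule g)
      (rule loc_borel_continuous, rule test_function_continuous, rule test_function_dir_deriv[OF g e])
  have "(\<integral>x. g x * dir_deriv e \<phi> x \<partial>lborel) = - (\<integral>x. dir_deriv e g x * \<phi> x \<partial>lborel)"
    if \<phi>: "test_function \<phi>" for \<phi>
  proof -
    have "(\<integral>x. g x * dir_deriv e \<phi> x \<partial>lborel) + (\<integral>x. dir_deriv e g x * \<phi> x \<partial>lborel) =
        (\<integral>x. g x * dir_deriv e \<phi> x + dir_deriv e g x * \<phi> x \<partial>lborel)"
      by (rule Bochner_Integration.integral_add[symmetric])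
        (intro loc_borel_test_integrable l test_function_dir_deriv \<phi> e)+
    also have "\<dots> = (\<integral>x. dir_deriv e (\<lambda>x. g x * \<phi> x) x \<partial>lborel)"
      by (simp add: dir_deriv_mult test_function_smooth g \<phi>)
    also have "\<dots> = 0"
      by (rule integral_dir_deriv_test[OF test_function_mult_left[OF test_function_smooth[OF g] \<phi>] e])
    finally show ?thesis by simp
  qed
  then show ?thesis using l by (simp add: borel_deriv_def)
qed

lemma borel_deriv_Cons:
  assumes "borel_deriv [b] g h" "borel_deriv bs h k" "set bs \<subseteq> Basis"
  shows "borel_deriv (b # bs) g k"
  using assms test_function_iter_deriv[OF _ assms(3)] unfolding borel_deriv_def by simp

text \<open>The list is reversed because integration by parts first moves the outermost derivative
  of the test function, the head of \<open>bs\<close>, onto \<open>g\<close>, whereas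
  \<open>iter_deriv\<close> applies the head last.\<close>

lemma borel_deriv_test_iter:
  "test_function g \<Longrightarrow> set bs \<subseteq> Basis \<Longrightarrow> borel_deriv bs g (iter_deriv (rev bs) g)"
proof (induction bs arbitrary: g)
  case Nil
  then show ?case by (simp add: borel_deriv_def loc_borel_continuous[OF test_function_continuous])
next
  case (Cons b bs)
  then have "borel_deriv bs (dir_deriv b g) (iter_deriv (rev bs) (dir_deriv b g))"
    by (simp add: test_function_dir_deriv)
  moreover have "borel_deriv [b] g (dir_deriv b g)" using Cons.prems by (simp add: borel_deriv_test)
  ultimately show ?case using Cons.prems borel_deriv_Cons[of b g "dir_deriv b g" bs]
    by (simp add: iter_deriv_append)
qed

text \<open>Testing with \<open>dir_deriv b \<phi>\<close> raises the order by one direction, and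
  commuting derivatives identify the result with \<open>cs\<close>. This extracts first order
  relations, the ones visible on lines, from derivatives that are given separately for each
  multi-index.\<close>

lemma borel_deriv_quotient:
  assumes h: "borel_deriv bs g h" and k: "borel_deriv cs g k"
    and m: "mset cs = add_mset b (mset bs)" and B: "set cs \<subseteq> Basis"
  shows "borel_deriv [b] h k"
proof -
  have b: "b \<in> Basis" using m B by (metis insert_subset set_mset_add_mset_insert set_mset_mset)
  have "length cs = Suc (length bs)" using m by (metis size_add_mset size_mset)
  moreover have "iter_deriv (bs @ [b]) \<phi> = iter_deriv cs \<phi>" if "test_function \<phi>" for \<phi>
    by (rule iter_deriv_perm[symmetric]) (use that m B in \<open>auto intro: test_function_smooth\<close>)
  ultimately have "(\<integral>x. h x * dir_deriv b \<phi> x \<partial>lborel) = - (\<integral>x. k x * \<phi> x \<partial>lborel)" if "test_function \<phi>" for \<phi>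
  proof -
    have "(-1) ^ length bs * (\<integral>x. h x * dir_deriv b \<phi> x \<partial>lborel) = (\<integral>x. g x * iter_deriv (bs @ [b]) \<phi> x \<partial>lborel)"
      using h test_function_dir_deriv[OF that b] by (simp add: borel_deriv_def iter_deriv_append)
    also have "\<dots> = (\<integral>x. g x * iter_deriv cs \<phi> x \<partial>lborel)"
      using \<open>\<And>\<phi>. test_function \<phi> \<Longrightarrow> iter_deriv (bs @ [b]) \<phi> = iter_deriv cs \<phi>\<close>[OF that] by simp
    also have "\<dots> = (-1) ^ length cs * (\<integral>x. k x * \<phi> x \<partial>lborel)"
      using k that by (simp add: borel_deriv_def)
    finally have "(-1) ^ length bs * (\<integral>x. h x * dir_deriv b \<phi> x \<partial>lborel) =
        (-1) ^ length bs * (- (\<integral>x. k x * \<phi> x \<partial>lborel))"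
      using \<open>length cs = Suc (length bs)\<close> by simp
    then show ?thesis by (subst (asm) mult_left_cancel) simp_all
  qed
  then show ?thesis using h k by (simp add: borel_deriv_def)
qed

text \<open>Integration by parts through Fubini's theorem on a triangle: \<open>F t - F (-R)\<close>
  is the integral of \<open>u\<close> over \<open>\<tau> \<le> t\<close>, and integrating the
  derivative of \<open>\<phi>\<close> over \<open>t \<ge> \<tau>\<close> leaves
  \<open>- \<phi> \<tau>\<close>.\<close>

lemma primitive_borel_deriv:
  assumes F: "primitive F u" and u: "loc_borel u"
  shows "borel_deriv [1] F u"
proof -
  have Fl: "loc_borel F" by (rule loc_borel_continuous[OF primitive_continuous[OF F]])
  have [measurable]: "u \<in> borel_measurable borel" "F \<in> borel_measurable borel"
    using u Fl by (auto simp: loc_borel_def)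
  have "(\<integral>t. F t * dir_deriv 1 \<phi> t \<partial>lborel) = - (\<integral>t. u t * \<phi> t \<partial>lborel)" if \<phi>: "test_function \<phi>" for \<phi>
  proof -
    let ?d = "dir_deriv 1 \<phi>"
    have d: "test_function ?d" using \<phi> by (rule test_function_dir_deriv) simp
    have [measurable]: "?d \<in> borel_measurable borel" "\<phi> \<in> borel_measurable borel"
      using \<phi> d by (auto intro: test_function_borel)
    obtain B R0 where B: "B \<ge> 0" "\<forall>x. \<bar>?d x\<bar> \<le> B * indicator (cball 0 R0) x" by (rule test_function_dominated[OF d])
    obtain R1 where R1: "R1 > 0" "{x. \<phi> x \<noteq> 0} \<subseteq> cball 0 R1" by (rule test_function_cball[OF \<phi>])
    \<comment> \<open>The extra 1 makes \<open>\<phi>\<close> and its derivative vanish at the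
      endpoints \<open>-R\<close> and \<open>R\<close> as well.\<close>
    define R where "R = max R0 R1 + 1"
    have d0: "?d t = 0" if "\<bar>t\<bar> \<ge> R" for t using B(2)[rule_format, of t] that by (simp add: R_def)
    have dB: "\<bar>?d t\<bar> \<le> B * indicator {-R..R} t" for t
    proof -
      have "indicator (cball 0 R0) t \<le> (indicator {-R..R} t :: real)"
        by (auto simp: R_def indicator_def)
      then have "B * indicator (cball 0 R0) t \<le> B * indicator {-R..R} t" by (rule mult_left_mono[OF _ B(1)])
      then show ?thesis using B(2)[rule_format, of t] by linarith
    qed
    have \<phi>0: "\<phi> t = 0" if "\<bar>t\<bar> \<ge> R" for t
      using R1(2) that by (auto simp: R_def)
    let ?k = "\<lambda>t \<tau>. if -R < \<tau> \<and> \<tau> \<le> t \<and> \<tau> \<le> R then u \<tau> else 0"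
    let ?w = "\<lambda>\<tau>. indicator (cball 0 R) \<tau> * u \<tau>"
    have w: "integrable lborel ?w" using u by (simp add: loc_borel_def)
    have k: "integrable lborel (?k t)" for t
      by (rule Bochner_Integration.integrable_bound[OF w]) (auto simp: indicator_def)
    have kint: "(\<integral>\<tau>. ?k t \<tau> \<partial>lborel) = F t - F (-R)" if t: "-R \<le> t" "t \<le> R" for t
    proof -
      have s: "set_integrable lborel {-R..t} u"
        unfolding set_integrable_def
        by (rule Bochner_Integration.integrable_bound[OF w]) (use t in \<open>auto simp: indicator_def\<close>)
      have "(\<integral>\<tau>. ?k t \<tau> \<partial>lborel) = (\<integral>\<tau>. indicator {-R..t} \<tau> *\<^sub>R u \<tau> \<partial>lborel)"
      proof (rule integral_cong_AE)
        show "AE \<tau> in lborel. ?k t \<tau> = indicator {-R..t} \<tau> *\<^sub>R u \<tau>"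
          using AE_lborel_singleton[of "-R"] by eventually_elim (use t in \<open>auto simp: indicator_def\<close>)
      qed simp_all
      also have "\<dots> = integral {-R..t} u"
        using set_borel_integral_eq_integral(2)[OF s] by (simp add: set_lebesgue_integral_def)
      also have "\<dots> = F t - F (-R)" by (rule integral_unique[OF primitiveD[OF F t(1)]])
      finally show ?thesis .
    qed
    have P: "integrable (lborel \<Otimes>\<^sub>M lborel) (\<lambda>(t, \<tau>). ?d t * ?k t \<tau>)"
    proof (rule pair_integrableI[where T = R and C = "B * (\<integral>\<tau>. \<bar>?w \<tau>\<bar> \<partial>lborel)"])
      show "integrable lborel (\<lambda>\<tau>. case (t, \<tau>) of (t, \<tau>) \<Rightarrow> ?d t * ?k t \<tau>)" for t
        using k by simp
      fix t
      have "(\<integral>\<tau>. \<bar>?d t * ?k t \<tau>\<bar> \<partial>lborel) = \<bar>?d t\<bar> * (\<integral>\<tau>. \<bar>?k t \<tau>\<bar> \<partial>lborel)"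
        by (simp add: abs_mult)
      also have "\<dots> \<le> (B * indicator {-R..R} t) * (\<integral>\<tau>. \<bar>?w \<tau>\<bar> \<partial>lborel)"
      proof (rule mult_mono[OF dB])
        show "(\<integral>\<tau>. \<bar>?k t \<tau>\<bar> \<partial>lborel) \<le> (\<integral>\<tau>. \<bar>?w \<tau>\<bar> \<partial>lborel)"
          by (intro integral_mono integrable_abs k w) (auto simp: indicator_def)
      qed (use B(1) in \<open>auto intro!: Bochner_Integration.integral_nonneg\<close>)
      finally show "(\<integral>\<tau>. \<bar>case (t, \<tau>) of (t, \<tau>) \<Rightarrow> ?d t * ?k t \<tau>\<bar> \<partial>lborel) \<le>
          B * (\<integral>\<tau>. \<bar>?w \<tau>\<bar> \<partial>lborel) * indicator {-R..R} t"
        by (simp add: mult_ac)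
    qed measurable
    have inner: "(\<integral>t. ?d t * ?k t \<tau> \<partial>lborel) = - (u \<tau> * \<phi> \<tau>)" for \<tau>
    proof (cases "-R < \<tau> \<and> \<tau> \<le> R")
      case True
      have "(\<integral>t. ?d t * ?k t \<tau> \<partial>lborel) = (\<integral>t. u \<tau> * (indicator {\<tau>..R} t *\<^sub>R ?d t) \<partial>lborel)"
        by (rule Bochner_Integration.integral_cong[OF refl]) (use True d0 in \<open>auto simp: indicator_def\<close>)
      also have "\<dots> = u \<tau> * (\<integral>t. indicator {\<tau>..R} t *\<^sub>R ?d t \<partial>lborel)" by simp
      also have "(\<integral>t. indicator {\<tau>..R} t *\<^sub>R ?d t \<partial>lborel) = \<phi> R - \<phi> \<tau>"
      proof (rule integral_FTC_atLeastAtMost)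
        show "(\<phi> has_vector_derivative ?d t) (at t within {\<tau>..R})" for t
          using smooth_line_deriv[OF test_function_smooth[OF \<phi>], of 0 1 t]
          by (auto simp: has_real_derivative_iff_has_vector_derivative[symmetric] intro: has_field_derivative_at_within)
      qed (use True in \<open>auto intro: test_function_continuous d\<close>)
      also have "\<phi> R = 0" by (rule \<phi>0) (simp add: R_def)
      finally show ?thesis by simp
    next
      case False
      then have "\<phi> \<tau> = 0" by (intro \<phi>0) auto
      moreover have "?k t \<tau> = 0" for t using False by auto
      ultimately show ?thesis by simp
    qed
    have one: "loc_borel (\<lambda>_. 1)" by (rule loc_borel_continuous) simp
    have di: "integrable lborel ?d" using loc_borel_test_integrable[OF one d] by simp
    have "(\<integral>t. F t * ?d t \<partial>lborel) = (\<integral>t. F (-R) * ?d t + (\<integral>\<tau>. ?d t * ?k t \<tau> \<partial>lborel) \<partial>lborel)"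
    proof (rule Bochner_Integration.integral_cong[OF refl])
      fix t
      show "F t * ?d t = F (-R) * ?d t + (\<integral>\<tau>. ?d t * ?k t \<tau> \<partial>lborel)"
      proof (cases "\<bar>t\<bar> \<ge> R")
        case True then show ?thesis by (simp add: d0)
      next
        case False
        then have t: "-R \<le> t" "t \<le> R" by auto
        have "(\<integral>\<tau>. ?d t * ?k t \<tau> \<partial>lborel) = ?d t * (\<integral>\<tau>. ?k t \<tau> \<partial>lborel)" by simp
        then show ?thesis unfolding kint[OF t] by (simp add: algebra_simps)
      qed
    qed
    also have "\<dots> = (\<integral>t. F (-R) * ?d t \<partial>lborel) + (\<integral>t. (\<integral>\<tau>. ?d t * ?k t \<tau> \<partial>lborel) \<partial>lborel)"
      using lborel_pair.integrable_fst[OF P] di by (intro Bochner_Integration.integral_add) auto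
    also have "(\<integral>t. F (-R) * ?d t \<partial>lborel) = 0"
      using integral_dir_deriv_test[OF \<phi>, of 1] by simp
    also have "(\<integral>t. (\<integral>\<tau>. ?d t * ?k t \<tau> \<partial>lborel) \<partial>lborel) = (\<integral>\<tau>. (\<integral>t. ?d t * ?k t \<tau> \<partial>lborel) \<partial>lborel)"
      using lborel_pair.Fubini_integral[OF P] by simp
    also have "\<dots> = - (\<integral>\<tau>. u \<tau> * \<phi> \<tau> \<partial>lborel)" unfolding inner by simp
    finally show ?thesis by simp
  qed
  then show ?thesis using Fl u by (simp add: borel_deriv_def)
qed

section \<open>Multi-indices and the lists of basis vectors that realize them\<close>

definition mi_dirs :: "'n::finite multi_index \<Rightarrow> (real^'n) list" where
  "mi_dirs \<beta> = map (\<lambda>i. axis i 1) (mi_list \<beta>)"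

lemma weak_deriv_mi_dirs: "weak_deriv \<beta> g h = distr_deriv (mi_dirs \<beta>) g h"
  by (simp add: weak_deriv_def mi_dirs_def)

lemma mi_dirs_Basis: "set (mi_dirs \<beta>) \<subseteq> Basis"
  by (auto simp: mi_dirs_def axis_in_Basis_iff)

lemma mset_mi_list_eqI: "(\<And>i. count M i = \<beta> $ i) \<Longrightarrow> mset (mi_list \<beta>) = M"
  by (rule multiset_eqI) (simp add: count_mset count_mi_list)

lemma mset_mi_dirs_add:
  "mset (mi_dirs (\<beta> + axis i 1)) = add_mset (axis i 1) (mset (mi_dirs \<beta>))"
proof -
  have "mset (mi_list (\<beta> + axis i 1)) = add_mset i (mset (mi_list \<beta>))"
    by (rule mset_mi_list_eqI) (simp add: count_mset count_mi_list axis_def)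
  then show ?thesis by (simp add: mi_dirs_def)
qed

lemma mi_dirs_0: "mi_dirs 0 = []"
proof -
  have "mset (mi_list (0 :: 'n::finite multi_index)) = {#}" by (rule mset_mi_list_eqI) simp
  then show ?thesis by (simp add: mi_dirs_def)
qed

lemma mi_abs_0 [simp]: "mi_abs 0 = 0" by (simp add: mi_abs_def)

lemma mi_abs_add: "mi_abs (\<beta> + \<gamma>) = mi_abs \<beta> + mi_abs \<gamma>"
  by (simp add: mi_abs_def sum.distrib)

lemma mi_abs_axis [simp]: "mi_abs (axis i k) = k"
  by (simp add: mi_abs_def axis_def)

lemma mi_abs_eq_0_iff: "mi_abs \<beta> = 0 \<longleftrightarrow> \<beta> = 0"
  by (auto simp: mi_abs_def vec_eq_iff)

lemma mi_decompose:
  fixes \<beta> :: "'n::finite multi_index"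
  assumes "\<beta> \<noteq> 0" obtains \<alpha> i where "\<beta> = \<alpha> + axis i 1"
proof -
  obtain i where i: "\<beta> $ i \<noteq> 0" using assms by (auto simp: vec_eq_iff)
  have "\<beta> = (\<chi> j. if j = i then \<beta> $ j - 1 else \<beta> $ j) + axis i 1"
    using i by (auto simp: vec_eq_iff axis_def)
  then show ?thesis by (rule that)
qed

lemma mi_abs_eq_1:
  assumes "mi_abs \<beta> = 1" obtains i where "\<beta> = axis i 1"
proof -
  have "\<beta> \<noteq> 0" using assms by auto
  then obtain \<alpha> i where \<beta>: "\<beta> = \<alpha> + axis i 1" by (rule mi_decompose)
  then have "\<alpha> = 0" using assms by (simp add: mi_abs_add mi_abs_eq_0_iff)
  then show ?thesis using \<beta> that by simp
qed

section \<open>Combinatorics of the formula\<close>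

text \<open>With the factorials divided out here, the part of \<open>fdb_coeff\<close> that remains
  is \<open>mi_fact \<alpha> / fact s\<close>, common to all tuples of length
  \<open>s\<close>.\<close>

definition tuple_prod :: "('n::finite multi_index \<Rightarrow> real) \<Rightarrow> 'n multi_index list \<Rightarrow> real" where
  "tuple_prod w \<gamma> = prod_list (map (\<lambda>\<beta>. w \<beta> / mi_fact \<beta>) \<gamma>)"

definition tuple_sum :: "('n::finite multi_index \<Rightarrow> real) \<Rightarrow> 'n multi_index \<Rightarrow> nat \<Rightarrow> real" where
  "tuple_sum w \<alpha> s = (\<Sum>\<gamma>\<in>mi_tuples \<alpha> s. tuple_prod w \<gamma>)"

text \<open>What the product rule makes of \<open>tuple_prod\<close> when differentiation sends each \<open>w \<beta>\<close> to \<open>w (\<beta> + \<epsilon>)\<close>.\<close>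

definition tuple_prod_deriv ::
    "('n::finite multi_index \<Rightarrow> real) \<Rightarrow> 'n multi_index \<Rightarrow> 'n multi_index list \<Rightarrow> nat \<Rightarrow> real" where
  "tuple_prod_deriv w \<epsilon> \<gamma> r =
    tuple_prod w (take r \<gamma>) * (w (\<gamma> ! r + \<epsilon>) / mi_fact (\<gamma> ! r)) * tuple_prod w (drop (Suc r) \<gamma>)"

definition tuple_sum_deriv ::
    "('n::finite multi_index \<Rightarrow> real) \<Rightarrow> 'n multi_index \<Rightarrow> 'n multi_index \<Rightarrow> nat \<Rightarrow> real" where
  "tuple_sum_deriv w \<epsilon> \<alpha> s = (\<Sum>\<gamma>\<in>mi_tuples \<alpha> s. \<Sum>r<s. tuple_prod_deriv w \<epsilon> \<gamma> r)"

lemma tuple_prod_append: "tuple_prod w (\<gamma> @ \<delta>) = tuple_prod w \<gamma> * tuple_prod w \<delta>"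
  and tuple_prod_Cons: "tuple_prod w (\<beta> # \<delta>) = w \<beta> / mi_fact \<beta> * tuple_prod w \<delta>"
  and tuple_prod_Nil: "tuple_prod w [] = 1"
  by (simp_all add: tuple_prod_def)

lemma tuple_prod_conv_nth: "tuple_prod w \<gamma> = (\<Prod>r<length \<gamma>. w (\<gamma> ! r)) / (\<Prod>r<length \<gamma>. mi_fact (\<gamma> ! r))"
  by (simp add: tuple_prod_def prod.list_conv_set_nth lessThan_atLeast0 prod_dividef)

lemma mi_fact_pos: "mi_fact \<beta> > 0"
  by (auto simp: mi_fact_def intro!: prod_pos)

lemma mi_fact_add_axis: "mi_fact (\<beta> + axis i 1) = (real (\<beta> $ i) + 1) * mi_fact \<beta>"
proof -
  have "mi_fact (\<beta> + axis i 1) = fact (\<beta> $ i + 1) * (\<Prod>j\<in>UNIV - {i}. fact (\<beta> $ j))"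
    unfolding mi_fact_def by (subst prod.remove[of _ i]) (auto simp: axis_def intro!: prod.cong)
  moreover have "mi_fact \<beta> = fact (\<beta> $ i) * (\<Prod>j\<in>UNIV - {i}. fact (\<beta> $ j))"
    unfolding mi_fact_def by (subst prod.remove[of _ i]) auto
  ultimately show ?thesis by (simp add: algebra_simps)
qed

lemma mi_fact_axis: "mi_fact (axis i 1) = 1"
  using mi_fact_add_axis[of 0 i] by (simp add: mi_fact_def)

lemma mi_tuples_0: "mi_tuples \<alpha> 0 = (if \<alpha> = 0 then {[]} else {})"
  by (auto simp: mi_tuples_def)

lemma length_le_mi_abs_sum_list: "0 \<notin> set \<gamma> \<Longrightarrow> length \<gamma> \<le> mi_abs (sum_list \<gamma>)"
proof (induction \<gamma>)
  case (Cons \<beta> \<gamma>)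
  then have "mi_abs \<beta> > 0" using mi_abs_eq_0_iff[of \<beta>] by auto
  then show ?case using Cons by (simp add: mi_abs_add)
qed simp

lemma mi_tuples_empty: "mi_abs \<alpha> < s \<Longrightarrow> mi_tuples \<alpha> s = {}"
  using length_le_mi_abs_sum_list by (fastforce simp: mi_tuples_def)

text \<open>The other \<open>s - 1\<close> entries have order at least 1 each. For
  \<open>s = mi_abs \<alpha>\<close> the bound forces every entry to have order exactly 1.\<close>

lemma mi_tuples_mi_abs_le:
  assumes "\<gamma> \<in> mi_tuples \<alpha> s" "\<beta> \<in> set \<gamma>"
  shows "0 < mi_abs \<beta>" "mi_abs \<beta> + (s - 1) \<le> mi_abs \<alpha>"
proof -
  obtain xs ys where \<gamma>: "\<gamma> = xs @ \<beta> # ys" using assms(2) by (meson split_list)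
  have 0: "0 \<notin> set \<gamma>" "sum_list \<gamma> = \<alpha>" "length \<gamma> = s" using assms(1) by (auto simp: mi_tuples_def)
  show "0 < mi_abs \<beta>" using 0 assms(2) mi_abs_eq_0_iff[of \<beta>] by auto
  have "length xs \<le> mi_abs (sum_list xs)" "length ys \<le> mi_abs (sum_list ys)"
    using 0 \<gamma> by (auto intro: length_le_mi_abs_sum_list)
  then show "mi_abs \<beta> + (s - 1) \<le> mi_abs \<alpha>" using 0 by (auto simp: \<gamma> mi_abs_add)
qed

text \<open>Together with \<open>mi_tuples_update\<close> this mirrors the product rule: a tuple of
  total \<open>\<alpha> + axis i 1\<close> arises from one of total \<open>\<alpha>\<close> by
  inserting the entry \<open>axis i 1\<close>, when the derivative falls on the outer function, or
  by raising an existing entry, when it falls on a factor.\<close>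

lemma mi_tuples_insert:
  assumes r: "r < s"
  shows "bij_betw (\<lambda>\<gamma>. take r \<gamma> @ axis i 1 # drop r \<gamma>) (mi_tuples \<alpha> (s - 1))
    {\<delta> \<in> mi_tuples (\<alpha> + axis i 1) s. \<delta> ! r = axis i 1}"
proof (rule bij_betw_byWitness[where f' = "\<lambda>\<delta>. take r \<delta> @ drop (Suc r) \<delta>"])
  have ne: "axis i (1::nat) \<noteq> (0 :: nat ^ 'a)" by (simp add: axis_eq_0_iff)
  show "\<forall>\<gamma>\<in>mi_tuples \<alpha> (s - 1). (\<lambda>\<delta>. take r \<delta> @ drop (Suc r) \<delta>) (take r \<gamma> @ axis i 1 # drop r \<gamma>) = \<gamma>"
    using r by (auto simp: mi_tuples_def min_def)
  show "\<forall>\<delta>\<in>{\<delta> \<in> mi_tuples (\<alpha> + axis i 1) s. \<delta> ! r = axis i 1}.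
      (\<lambda>\<gamma>. take r \<gamma> @ axis i 1 # drop r \<gamma>) (take r \<delta> @ drop (Suc r) \<delta>) = \<delta>"
  proof
    fix \<delta> assume "\<delta> \<in> {\<delta> \<in> mi_tuples (\<alpha> + axis i 1) s. \<delta> ! r = axis i 1}"
    then have \<delta>: "length \<delta> = s" "\<delta> ! r = axis i 1" by (auto simp: mi_tuples_def)
    then show "(\<lambda>\<gamma>. take r \<gamma> @ axis i 1 # drop r \<gamma>) (take r \<delta> @ drop (Suc r) \<delta>) = \<delta>"
      using id_take_nth_drop[of r \<delta>] r by (simp add: min_def)
  qed
  show "(\<lambda>\<gamma>. take r \<gamma> @ axis i 1 # drop r \<gamma>) ` mi_tuples \<alpha> (s - 1) \<subseteq>
      {\<delta> \<in> mi_tuples (\<alpha> + axis i 1) s. \<delta> ! r = axis i 1}"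
  proof (rule image_subsetI)
    fix \<gamma> assume "\<gamma> \<in> mi_tuples \<alpha> (s - 1)"
    then have \<gamma>: "length \<gamma> = s - 1" "0 \<notin> set \<gamma>" "sum_list \<gamma> = \<alpha>" by (auto simp: mi_tuples_def)
    have "sum_list (take r \<gamma>) + sum_list (drop r \<gamma>) = \<alpha>"
      using \<gamma>(3) by (metis append_take_drop_id sum_list_append)
    then show "take r \<gamma> @ axis i 1 # drop r \<gamma> \<in> {\<delta> \<in> mi_tuples (\<alpha> + axis i 1) s. \<delta> ! r = axis i 1}"
      using \<gamma> r ne by (auto simp: mi_tuples_def nth_append min_def algebra_simps dest: in_set_takeD in_set_dropD)
  qed
  show "(\<lambda>\<delta>. take r \<delta> @ drop (Suc r) \<delta>) ` {\<delta> \<in> mi_tuples (\<alpha> + axis i 1) s. \<delta> ! r = axis i 1}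
      \<subseteq> mi_tuples \<alpha> (s - 1)"
  proof (rule image_subsetI)
    fix \<delta> assume "\<delta> \<in> {\<delta> \<in> mi_tuples (\<alpha> + axis i 1) s. \<delta> ! r = axis i 1}"
    then have \<delta>: "length \<delta> = s" "0 \<notin> set \<delta>" "sum_list \<delta> = \<alpha> + axis i 1" "\<delta> ! r = axis i 1"
      by (auto simp: mi_tuples_def)
    have "sum_list \<delta> = sum_list (take r \<delta>) + axis i 1 + sum_list (drop (Suc r) \<delta>)"
      using id_take_nth_drop[of r \<delta>] \<delta>(1,4) r by (metis sum_list_append sum_list.Cons add.assoc)
    then have "(sum_list (take r \<delta>) + sum_list (drop (Suc r) \<delta>)) + axis i 1 = \<alpha> + axis i 1"
      using \<delta>(3) by (metis add.assoc add.commute)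
    then have "sum_list (take r \<delta>) + sum_list (drop (Suc r) \<delta>) = \<alpha>" by (rule add_right_imp_eq)
    then show "take r \<delta> @ drop (Suc r) \<delta> \<in> mi_tuples \<alpha> (s - 1)"
      using \<delta>(1,2) r by (auto simp: mi_tuples_def min_def algebra_simps dest: in_set_takeD in_set_dropD)
  qed
qed

lemma mi_tuples_update:
  assumes r: "r < s"
  shows "bij_betw (\<lambda>\<gamma>. \<gamma>[r := \<gamma> ! r + axis i 1]) (mi_tuples \<alpha> s)
    {\<delta> \<in> mi_tuples (\<alpha> + axis i 1) s. \<delta> ! r $ i \<noteq> 0 \<and> \<delta> ! r \<noteq> axis i 1}"
proof (rule bij_betw_byWitness[where f' = "\<lambda>\<delta>. \<delta>[r := (\<chi> j. if j = i then \<delta> ! r $ j - 1 else \<delta> ! r $ j)]"])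
  let ?dec = "\<lambda>\<beta> :: nat ^ 'a. (\<chi> j. if j = i then \<beta> $ j - 1 else \<beta> $ j)"
  have dec1: "?dec (\<beta> + axis i 1) = \<beta>" for \<beta> by (auto simp: vec_eq_iff axis_def)
  have dec2: "?dec \<beta> + axis i 1 = \<beta>" if "\<beta> $ i \<noteq> 0" for \<beta> using that by (auto simp: vec_eq_iff axis_def)
  have sum_upd: "sum_list (\<gamma>[r := \<beta>]) + \<gamma> ! r = sum_list \<gamma> + \<beta>" if "length \<gamma> = s" for \<gamma> :: "(nat ^ 'a) list" and \<beta>
  proof -
    have "sum_list \<gamma> = sum_list (take r \<gamma>) + \<gamma> ! r + sum_list (drop (Suc r) \<gamma>)"
      using id_take_nth_drop[of r \<gamma>] that r by (metis sum_list_append sum_list.Cons add.assoc)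
    moreover have "sum_list (\<gamma>[r := \<beta>]) = sum_list (take r \<gamma>) + \<beta> + sum_list (drop (Suc r) \<gamma>)"
      using that r by (simp add: upd_conv_take_nth_drop add.assoc)
    ultimately show ?thesis by (simp add: algebra_simps)
  qed
  show "\<forall>\<gamma>\<in>mi_tuples \<alpha> s. (\<lambda>\<delta>. \<delta>[r := ?dec (\<delta> ! r)]) (\<gamma>[r := \<gamma> ! r + axis i 1]) = \<gamma>"
  proof
    fix \<gamma> assume "\<gamma> \<in> mi_tuples \<alpha> s"
    then have "r < length \<gamma>" using r by (auto simp: mi_tuples_def)
    then show "(\<lambda>\<delta>. \<delta>[r := ?dec (\<delta> ! r)]) (\<gamma>[r := \<gamma> ! r + axis i 1]) = \<gamma>"
      by (simp only: nth_list_update_eq dec1 list_update_overwrite list_update_id)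
  qed
  show "\<forall>\<delta>\<in>{\<delta> \<in> mi_tuples (\<alpha> + axis i 1) s. \<delta> ! r $ i \<noteq> 0 \<and> \<delta> ! r \<noteq> axis i 1}.
      (\<lambda>\<gamma>. \<gamma>[r := \<gamma> ! r + axis i 1]) (\<delta>[r := ?dec (\<delta> ! r)]) = \<delta>"
  proof
    fix \<delta> assume \<delta>: "\<delta> \<in> {\<delta> \<in> mi_tuples (\<alpha> + axis i 1) s. \<delta> ! r $ i \<noteq> 0 \<and> \<delta> ! r \<noteq> axis i 1}"
    then have r': "r < length \<delta>" and i: "\<delta> ! r $ i \<noteq> 0" using r by (auto simp: mi_tuples_def)
    from r' show "(\<lambda>\<gamma>. \<gamma>[r := \<gamma> ! r + axis i 1]) (\<delta>[r := ?dec (\<delta> ! r)]) = \<delta>"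
      by (simp only: nth_list_update_eq dec2[OF i] list_update_overwrite list_update_id)
  qed
  show "(\<lambda>\<gamma>. \<gamma>[r := \<gamma> ! r + axis i 1]) ` mi_tuples \<alpha> s \<subseteq>
      {\<delta> \<in> mi_tuples (\<alpha> + axis i 1) s. \<delta> ! r $ i \<noteq> 0 \<and> \<delta> ! r \<noteq> axis i 1}"
  proof (rule image_subsetI)
    fix \<gamma> assume "\<gamma> \<in> mi_tuples \<alpha> s"
    then have \<gamma>: "length \<gamma> = s" "0 \<notin> set \<gamma>" "sum_list \<gamma> = \<alpha>" by (auto simp: mi_tuples_def)
    have "\<gamma> ! r \<noteq> 0" using \<gamma> r nth_mem[of r \<gamma>] by metis
    moreover have "sum_list (\<gamma>[r := \<gamma> ! r + axis i 1]) = \<alpha> + axis i 1"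
    proof (rule add_right_imp_eq)
      show "sum_list (\<gamma>[r := \<gamma> ! r + axis i 1]) + \<gamma> ! r = \<alpha> + axis i 1 + \<gamma> ! r"
        using sum_upd[OF \<gamma>(1), of "\<gamma> ! r + axis i 1"] \<gamma>(3) by (metis add.assoc add.commute)
    qed
    moreover have "\<gamma> ! r + axis i 1 \<noteq> 0" by (auto simp: vec_eq_iff axis_def intro!: exI[of _ i])
    ultimately show "\<gamma>[r := \<gamma> ! r + axis i 1] \<in>
        {\<delta> \<in> mi_tuples (\<alpha> + axis i 1) s. \<delta> ! r $ i \<noteq> 0 \<and> \<delta> ! r \<noteq> axis i 1}"
      using \<gamma> r set_update_subset_insert[of \<gamma> r "\<gamma> ! r + axis i 1"] by (auto simp: mi_tuples_def)
  qed
  show "(\<lambda>\<delta>. \<delta>[r := ?dec (\<delta> ! r)]) ` {\<delta> \<in> mi_tuples (\<alpha> + axis i 1) s. \<delta> ! r $ i \<noteq> 0 \<and> \<delta> ! r \<noteq> axis i 1}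
      \<subseteq> mi_tuples \<alpha> s"
  proof (rule image_subsetI)
    fix \<delta> assume "\<delta> \<in> {\<delta> \<in> mi_tuples (\<alpha> + axis i 1) s. \<delta> ! r $ i \<noteq> 0 \<and> \<delta> ! r \<noteq> axis i 1}"
    then have \<delta>: "length \<delta> = s" "0 \<notin> set \<delta>" "sum_list \<delta> = \<alpha> + axis i 1"
      "\<delta> ! r $ i \<noteq> 0" "\<delta> ! r \<noteq> axis i 1"
      by (auto simp: mi_tuples_def)
    have "?dec (\<delta> ! r) \<noteq> 0" using dec2[OF \<delta>(4)] \<delta>(5) by (metis add_0)
    moreover have "sum_list (\<delta>[r := ?dec (\<delta> ! r)]) + (?dec (\<delta> ! r) + axis i 1) = \<alpha> + axis i 1 + ?dec (\<delta> ! r)"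
      using sum_upd[OF \<delta>(1), of "?dec (\<delta> ! r)"] \<delta>(3) unfolding dec2[OF \<delta>(4)] by simp
    then have "sum_list (\<delta>[r := ?dec (\<delta> ! r)]) = \<alpha>"
      by (metis (no_types, lifting) add.assoc add.commute add_right_imp_eq)
    ultimately show "\<delta>[r := ?dec (\<delta> ! r)] \<in> mi_tuples \<alpha> s"
      using \<delta> r set_update_subset_insert[of \<delta> r "?dec (\<delta> ! r)"] by (auto simp: mi_tuples_def)
  qed
qed

text \<open>The weight vanishes on tuples whose entry \<open>r\<close> cannot be lowered in
  coordinate \<open>i\<close>. Lowering it in the others either leaves 0, and the entry is regarded
  as inserted, or leaves a nonzero entry, and then the weight cancels the factor by which raising
  increases \<open>mi_fact\<close>.\<close>

lemma tuple_sum_component: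
  assumes r: "r < s"
  shows "(\<Sum>\<delta>\<in>mi_tuples (\<alpha> + axis i 1) s. real (\<delta> ! r $ i) * tuple_prod w \<delta>) =
    (\<Sum>\<gamma>\<in>mi_tuples \<alpha> s. tuple_prod_deriv w (axis i 1) \<gamma> r) + w (axis i 1) * tuple_sum w \<alpha> (s - 1)"
proof -
  let ?D = "mi_tuples (\<alpha> + axis i 1) s" and ?g = "\<lambda>\<delta>. real (\<delta> ! r $ i) * tuple_prod w \<delta>"
  let ?D1 = "{\<delta> \<in> ?D. \<delta> ! r = axis i 1}" and ?D2 = "{\<delta> \<in> ?D. \<delta> ! r $ i \<noteq> 0 \<and> \<delta> ! r \<noteq> axis i 1}"
  have fin: "finite ?D" by (rule finite_mi_tuples)
  have "sum ?g ?D = sum ?g (?D2 \<union> ?D1)"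
    by (rule sum.mono_neutral_right) (use fin in \<open>auto simp: axis_def\<close>)
  also have "\<dots> = sum ?g ?D2 + sum ?g ?D1"
    by (rule sum.union_disjoint) (use fin in auto)
  also have "sum ?g ?D2 = (\<Sum>\<gamma>\<in>mi_tuples \<alpha> s. ?g (\<gamma>[r := \<gamma> ! r + axis i 1]))"
    using sum.reindex_bij_betw[OF mi_tuples_update[OF r, of i \<alpha>], of ?g] by simp
  also have "\<dots> = (\<Sum>\<gamma>\<in>mi_tuples \<alpha> s. tuple_prod_deriv w (axis i 1) \<gamma> r)"
  proof (rule sum.cong[OF refl])
    fix \<gamma> assume "\<gamma> \<in> mi_tuples \<alpha> s"
    then have \<gamma>: "r < length \<gamma>" using r by (auto simp: mi_tuples_def)
    have "real (\<gamma> ! r $ i) + 1 \<noteq> 0" by linarith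
    then have "(real (\<gamma> ! r $ i) + 1) * (w (\<gamma> ! r + axis i 1) / mi_fact (\<gamma> ! r + axis i 1)) = w (\<gamma> ! r + axis i 1) / mi_fact (\<gamma> ! r)"
      using mi_fact_pos[of "\<gamma> ! r"] by (simp add: mi_fact_add_axis del: One_nat_def)
    moreover have "(\<gamma> ! r + axis i 1) $ i = \<gamma> ! r $ i + 1" by (simp add: axis_def)
    then have "?g (\<gamma>[r := \<gamma> ! r + axis i 1]) =
        ((real (\<gamma> ! r $ i) + 1) * (w (\<gamma> ! r + axis i 1) / mi_fact (\<gamma> ! r + axis i 1))) *
        (tuple_prod w (take r \<gamma>) * tuple_prod w (drop (Suc r) \<gamma>))"
      using \<gamma> by (simp add: upd_conv_take_nth_drop tuple_prod_append tuple_prod_Cons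
          nth_append min_def mult_ac add.commute)
    ultimately show "?g (\<gamma>[r := \<gamma> ! r + axis i 1]) = tuple_prod_deriv w (axis i 1) \<gamma> r"
      by (simp add: tuple_prod_deriv_def mult_ac)
  qed
  also have "sum ?g ?D1 = (\<Sum>\<gamma>\<in>mi_tuples \<alpha> (s - 1). ?g (take r \<gamma> @ axis i 1 # drop r \<gamma>))"
    using sum.reindex_bij_betw[OF mi_tuples_insert[OF r, of i \<alpha>], of ?g] by simp
  also have "\<dots> = (\<Sum>\<gamma>\<in>mi_tuples \<alpha> (s - 1). w (axis i 1) * tuple_prod w \<gamma>)"
  proof (rule sum.cong[OF refl])
    fix \<gamma> assume "\<gamma> \<in> mi_tuples \<alpha> (s - 1)"
    then have "length \<gamma> = s - 1" by (auto simp: mi_tuples_def)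
    then have "(take r \<gamma> @ axis i 1 # drop r \<gamma>) ! r = axis i 1" using r by (simp add: nth_append min_def)
    moreover have "tuple_prod w \<gamma> = tuple_prod w (take r \<gamma>) * tuple_prod w (drop r \<gamma>)"
      by (simp flip: tuple_prod_append)
    ultimately show "?g (take r \<gamma> @ axis i 1 # drop r \<gamma>) = w (axis i 1) * tuple_prod w \<gamma>"
      by (simp add: tuple_prod_append tuple_prod_Cons mi_fact_axis del: One_nat_def)
  qed
  finally show ?thesis by (simp add: tuple_sum_def sum_distrib_left)
qed

text \<open>If \<open>W\<close> is the formal power series \<open>\<Sum>\<^sub>\<beta>\<^sub>\<noteq>\<^sub>0 w \<beta> X\<^sup>\<beta> / \<beta>!\<close>, then \<open>tuple_sum w \<alpha> s\<close> is the coefficient of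
  \<open>X\<^sup>\<alpha>\<close> in \<open>W\<^sup>s\<close>, and this lemma compares \<open>W\<^sup>s\<close> differentiated with respect to \<open>X\<^sub>i\<close> and through its coefficients.\<close>

lemma tuple_sum_add_axis:
  "(real (\<alpha> $ i) + 1) * tuple_sum w (\<alpha> + axis i 1) s =
    tuple_sum_deriv w (axis i 1) \<alpha> s + real s * w (axis i 1) * tuple_sum w \<alpha> (s - 1)"
proof -
  have vsum: "sum_list \<delta> $ i = (\<Sum>r<length \<delta>. \<delta> ! r $ i)" for \<delta> :: "(nat ^ 'a) list"
    by (induction \<delta>) (auto simp: sum.lessThan_Suc_shift simp del: sum.lessThan_Suc)
  \<comment> \<open>The factor \<open>\<alpha> $ i + 1\<close> is coordinate \<open>i\<close> of the
    total, hence the sum of the coordinates \<open>i\<close> of all entries.\<close>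
  have "(real (\<alpha> $ i) + 1) * tuple_sum w (\<alpha> + axis i 1) s =
      (\<Sum>\<delta>\<in>mi_tuples (\<alpha> + axis i 1) s. \<Sum>r<s. real (\<delta> ! r $ i) * tuple_prod w \<delta>)"
    unfolding tuple_sum_def sum_distrib_left
  proof (rule sum.cong[OF refl])
    fix \<delta> assume "\<delta> \<in> mi_tuples (\<alpha> + axis i 1) s"
    then have "length \<delta> = s" "sum_list \<delta> = \<alpha> + axis i 1" by (auto simp: mi_tuples_def)
    then have "(\<Sum>r<s. \<delta> ! r $ i) = \<alpha> $ i + 1" using vsum[of \<delta>] by (simp add: axis_def)
    then have "real (\<alpha> $ i) + 1 = (\<Sum>r<s. real (\<delta> ! r $ i))" by (simp flip: of_nat_sum)
    then show "(real (\<alpha> $ i) + 1) * tuple_prod w \<delta> = (\<Sum>r<s. real (\<delta> ! r $ i) * tuple_prod w \<delta>)"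
      by (simp add: sum_distrib_right)
  qed
  also have "\<dots> = (\<Sum>r<s. \<Sum>\<delta>\<in>mi_tuples (\<alpha> + axis i 1) s. real (\<delta> ! r $ i) * tuple_prod w \<delta>)"
    by (rule sum.swap)
  also have "\<dots> = (\<Sum>r<s. (\<Sum>\<gamma>\<in>mi_tuples \<alpha> s. tuple_prod_deriv w (axis i 1) \<gamma> r) + w (axis i 1) * tuple_sum w \<alpha> (s - 1))"
    by (rule sum.cong[OF refl], rule tuple_sum_component) simp
  also have "\<dots> = tuple_sum_deriv w (axis i 1) \<alpha> s + real s * w (axis i 1) * tuple_sum w \<alpha> (s - 1)"
    unfolding tuple_sum_deriv_def by (simp add: sum.distrib sum.swap[of _ "mi_tuples \<alpha> s"])
  finally show ?thesis .
qed

text \<open>The sum starts at 0 so that order 0 gives \<open>d 0\<close> and can start an induction;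
  for nonzero \<open>\<alpha>\<close> the term with \<open>s = 0\<close> is zero. The numbers
  \<open>d s\<close> stand for \<open>f^(s) (g x)\<close>, and \<open>w \<beta>\<close> for the
  derivatives of \<open>g\<close> at \<open>x\<close>.\<close>

definition faa_di_bruno ::
    "(nat \<Rightarrow> real) \<Rightarrow> ('n::finite multi_index \<Rightarrow> real) \<Rightarrow> 'n multi_index \<Rightarrow> real" where
  "faa_di_bruno d w \<alpha> = (\<Sum>s\<le>mi_abs \<alpha>. d s * (mi_fact \<alpha> / fact s * tuple_sum w \<alpha> s))"

text \<open>The right side is the product rule taken termwise: the derivative falls on
  \<open>d s\<close> and produces \<open>d (Suc s) * w (axis i 1)\<close>, or falls on the tuple
  sum. In \<open>tuple_sum_add_axis\<close> the former kind of term carries the factor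
  \<open>s\<close>, which turns \<open>1 / fact s\<close> into \<open>1 / fact (s - 1)\<close> and
  so shifts the index.\<close>

lemma faa_di_bruno_step:
  "faa_di_bruno d w (\<alpha> + axis i 1) =
    (\<Sum>s\<le>mi_abs \<alpha>. d (Suc s) * w (axis i 1) * (mi_fact \<alpha> / fact s * tuple_sum w \<alpha> s) +
      d s * (mi_fact \<alpha> / fact s * tuple_sum_deriv w (axis i 1) \<alpha> s))"
proof -
  let ?n = "mi_abs \<alpha>" and ?\<epsilon> = "axis i 1 :: 'a multi_index"
  let ?A = "\<Sum>s\<le>?n. d (Suc s) * w ?\<epsilon> * (mi_fact \<alpha> / fact s * tuple_sum w \<alpha> s)"
  let ?B = "\<lambda>s. d s * (mi_fact \<alpha> / fact s * tuple_sum_deriv w ?\<epsilon> \<alpha> s)"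
  let ?C = "\<lambda>s. d s * (mi_fact \<alpha> / fact s * (real s * w ?\<epsilon> * tuple_sum w \<alpha> (s - 1)))"
  \<comment> \<open>No tuple of total \<open>\<alpha>\<close> has \<open>Suc ?n\<close> nonzero
    entries, so this kind of term stops at \<open>?n\<close>; the other kind reaches
    \<open>?n\<close> through the shift by one.\<close>
  have "?B (Suc ?n) = 0" by (simp add: tuple_sum_deriv_def mi_tuples_empty)
  have "faa_di_bruno d w (\<alpha> + ?\<epsilon>) =
      (\<Sum>s\<le>Suc ?n. d s * (mi_fact \<alpha> / fact s * ((real (\<alpha> $ i) + 1) * tuple_sum w (\<alpha> + ?\<epsilon>) s)))"
    unfolding faa_di_bruno_def mi_fact_add_axis mi_abs_add mi_abs_axis
    by (intro sum.cong) (auto simp: mult_ac)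
  also have "\<dots> = (\<Sum>s\<le>Suc ?n. ?B s + ?C s)"
    unfolding tuple_sum_add_axis by (simp only: distrib_left)
  also have "\<dots> = (\<Sum>s\<le>Suc ?n. ?B s) + (\<Sum>s\<le>Suc ?n. ?C s)" by (rule sum.distrib)
  also have "(\<Sum>s\<le>Suc ?n. ?B s) = (\<Sum>s\<le>?n. ?B s)" using \<open>?B (Suc ?n) = 0\<close> by simp
  also have "(\<Sum>s\<le>Suc ?n. ?C s) = ?A"
  proof -
    have "?C (Suc s) = d (Suc s) * w ?\<epsilon> * (mi_fact \<alpha> / fact s * tuple_sum w \<alpha> s)" for s
    proof -
      have "real (Suc s) / fact (Suc s) = (1 / fact s :: real)" by (simp only: fact_Suc of_nat_mult) simp
      moreover have "?C (Suc s) = d (Suc s) * w ?\<epsilon> * (mi_fact \<alpha> * (real (Suc s) / fact (Suc s)) * tuple_sum w \<alpha> s)"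
        by (simp only: diff_Suc_1) (simp only: times_divide_eq_left times_divide_eq_right mult_ac)
      ultimately show ?thesis by simp
    qed
    then show ?thesis unfolding sum.atMost_Suc_shift by (simp add: mult_ac)
  qed
  finally show ?thesis by (simp add: sum.distrib)
qed

lemma faa_di_bruno_0: "faa_di_bruno d w 0 = d 0"
  by (simp add: faa_di_bruno_def tuple_sum_def mi_tuples_0 tuple_prod_Nil mi_fact_def)

lemma faa_di_bruno_conv_fdb_coeff:
  assumes "\<alpha> \<noteq> 0"
  shows "faa_di_bruno d w \<alpha> =
    (\<Sum>s=1..mi_abs \<alpha>. \<Sum>\<gamma>\<in>mi_tuples \<alpha> s. fdb_coeff \<alpha> s \<gamma> * (d s * (\<Prod>r<s. w (\<gamma> ! r))))"
proof -
  have "faa_di_bruno d w \<alpha> = (\<Sum>s=1..mi_abs \<alpha>. d s * (mi_fact \<alpha> / fact s * tuple_sum w \<alpha> s))"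
    unfolding faa_di_bruno_def
  proof (rule sum.mono_neutral_right)
    show "\<forall>s\<in>{..mi_abs \<alpha>} - {1..mi_abs \<alpha>}. d s * (mi_fact \<alpha> / fact s * tuple_sum w \<alpha> s) = 0"
      using assms by (auto simp: tuple_sum_def mi_tuples_0 not_le)
  qed auto
  also have "\<dots> = (\<Sum>s=1..mi_abs \<alpha>. \<Sum>\<gamma>\<in>mi_tuples \<alpha> s. fdb_coeff \<alpha> s \<gamma> * (d s * (\<Prod>r<s. w (\<gamma> ! r))))"
    unfolding tuple_sum_def sum_distrib_left
    by (intro sum.cong refl) (auto simp: mi_tuples_def fdb_coeff_def tuple_prod_conv_nth)
  finally show ?thesis .
qed

lemma tuple_prod_has_derivative:
  assumes "\<And>\<beta>. \<beta> \<in> set \<gamma> \<Longrightarrow> ((\<lambda>t. w t \<beta>) has_real_derivative w t (\<beta> + \<epsilon>)) (at t)"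
  shows "((\<lambda>t. tuple_prod (w t) \<gamma>) has_real_derivative (\<Sum>r<length \<gamma>. tuple_prod_deriv (w t) \<epsilon> \<gamma> r)) (at t)"
  using assms
proof (induction \<gamma>)
  case Nil
  then show ?case by (simp add: tuple_prod_Nil)
next
  case (Cons \<beta> \<gamma>)
  have "((\<lambda>t. w t \<beta> / mi_fact \<beta> * tuple_prod (w t) \<gamma>) has_real_derivative
      w t (\<beta> + \<epsilon>) / mi_fact \<beta> * tuple_prod (w t) \<gamma> +
      (\<Sum>r<length \<gamma>. tuple_prod_deriv (w t) \<epsilon> \<gamma> r) * (w t \<beta> / mi_fact \<beta>)) (at t)"
    by (intro DERIV_mult DERIV_cdivide Cons) (use Cons.prems in auto)
  moreover have "tuple_prod_deriv (w t) \<epsilon> (\<beta> # \<gamma>) (Suc r) = tuple_prod_deriv (w t) \<epsilon> \<gamma> r * (w t \<beta> / mi_fact \<beta>)" for r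
    by (simp add: tuple_prod_deriv_def tuple_prod_Cons mult_ac)
  moreover have "tuple_prod_deriv (w t) \<epsilon> (\<beta> # \<gamma>) 0 = w t (\<beta> + \<epsilon>) / mi_fact \<beta> * tuple_prod (w t) \<gamma>"
    by (simp add: tuple_prod_deriv_def tuple_prod_Nil)
  ultimately show ?case
    by (simp add: tuple_prod_Cons sum.lessThan_Suc_shift sum_distrib_right sum_divide_distrib del: sum.lessThan_Suc)
qed

lemma tuple_sum_has_derivative:
  assumes "\<And>\<beta>. \<beta> \<noteq> 0 \<Longrightarrow> mi_abs \<beta> \<le> mi_abs \<alpha> \<Longrightarrow> ((\<lambda>t. w t \<beta>) has_real_derivative w t (\<beta> + \<epsilon>)) (at t)"
  shows "((\<lambda>t. tuple_sum (w t) \<alpha> s) has_real_derivative tuple_sum_deriv (w t) \<epsilon> \<alpha> s) (at t)"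
  unfolding tuple_sum_def tuple_sum_deriv_def
proof (rule DERIV_sum)
  fix \<gamma> assume \<gamma>: "\<gamma> \<in> mi_tuples \<alpha> s"
  then have "length \<gamma> = s" by (simp add: mi_tuples_def)
  moreover have "((\<lambda>t. w t \<beta>) has_real_derivative w t (\<beta> + \<epsilon>)) (at t)" if "\<beta> \<in> set \<gamma>" for \<beta>
    using mi_tuples_mi_abs_le[OF \<gamma> that] by (intro assms) auto
  ultimately show "((\<lambda>t. tuple_prod (w t) \<gamma>) has_real_derivative (\<Sum>r<s. tuple_prod_deriv (w t) \<epsilon> \<gamma> r)) (at t)"
    using tuple_prod_has_derivative[of \<gamma> w t \<epsilon>] by simp
qed

lemma tuple_sum_continuous:
  assumes "\<And>\<beta>. \<beta> \<noteq> 0 \<Longrightarrow> mi_abs \<beta> \<le> mi_abs \<alpha> \<Longrightarrow> continuous_on A (\<lambda>t. w t \<beta>)"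
  shows "continuous_on A (\<lambda>t. tuple_sum (w t) \<alpha> s)"
  unfolding tuple_sum_def tuple_prod_conv_nth
proof (intro continuous_on_sum continuous_on_divide continuous_on_prod continuous_on_const ballI)
  fix \<gamma> r assume \<gamma>: "\<gamma> \<in> mi_tuples \<alpha> s" and r: "r \<in> {..<length \<gamma>}"
  show "continuous_on A (\<lambda>t. w t (\<gamma> ! r))"
    using mi_tuples_mi_abs_le[OF \<gamma>, of "\<gamma> ! r"] r by (intro assms) auto
next
  fix \<gamma> assume "\<gamma> \<in> mi_tuples \<alpha> s" show "(\<Prod>r<length \<gamma>. mi_fact (\<gamma> ! r)) \<noteq> 0"
    by (rule less_imp_neq[THEN not_sym]) (intro prod_pos mi_fact_pos)
qed

section \<open>The formula for regular outer functions\<close>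

lemma AE_lborel_iff_lebesgue: "(AE x in lebesgue. P x) \<longleftrightarrow> (AE x in lborel. P x)"
  by (rule AE_completion_iff)

lemma continuous_AE_eq:
  fixes f g :: "real \<Rightarrow> real"
  assumes f: "continuous_on UNIV f" and g: "continuous_on UNIV g" and ae: "AE t in lborel. f t = g t"
  shows "f = g"
proof -
  have "open {t. f t \<noteq> g t}" by (rule open_Collect_neq) (use f g in auto)
  moreover have "negligible {t. f t \<noteq> g t}"
    using ae by (simp add: AE_lborel_iff_lebesgue[symmetric] AE_lebesgue_iff_negligible)
  ultimately have "{t. f t \<noteq> g t} = {}" using open_not_negligible by blast
  then show ?thesis by auto
qed

text \<open>\<open>d s\<close> stands for \<open>f^(s)\<close>. Classical derivatives are required
  only up to order \<open>m - 1\<close>; the last link just says that \<open>d (m - 1)\<close> is a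
  primitive of the Borel function \<open>d m\<close>.\<close>

definition deriv_chain :: "nat \<Rightarrow> (nat \<Rightarrow> real \<Rightarrow> real) \<Rightarrow> bool" where
  "deriv_chain m d \<longleftrightarrow> (\<forall>s\<le>m. d s \<in> borel_measurable borel) \<and> (\<forall>s<m. primitive (d s) (d (Suc s))) \<and>
    (\<forall>s t. Suc s < m \<longrightarrow> (d s has_real_derivative d (Suc s) t) (at t))"

text \<open>A simultaneous choice of Borel representatives, linked by first order derivatives only,
  so that \<open>borel_deriv_lines\<close> applies to every link.\<close>

definition deriv_family :: "nat \<Rightarrow> ('n::finite multi_index \<Rightarrow> real^'n \<Rightarrow> real) \<Rightarrow> bool" where
  "deriv_family m w \<longleftrightarrow> (\<forall>\<beta>. mi_abs \<beta> \<le> m \<longrightarrow> loc_borel (w \<beta>)) \<and>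
    (\<forall>\<beta> i. mi_abs \<beta> < m \<longrightarrow> borel_deriv [axis i 1] (w \<beta>) (w (\<beta> + axis i 1)))"

lemma finite_mi_abs_le: "finite {\<beta> :: 'n::finite multi_index. mi_abs \<beta> \<le> n}"
proof -
  have "{\<beta> :: 'n multi_index. mi_abs \<beta> \<le> n} \<subseteq> vec_lambda ` (\<Pi>\<^sub>E i\<in>UNIV. {..n})"
  proof
    fix \<beta> :: "'n multi_index" assume "\<beta> \<in> {\<beta>. mi_abs \<beta> \<le> n}"
    then have "\<beta> $ i \<le> n" for i
      using member_le_sum[of i UNIV "\<lambda>i. \<beta> $ i"] by (simp add: mi_abs_def)
    then have "vec_nth \<beta> \<in> (\<Pi>\<^sub>E i\<in>UNIV. {..n})" by (auto simp: PiE_def Pi_def)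
    then show "\<beta> \<in> vec_lambda ` (\<Pi>\<^sub>E i\<in>UNIV. {..n})" by (metis image_eqI vec_nth_inverse)
  qed
  then show ?thesis by (rule finite_subset) (auto intro!: finite_PiE)
qed

lemma axis_in_Basis: "axis i (1::real) \<in> Basis"
  by (simp add: axis_in_Basis_iff)

lemma deriv_family_lines:
  assumes w: "deriv_family m w" and n: "n < m"
  shows "AE x in lborel. \<exists>v. \<forall>\<beta>. mi_abs \<beta> \<le> n \<longrightarrow>
    primitive (\<lambda>t. v t \<beta>) (\<lambda>t. w (\<beta> + axis i 1) (x + t *\<^sub>R axis i 1)) \<and>
    (AE t in lborel. w \<beta> (x + t *\<^sub>R axis i 1) = v t \<beta>)"
proof -
  have "AE x in lborel. \<forall>\<beta>\<in>{\<beta>. mi_abs \<beta> \<le> n}.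
      \<exists>V. primitive V (\<lambda>t. w (\<beta> + axis i 1) (x + t *\<^sub>R axis i 1)) \<and> (AE t in lborel. w \<beta> (x + t *\<^sub>R axis i 1) = V t)"
    using w n by (intro AE_finite_allI finite_mi_abs_le borel_deriv_lines axis_in_Basis) (auto simp: deriv_family_def)
  then show ?thesis
  proof eventually_elim
    case (elim x)
    then obtain V where "\<forall>\<beta>\<in>{\<beta>. mi_abs \<beta> \<le> n}. primitive (V \<beta>) (\<lambda>t. w (\<beta> + axis i 1) (x + t *\<^sub>R axis i 1)) \<and>
        (AE t in lborel. w \<beta> (x + t *\<^sub>R axis i 1) = V \<beta> t)"
      by (rule bchoice[THEN exE])
    then show ?case by (intro exI[of _ "\<lambda>t \<beta>. V \<beta> t"]) simp
  qed
qed

lemma tuple_sum_measurable: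
  assumes "\<And>\<beta>. \<beta> \<noteq> 0 \<Longrightarrow> mi_abs \<beta> \<le> mi_abs \<alpha> \<Longrightarrow> w \<beta> \<in> borel_measurable M"
  shows "(\<lambda>x. tuple_sum (\<lambda>\<beta>. w \<beta> x) \<alpha> s) \<in> borel_measurable M"
  unfolding tuple_sum_def tuple_prod_conv_nth
proof (intro borel_measurable_sum borel_measurable_divide borel_measurable_prod borel_measurable_const)
  fix \<gamma> r assume \<gamma>: "\<gamma> \<in> mi_tuples \<alpha> s" and r: "r \<in> {..<length \<gamma>}"
  show "w (\<gamma> ! r) \<in> borel_measurable M"
    using mi_tuples_mi_abs_le[OF \<gamma>, of "\<gamma> ! r"] r by (intro assms) auto
qed

lemma tuple_sum_cong:
  "(\<And>\<beta>. \<beta> \<noteq> 0 \<Longrightarrow> mi_abs \<beta> \<le> mi_abs \<alpha> \<Longrightarrow> w \<beta> = w' \<beta>) \<Longrightarrow> tuple_sum w \<alpha> s = tuple_sum w' \<alpha> s"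
  unfolding tuple_sum_def tuple_prod_conv_nth
proof (intro sum.cong[OF refl] arg_cong2[of _ _ _ _ "(/)"] prod.cong refl)
  fix \<gamma> r assume *: "\<And>\<beta>. \<beta> \<noteq> 0 \<Longrightarrow> mi_abs \<beta> \<le> mi_abs \<alpha> \<Longrightarrow> w \<beta> = w' \<beta>"
    and \<gamma>: "\<gamma> \<in> mi_tuples \<alpha> s" and r: "r \<in> {..<length \<gamma>}"
  show "w (\<gamma> ! r) = w' (\<gamma> ! r)"
    using mi_tuples_mi_abs_le[OF \<gamma>, of "\<gamma> ! r"] r by (intro *) auto
qed

text \<open>The induction step on a single line: there the formula of order \<open>\<alpha>\<close> is an identity of continuous
  functions, which is differentiated almost everywhere.  All its terms except the one with \<open>s = mi_abs \<alpha>\<close>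
  are differentiable by the chain rule, hence so is the remaining one.\<close>

lemma faa_di_bruno_line_step:
  fixes w :: "real \<Rightarrow> 'n::finite multi_index \<Rightarrow> real"
  assumes d: "deriv_chain m d" and n: "mi_abs \<alpha> < m"
    and v: "\<And>\<beta>. mi_abs \<beta> \<le> mi_abs \<alpha> \<Longrightarrow> primitive (\<lambda>t. v t \<beta>) (\<lambda>t. w t (\<beta> + axis i 1))"
    and wv: "\<And>\<beta>. mi_abs \<beta> \<le> mi_abs \<alpha> \<Longrightarrow> AE t in lborel. w t \<beta> = v t \<beta>"
    and H: "primitive H h" and eq: "AE t in lborel. H t = faa_di_bruno (\<lambda>s. d s (w t 0)) (w t) \<alpha>"
  shows "AE t in lborel. h t = faa_di_bruno (\<lambda>s. d s (w t 0)) (w t) (\<alpha> + axis i 1)"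
proof -
  let ?n = "mi_abs \<alpha>" and ?e = "axis i 1 :: 'n multi_index"
  have wv_all: "AE t in lborel. \<forall>\<beta>\<in>{\<beta>. mi_abs \<beta> \<le> ?n}. w t \<beta> = v t \<beta>"
    using wv by (intro AE_finite_allI finite_mi_abs_le) auto
  have dv_all: "AE t in lborel. \<forall>\<beta>\<in>{\<beta>. mi_abs \<beta> \<le> ?n}. ((\<lambda>t. v t \<beta>) has_real_derivative w t (\<beta> + ?e)) (at t)"
    using primitive_AE_deriv[OF v] by (intro AE_finite_allI finite_mi_abs_le) (auto simp: AE_lborel_iff_lebesgue)
  have cv: "continuous_on UNIV (\<lambda>t. v t \<beta>)" if "mi_abs \<beta> \<le> ?n" for \<beta>
    by (rule primitive_continuous[OF v[OF that]])
  have cd: "continuous_on UNIV (d s)" if "s < m" for s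
    using d that by (auto simp: deriv_chain_def intro: primitive_continuous)
  \<comment> \<open>\<open>Q s\<close> is built from the continuous \<open>v\<close>, which makes
    the identity for \<open>H\<close> hold at every point. Its derivative \<open>Q' s\<close> is
    built from \<open>w\<close>, as \<open>v\<close> is controlled up to order \<open>?n\<close>
    only.\<close>
  define Q where "Q s t = mi_fact \<alpha> / fact s * tuple_sum (v t) \<alpha> s" for s t
  define Q' where "Q' s t = mi_fact \<alpha> / fact s * tuple_sum_deriv (w t) ?e \<alpha> s" for s t
  have cQ: "continuous_on UNIV (Q s)" for s
    unfolding Q_def[abs_def] by (intro continuous_intros tuple_sum_continuous cv) auto
  have dQ: "AE t in lborel. \<forall>s. (Q s has_real_derivative Q' s t) (at t)"
    using wv_all dv_all
  proof eventually_elim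
    case (elim t)
    \<comment> \<open>Glues \<open>v\<close> up to order \<open>?n\<close> to \<open>w\<close> above
      it, so that one family contains both the functions to be differentiated and their derivatives
      at \<open>t\<close>, as \<open>tuple_sum_has_derivative\<close> expects.\<close>
    define W where "W \<tau> \<beta> = (if mi_abs \<beta> \<le> ?n then v \<tau> \<beta> else w \<tau> \<beta>)" for \<tau> \<beta>
    have Wt: "W t = w t" using elim(1) by (auto simp: W_def fun_eq_iff)
    have "((\<lambda>\<tau>. W \<tau> \<beta>) has_real_derivative W t (\<beta> + ?e)) (at t)" if "mi_abs \<beta> \<le> ?n" for \<beta>
      using elim(2) that unfolding Wt by (simp add: W_def)
    then have "((\<lambda>\<tau>. tuple_sum (W \<tau>) \<alpha> s) has_real_derivative tuple_sum_deriv (W t) ?e \<alpha> s) (at t)" for s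
      by (intro tuple_sum_has_derivative)
    moreover have "tuple_sum (W \<tau>) \<alpha> s = tuple_sum (v \<tau>) \<alpha> s" for \<tau> s
      by (rule tuple_sum_cong) (simp add: W_def)
    ultimately have D: "((\<lambda>\<tau>. tuple_sum (v \<tau>) \<alpha> s) has_real_derivative tuple_sum_deriv (w t) ?e \<alpha> s) (at t)" for s
      by (simp add: Wt)
    show ?case unfolding Q_def[abs_def] Q'_def by (intro allI DERIV_cmult D)
  qed
  have "H = (\<lambda>t. \<Sum>s\<le>?n. d s (v t 0) * Q s t)"
  proof (rule continuous_AE_eq)
    show "continuous_on UNIV H" by (rule primitive_continuous[OF H])
    have "continuous_on UNIV (\<lambda>t. d s (v t 0))" if "s \<le> ?n" for s
      by (rule continuous_on_compose2[OF cd cv]) (use that n in auto)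
    then show "continuous_on UNIV (\<lambda>t. \<Sum>s\<le>?n. d s (v t 0) * Q s t)"
      by (intro continuous_on_sum continuous_on_mult cQ) auto
    show "AE t in lborel. H t = (\<Sum>s\<le>?n. d s (v t 0) * Q s t)"
      using eq wv_all
    proof eventually_elim
      case (elim t)
      have "tuple_sum (w t) \<alpha> s = tuple_sum (v t) \<alpha> s" for s
        by (rule tuple_sum_cong) (use elim(2) in simp)
      then show ?case using elim by (simp add: faa_di_bruno_def Q_def)
    qed
  qed
  \<comment> \<open>Isolates the top term. For \<open>s < ?n\<close> one has
    \<open>Suc s < m\<close>, so \<open>d s\<close> is differentiable everywhere and the ordinary
    chain rule covers the terms moved to the right.\<close>
  then have top_eq: "(\<lambda>t. d ?n (v t 0) * Q ?n t) = (\<lambda>t. H t - (\<Sum>s<?n. d s (v t 0) * Q s t))"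
    by (simp add: fun_eq_iff flip: lessThan_Suc_atMost)
  define L where "L s t = d (Suc s) (v t 0) * w t ?e * Q s t + d s (v t 0) * Q' s t" for s t
  have dH: "AE t in lborel. (H has_real_derivative h t) (at t)"
    using primitive_AE_deriv[OF H] by (simp add: AE_lborel_iff_lebesgue)
  have dv0: "AE t in lborel. ((\<lambda>t. v t 0) has_real_derivative w t ?e) (at t)"
    using primitive_AE_deriv[OF v[of 0]] by (simp add: AE_lborel_iff_lebesgue)
  have "AE t in lborel. ((\<lambda>t. d ?n (v t 0) * Q ?n t) has_real_derivative h t - (\<Sum>s<?n. L s t)) (at t)"
    using dH dv0 dQ
  proof eventually_elim
    case (elim t)
    have "((\<lambda>t. d s (v t 0) * Q s t) has_real_derivative L s t) (at t)" if "s < ?n" for s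
    proof -
      have "(d s has_real_derivative d (Suc s) (v t 0)) (at (v t 0))"
        using d that n by (auto simp: deriv_chain_def)
      from DERIV_mult[OF DERIV_chain2[OF this elim(2)] elim(3)[rule_format, of s]]
      show ?thesis by (simp add: L_def mult.commute add.commute)
    qed
    then show ?case unfolding top_eq by (intro DERIV_diff DERIV_sum elim(1)) auto
  qed
  \<comment> \<open>Here \<open>d ?n\<close> may be \<open>d (m - 1)\<close>, known to be
    differentiable almost everywhere only; but its composition times \<open>Q ?n\<close> has just
    been shown to have a derivative almost everywhere, which is what
    \<open>AE_deriv_comp_mult\<close> asks for.\<close>
  then have "AE t in lebesgue. h t - (\<Sum>s<?n. L s t) = d (Suc ?n) (v t 0) * w t ?e * Q ?n t + d ?n (v t 0) * Q' ?n t"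
    using d n dv0 dQ cQ
    by (intro AE_deriv_comp_mult[where g = "\<lambda>t. v t 0"]) (auto simp: deriv_chain_def AE_lborel_iff_lebesgue)
  then have "AE t in lborel. h t = (\<Sum>s\<le>?n. L s t)"
    unfolding AE_lborel_iff_lebesgue
    by eventually_elim (simp add: L_def algebra_simps flip: lessThan_Suc_atMost)
  then show ?thesis using wv_all
  proof eventually_elim
    case (elim t)
    have "tuple_sum (w t) \<alpha> s = tuple_sum (v t) \<alpha> s" for s
      by (rule tuple_sum_cong) (use elim(2) in simp)
    then show ?case using elim unfolding faa_di_bruno_step by (simp add: L_def Q_def Q'_def)
  qed
qed

text \<open>Induction on the order: one unit is taken off in some coordinate \<open>i\<close>, the
  step is made on the lines parallel to that axis, and \<open>AE_lines_conv\<close> leads back to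
  the space, as both sides are Borel.\<close>

lemma faa_di_bruno_AE:
  fixes w G :: "'n::finite multi_index \<Rightarrow> real^'n \<Rightarrow> real"
  assumes d: "deriv_chain m d" and w: "deriv_family m w" and G: "deriv_family m G"
    and G0: "AE x in lborel. G 0 x = d 0 (w 0 x)"
  shows "mi_abs \<alpha> \<le> m \<Longrightarrow> AE x in lborel. G \<alpha> x = faa_di_bruno (\<lambda>s. d s (w 0 x)) (\<lambda>\<beta>. w \<beta> x) \<alpha>"
proof (induction "mi_abs \<alpha>" arbitrary: \<alpha>)
  case 0
  then have "\<alpha> = 0" by (simp add: mi_abs_eq_0_iff)
  then show ?case using G0 by (simp add: faa_di_bruno_0)
next
  case (Suc n)
  then have "\<alpha> \<noteq> 0" by auto
  then obtain \<beta> i where \<alpha>: "\<alpha> = \<beta> + axis i 1" by (rule mi_decompose)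
  have \<beta>: "n = mi_abs \<beta>" "mi_abs \<beta> < m" using Suc.hyps(2) Suc.prems by (auto simp: \<alpha> mi_abs_add)
  let ?e = "axis i 1 :: real^'n"
  have IH: "AE x in lborel. G \<beta> x = faa_di_bruno (\<lambda>s. d s (w 0 x)) (\<lambda>\<gamma>. w \<gamma> x) \<beta>"
    using Suc.hyps(1)[OF \<beta>(1)] \<beta>(2) by simp
  have G': "borel_deriv [?e] (G \<beta>) (G \<alpha>)" using G \<beta> by (simp add: deriv_family_def \<alpha> del: One_nat_def)
  have wm: "w \<gamma> \<in> borel_measurable borel" if "mi_abs \<gamma> \<le> m" for \<gamma>
    using w that by (auto simp: deriv_family_def loc_borel_def)
  have w0 [measurable]: "w 0 \<in> borel_measurable borel" by (rule wm) simp
  have Gm [measurable]: "G \<alpha> \<in> borel_measurable borel"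
    using G Suc.prems by (auto simp: deriv_family_def loc_borel_def)
  have "(\<lambda>x. faa_di_bruno (\<lambda>s. d s (w 0 x)) (\<lambda>\<gamma>. w \<gamma> x) \<alpha>) \<in> borel_measurable borel"
    unfolding faa_di_bruno_def
  proof (intro borel_measurable_sum borel_measurable_times borel_measurable_const tuple_sum_measurable wm)
    fix s assume "s \<in> {..mi_abs \<alpha>}"
    then have "d s \<in> borel_measurable borel" using d Suc.prems by (auto simp: deriv_chain_def)
    then show "(\<lambda>x. d s (w 0 x)) \<in> borel_measurable borel" using w0 by measurable
  qed (use Suc.prems in auto)
  then have m: "Measurable.pred borel (\<lambda>x. G \<alpha> x = faa_di_bruno (\<lambda>s. d s (w 0 x)) (\<lambda>\<gamma>. w \<gamma> x) \<alpha>)"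
    by measurable
  have "AE x in lborel. AE t in lborel. G \<alpha> (x + t *\<^sub>R ?e) =
      faa_di_bruno (\<lambda>s. d s (w 0 (x + t *\<^sub>R ?e))) (\<lambda>\<gamma>. w \<gamma> (x + t *\<^sub>R ?e)) \<alpha>"
    using AE_lines[OF IH, of ?e] borel_deriv_lines[OF G' axis_in_Basis] deriv_family_lines[OF w \<beta>(2), of i]
  proof eventually_elim
    case (elim x)
    obtain H where H: "primitive H (\<lambda>t. G \<alpha> (x + t *\<^sub>R ?e))" "AE t in lborel. G \<beta> (x + t *\<^sub>R ?e) = H t"
      using elim(2) by blast
    obtain v where v: "\<forall>\<gamma>. mi_abs \<gamma> \<le> mi_abs \<beta> \<longrightarrow>
        primitive (\<lambda>t. v t \<gamma>) (\<lambda>t. w (\<gamma> + axis i 1) (x + t *\<^sub>R ?e)) \<and>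
        (AE t in lborel. w \<gamma> (x + t *\<^sub>R ?e) = v t \<gamma>)"
      using elim(3) by blast
    have eq: "AE t in lborel. H t = faa_di_bruno (\<lambda>s. d s (w 0 (x + t *\<^sub>R ?e))) (\<lambda>\<gamma>. w \<gamma> (x + t *\<^sub>R ?e)) \<beta>"
      using elim(1) H(2) by eventually_elim simp
    show ?case unfolding \<alpha>
      by (rule faa_di_bruno_line_step[OF d \<beta>(2) _ _ H(1)[unfolded \<alpha>] eq]) (use v in auto)
  qed
  from AE_lines_conv[OF m this] show ?case .
qed

text \<open>On almost every line \<open>w 0\<close> agrees almost everywhere with a primitive, and
  where that primitive takes values in the null set \<open>N\<close> its derivative vanishes almost
  everywhere. This serves to neglect the null set on which two representatives of
  \<open>f^(m)\<close> differ.\<close>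

lemma deriv_family_null_preimage:
  assumes w: "deriv_family m w" and m: "0 < m" and N: "N \<in> null_sets lborel"
  shows "AE x in lborel. w 0 x \<in> N \<longrightarrow> w (axis i 1) x = 0"
proof (rule AE_lines_conv)
  have [measurable]: "w 0 \<in> borel_measurable borel" "w (axis i 1) \<in> borel_measurable borel"
    using w m by (auto simp: deriv_family_def loc_borel_def)
  have [measurable]: "N \<in> sets borel" using N by auto
  show "Measurable.pred borel (\<lambda>x. w 0 x \<in> N \<longrightarrow> w (axis i 1) x = 0)" by measurable
  have negN: "negligible N"
    using N by (simp add: negligible_iff_null_sets null_sets_completionI)
  show "AE x in lborel. AE t in lborel. w 0 (x + t *\<^sub>R axis i 1) \<in> N \<longrightarrow> w (axis i 1) (x + t *\<^sub>R axis i 1) = 0"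
    using deriv_family_lines[OF w m, of i]
  proof eventually_elim
    case (elim x)
    then obtain v where v: "primitive (\<lambda>t. v t 0) (\<lambda>t. w (axis i 1) (x + t *\<^sub>R axis i 1))"
      "AE t in lborel. w 0 (x + t *\<^sub>R axis i 1) = v t 0"
      by (auto simp: mi_abs_eq_0_iff)
    let ?E = "{t. v t 0 \<in> N \<and> ((\<lambda>t. v t 0) has_real_derivative w (axis i 1) (x + t *\<^sub>R axis i 1)) (at t)}"
    have "negligible {t \<in> ?E. w (axis i 1) (x + t *\<^sub>R axis i 1) \<noteq> 0}"
      by (rule negligible_nonzero_deriv[where h = "\<lambda>t. v t 0"]) (auto intro: negligible_subset[OF negN])
    then have "AE t in lebesgue. t \<notin> {t \<in> ?E. w (axis i 1) (x + t *\<^sub>R axis i 1) \<noteq> 0}"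
      by (simp only: AE_lebesgue_iff_negligible not_not Collect_mem_eq)
    then have "AE t in lborel. t \<notin> {t \<in> ?E. w (axis i 1) (x + t *\<^sub>R axis i 1) \<noteq> 0}"
      by (simp only: AE_lborel_iff_lebesgue)
    moreover have "AE t in lborel. ((\<lambda>t. v t 0) has_real_derivative w (axis i 1) (x + t *\<^sub>R axis i 1)) (at t)"
      using primitive_AE_deriv[OF v(1)] by (simp only: AE_lborel_iff_lebesgue)
    ultimately show ?case using v(2) by eventually_elim auto
  qed
qed

text \<open>The weak derivatives of the various orders are given independently of each other;
  \<open>borel_deriv_quotient\<close> supplies the links between them.\<close>

lemma sobolev_deriv_family:
  fixes g :: "real^'n::finite \<Rightarrow> real"
  assumes "g \<in> sobolev m p"
  shows "\<exists>w. deriv_family m w \<and> (AE x in lborel. g x = w 0 x) \<and>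
    (\<forall>\<beta>. mi_abs \<beta> \<le> m \<longrightarrow> weak_deriv \<beta> g (w \<beta>))"
proof -
  have "\<exists>h. loc_borel h \<and> weak_deriv \<beta> g h" if \<beta>: "mi_abs \<beta> \<le> m" for \<beta>
  proof -
    obtain h where h: "weak_deriv \<beta> g h" using assms \<beta> unfolding sobolev_def by blast
    then have "locally_integrable h" by (simp add: weak_deriv_mi_dirs distr_deriv_def)
    then obtain h0 where h0: "loc_borel h0" "AE x in lebesgue. h x = h0 x" using loc_borel_rep by blast
    have "weak_deriv \<beta> g h0"
      using distr_deriv_cong[OF h[unfolded weak_deriv_mi_dirs] _ h0(2) mi_dirs_Basis, of g] by (simp add: weak_deriv_mi_dirs)
    with h0 show ?thesis by blast
  qed
  then have "\<forall>\<beta>. \<exists>h. mi_abs \<beta> \<le> m \<longrightarrow> loc_borel h \<and> weak_deriv \<beta> g h" by blast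
  then obtain w where w: "\<forall>\<beta>. mi_abs \<beta> \<le> m \<longrightarrow> loc_borel (w \<beta>) \<and> weak_deriv \<beta> g (w \<beta>)"
    by (rule choice[THEN exE])
  have w0: "loc_borel (w 0)" "distr_deriv [] g (w 0)" using w[rule_format, of 0] by (auto simp: weak_deriv_mi_dirs mi_dirs_0)
  \<comment> \<open>Order 0 is the derivative along the empty list, so \<open>g\<close> and
    \<open>w 0\<close> are both derivatives of order 0 of \<open>g\<close> and coincide almost
    everywhere.\<close>
  have "distr_deriv [] g g" using w0(2) by (simp add: distr_deriv_def)
  from distr_deriv_unique[OF this w0(2)] have g0: "AE x in lebesgue. g x = w 0 x" by simp
  have bd: "borel_deriv (mi_dirs \<beta>) (w 0) (w \<beta>)" if "mi_abs \<beta> \<le> m" for \<beta>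
    using distr_deriv_iff_borel[OF w0(1) _ g0 _ mi_dirs_Basis, of "w \<beta>" "w \<beta>" \<beta>] w[rule_format, OF that]
    by (simp add: weak_deriv_mi_dirs)
  have "deriv_family m w"
    unfolding deriv_family_def
  proof (intro conjI allI impI)
    fix \<beta> :: "'n multi_index" and i assume "mi_abs \<beta> < m"
    then have b: "mi_abs \<beta> \<le> m" "mi_abs (\<beta> + axis i 1) \<le> m" by (auto simp: mi_abs_add)
    show "borel_deriv [axis i 1] (w \<beta>) (w (\<beta> + axis i 1))"
      by (rule borel_deriv_quotient[OF bd[OF b(1)] bd[OF b(2)] mset_mi_dirs_add mi_dirs_Basis])
  qed (use w in auto)
  with w g0 show ?thesis by (auto simp: AE_lborel_iff_lebesgue)
qed

text \<open>Only \<open>s = m\<close> leaves freedom in the choice of \<open>u\<close>. Then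
  \<open>\<alpha>\<close> has order \<open>m\<close> and every entry of \<open>\<gamma>\<close>
  order 1, so the product contains a first derivative of \<open>g\<close>, which vanishes almost
  everywhere on the set that \<open>g\<close> maps into the null set where \<open>u\<close> and
  \<open>d m\<close> differ.\<close>

lemma fdb_product_AE:
  fixes g :: "real^'n::finite \<Rightarrow> real"
  assumes d: "deriv_chain m d" and dm: "deriv_rep m f m (d m)"
    and ds: "\<And>s. s < m \<Longrightarrow> d s = (deriv ^^ s) f"
    and w: "deriv_family m w" "AE x in lborel. g x = w 0 x"
      "\<And>\<beta>. mi_abs \<beta> \<le> m \<Longrightarrow> weak_deriv \<beta> g (w \<beta>)"
    and \<alpha>: "mi_abs \<alpha> \<le> m" and s: "s \<in> {1..mi_abs \<alpha>}" and \<gamma>: "\<gamma> \<in> mi_tuples \<alpha> s"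
    and P: "P \<in> fdb_product m f g \<gamma>"
  shows "AE x in lebesgue. P x = d s (w 0 x) * (\<Prod>r<s. w (\<gamma> ! r) x)"
proof -
  have len: "length \<gamma> = s" using \<gamma> by (simp add: mi_tuples_def)
  obtain u v w' where u: "deriv_rep m f s u" and v: "AE x in lebesgue. v x = g x"
    and w': "\<forall>r<s. weak_deriv (\<gamma> ! r) g (w' r)" and Puv: "AE x in lebesgue. P x = u (v x) * (\<Prod>r<s. w' r x)"
    using P unfolding fdb_product_def len by blast
  have \<gamma>m: "mi_abs (\<gamma> ! r) \<le> m" if "r < s" for r
    using mi_tuples_mi_abs_le(2)[OF \<gamma>, of "\<gamma> ! r"] \<alpha> that len by simp
  have "AE x in lebesgue. \<forall>r\<in>{..<s}. w' r x = w (\<gamma> ! r) x"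
  proof (rule AE_finite_allI)
    fix r assume "r \<in> {..<s}"
    then have "distr_deriv (mi_dirs (\<gamma> ! r)) g (w' r)" "distr_deriv (mi_dirs (\<gamma> ! r)) g (w (\<gamma> ! r))"
      using w' w(3)[OF \<gamma>m] by (auto simp: weak_deriv_mi_dirs)
    then show "AE x in lebesgue. w' r x = w (\<gamma> ! r) x"
      by (rule distr_deriv_unique) (rule mi_dirs_Basis)
  qed simp
  moreover have "AE x in lebesgue. u (w 0 x) * (\<Prod>r<s. w (\<gamma> ! r) x) = d s (w 0 x) * (\<Prod>r<s. w (\<gamma> ! r) x)"
  proof (cases "s < m")
    case True
    then show ?thesis using u ds by (simp add: deriv_rep_def)
  next
    case False
    then have sm: "s = m" "mi_abs \<alpha> = m" using s \<alpha> by auto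
    have "AE y in lebesgue. u y = d m y"
      using u dm unfolding sm deriv_rep_def by (auto intro!: distr_deriv_unique)
    then have "AE y in lborel. u y = d m y" by (simp only: AE_lborel_iff_lebesgue)
    then obtain N where N: "{y. u y \<noteq> d m y} \<subseteq> N" "N \<in> null_sets lborel"
      by (auto elim!: AE_E simp: null_sets_def)
    have r0: "0 < s" "\<gamma> ! 0 \<in> set \<gamma>" using s len by auto
    have "mi_abs (\<gamma> ! 0) = 1" using mi_tuples_mi_abs_le[OF \<gamma> r0(2)] sm by linarith
    then obtain i where i: "\<gamma> ! 0 = axis i 1" by (rule mi_abs_eq_1)
    have "AE x in lborel. w 0 x \<in> N \<longrightarrow> w (axis i 1) x = 0"
      by (rule deriv_family_null_preimage[OF w(1) _ N(2)]) (use r0 sm in simp)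
    then have "AE x in lebesgue. w 0 x \<in> N \<longrightarrow> w (axis i 1) x = 0" by (simp only: AE_lborel_iff_lebesgue)
    then show ?thesis
    proof eventually_elim
      case (elim x)
      show ?case
      proof (cases "w 0 x \<in> N")
        case True
        then have "w (\<gamma> ! 0) x = 0" using elim i by simp
        then have "(\<Prod>r<s. w (\<gamma> ! r) x) = 0" using r0 by (intro prod_zero) auto
        then show ?thesis by simp
      next
        case False
        then have "u (w 0 x) = d m (w 0 x)" using N(1) by blast
        then show ?thesis by (simp add: sm)
      qed
    qed
  qed
  moreover have "AE x in lebesgue. g x = w 0 x" using w(2) by (simp only: AE_lborel_iff_lebesgue)
  ultimately show ?thesis using Puv v by eventually_elim simp
qed

section \<open>Regularity of the outer function\<close>

definition plateau :: "real \<Rightarrow> 'a::euclidean_space \<Rightarrow> real" where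
  "plateau R x = (\<Prod>b\<in>Basis. step (x \<bullet> b + (R + 1)) * step (x \<bullet> (-b) + (R + 1)))"

lemma smooth_plateau: "smooth (plateau R)"
  unfolding plateau_def[abs_def]
  by (intro smooth_prod smooth_mult smooth_comp[OF smooth_step] smooth_affine) simp

lemma plateau_1:
  assumes "\<And>b. b \<in> Basis \<Longrightarrow> \<bar>x \<bullet> b\<bar> \<le> R" shows "plateau R x = 1"
  unfolding plateau_def
proof (intro prod.neutral ballI)
  fix b :: 'a assume "b \<in> Basis"
  from assms[OF this] have "step (x \<bullet> b + (R + 1)) = 1" "step (x \<bullet> (-b) + (R + 1)) = 1"
    by (auto intro!: step_1)
  then show "step (x \<bullet> b + (R + 1)) * step (x \<bullet> (-b) + (R + 1)) = 1" by simp
qed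

lemma test_function_plateau: "test_function (plateau R)"
proof (rule test_functionI[OF smooth_plateau], rule bounded_subset[OF bounded_cbox], rule subsetI)
  fix x :: 'a assume "x \<in> {x. plateau R x \<noteq> 0}"
  then have *: "step (x \<bullet> b + (R + 1)) \<noteq> 0 \<and> step (x \<bullet> (-b) + (R + 1)) \<noteq> 0" if "b \<in> Basis" for b
    using that by (auto simp: plateau_def)
  have "\<bar>x \<bullet> b\<bar> \<le> R + 1" if "b \<in> Basis" for b
    using *[OF that] step_0[of "x \<bullet> b + (R + 1)"] step_0[of "x \<bullet> (-b) + (R + 1)"] by force
  then show "x \<in> cbox (- (R + 1) *\<^sub>R One) ((R + 1) *\<^sub>R One)"
    by (force simp: mem_box abs_le_iff)
qed

lemma test_function_in_Lp:
  assumes \<phi>: "test_function \<phi>" and p: "p \<ge> 0" shows "in_Lp p \<phi>"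
proof -
  have [measurable]: "\<phi> \<in> borel_measurable borel" using \<phi> by (rule test_function_borel)
  obtain B R where B: "B \<ge> 0" "\<forall>x. \<bar>\<phi> x\<bar> \<le> B * indicator (cball 0 R) x" by (rule test_function_dominated[OF \<phi>])
  have one: "loc_borel (\<lambda>_. 1)" by (rule loc_borel_continuous) simp
  have "integrable lborel (\<lambda>x. 1 * (\<bar>\<phi> x\<bar> powr p))"
  proof (rule loc_borel_mult_integrable[OF one, where B = "B powr p"])
    fix x
    have "\<bar>\<phi> x\<bar> \<le> B" using order_trans[OF B(2)[rule_format, of x]] B(1) by (simp add: indicator_def)
    then show "\<bar>\<bar>\<phi> x\<bar> powr p\<bar> \<le> B powr p" using p by (simp add: powr_mono2)
  next
    show "bounded {x. \<bar>\<phi> x\<bar> powr p \<noteq> 0}"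
      by (rule bounded_subset[OF test_function_bounded_support[OF \<phi>]]) auto
  qed measurable
  then show ?thesis
    unfolding in_Lp_def by (simp add: integrable_completion measurable_completion)
qed

lemma test_function_weak_deriv:
  assumes "test_function g" shows "\<exists>h. weak_deriv \<beta> g h \<and> test_function h"
proof -
  let ?h = "iter_deriv (rev (mi_dirs \<beta>)) g"
  have b: "borel_deriv (mi_dirs \<beta>) g ?h" by (rule borel_deriv_test_iter[OF assms mi_dirs_Basis])
  then have "distr_deriv (mi_dirs \<beta>) g ?h"
    by (subst distr_deriv_iff_borel[of g ?h]) (auto simp: borel_deriv_def mi_dirs_Basis[THEN subsetD])
  moreover have "set (rev (mi_dirs \<beta>)) \<subseteq> Basis" using mi_dirs_Basis[of \<beta>] by simp
  then have "test_function ?h" by (rule test_function_iter_deriv[OF assms])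
  ultimately show ?thesis by (auto simp: weak_deriv_mi_dirs)
qed

lemma test_function_in_sobolev:
  assumes g: "test_function g" and p: "p \<ge> 0"
  shows "g \<in> sobolev m p" "g \<in> homogeneous_sobolev1 p"
  using test_function_weak_deriv[OF g] test_function_in_Lp[OF _ p]
  unfolding sobolev_def homogeneous_sobolev1_def by blast+

section \<open>Chains of derivatives on bounded intervals\<close>

lemma AE_translate:
  assumes "AE x in lborel. P x" shows "AE x in lborel. P (x + a)"
proof -
  obtain N where N: "{x. \<not> P x} \<subseteq> N" "N \<in> sets borel" "emeasure lborel N = 0"
    using assms by (auto elim!: AE_E)
  have "AE x in lborel. x \<notin> N" by (rule AE_not_in) (use N in \<open>auto simp: null_sets_def\<close>)
  from AE_shift[OF this N(2), of a] show ?thesis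
    by eventually_elim (use N(1) in auto)
qed

lemma AE_open_witness:
  assumes "AE x in lborel. P x" "open U" "U \<noteq> {}" shows "\<exists>x\<in>U. P x"
proof (rule ccontr)
  assume "\<not> (\<exists>x\<in>U. P x)"
  then have "U \<subseteq> {x. \<not> P x}" by auto
  moreover have "negligible {x. \<not> P x}"
    using assms(1) by (simp add: AE_lborel_iff_lebesgue[symmetric] AE_lebesgue_iff_negligible)
  ultimately show False using open_not_negligible[OF assms(2,3)] negligible_subset by blast
qed

text \<open>Like \<open>deriv_chain\<close>, but meant for functions that agree with
  \<open>f\<close> and its derivatives on a bounded interval only; being defined on the whole line,
  they need no conditions at endpoints.\<close>

definition local_chain :: "nat \<Rightarrow> (nat \<Rightarrow> real \<Rightarrow> real) \<Rightarrow> bool" where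
  "local_chain m A \<longleftrightarrow> (\<forall>k t. Suc k < m \<longrightarrow> (A k has_real_derivative A (Suc k) t) (at t)) \<and>
    primitive (A (m - 1)) (A m) \<and> loc_borel (A m)"

lemma primitive_shift:
  assumes "primitive F u" shows "primitive (\<lambda>t. F (t + c)) (\<lambda>t. u (t + c))"
  unfolding primitive_def
proof (intro allI impI)
  fix a b :: real assume "a \<le> b"
  then have "(u has_integral F (b + c) - F (a + c)) (cbox (a + c) (b + c))"
    using primitiveD[OF assms, of "a + c" "b + c"] by simp
  from has_integral_shift_cbox[OF this, of c]
  show "((\<lambda>t. u (t + c)) has_integral F (b + c) - F (a + c)) {a..b}" by simp
qed

lemma loc_borel_real_iff:
  "loc_borel (u :: real \<Rightarrow> real) \<longleftrightarrow> u \<in> borel_measurable borel \<and> (\<forall>a b. set_integrable lborel {a..b} u)"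
proof
  assume u: "loc_borel u"
  have "set_integrable lborel {a..b} u" for a b
  proof -
    have "set_integrable lborel (cball 0 (max \<bar>a\<bar> \<bar>b\<bar>)) u"
      using u by (simp add: loc_borel_def set_integrable_def)
    then show ?thesis by (rule set_integrable_subset) auto
  qed
  then show "u \<in> borel_measurable borel \<and> (\<forall>a b. set_integrable lborel {a..b} u)"
    using u by (simp add: loc_borel_def)
next
  assume "u \<in> borel_measurable borel \<and> (\<forall>a b. set_integrable lborel {a..b} u)"
  then show "loc_borel u"
    by (simp add: loc_borel_def set_integrable_def cball_eq_atLeastAtMost)
qed

lemma loc_borel_shift_real:
  fixes u :: "real \<Rightarrow> real"
  assumes u: "loc_borel u" shows "loc_borel (\<lambda>t. u (t + c))"
  unfolding loc_borel_real_iff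
proof (intro conjI allI)
  have [measurable]: "u \<in> borel_measurable borel" using u by (simp add: loc_borel_def)
  show "(\<lambda>t. u (t + c)) \<in> borel_measurable borel" by measurable
  fix a b
  have "integrable lborel (\<lambda>t. indicator {a + c..b + c} t *\<^sub>R u t)"
    using u by (simp add: loc_borel_real_iff set_integrable_def)
  then have "integrable lborel (\<lambda>t. (\<lambda>t. indicator {a + c..b + c} t *\<^sub>R u t) (t + c))"
    by (subst lborel_integrable_shift) auto
  then show "set_integrable lborel {a..b} (\<lambda>t. u (t + c))"
    by (simp add: set_integrable_def indicator_def)
qed

lemma local_chain_shift: "local_chain m A \<Longrightarrow> local_chain m (\<lambda>k t. A k (t + c))"
  unfolding local_chain_def
  by (auto intro: primitive_shift loc_borel_shift_real simp: DERIV_shift[symmetric])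

lemma primitive_continuous_deriv:
  assumes F: "primitive F u" and u: "continuous_on UNIV u"
  shows "(F has_real_derivative u t) (at t)"
proof -
  have "((\<lambda>s. integral {t - 1..s} u) has_real_derivative u t) (at t within {t - 1..t + 1})"
    by (intro integral_has_real_derivative continuous_on_subset[OF u]) auto
  then have "((\<lambda>s. F (t - 1) + integral {t - 1..s} u) has_real_derivative 0 + u t) (at t within {t - 1..t + 1})"
    by (intro DERIV_add DERIV_const)
  moreover have "at t within {t - 1..t + 1} = at t"
    by (rule at_within_interior) (simp add: interior_atLeastAtMost_real)
  ultimately have D: "((\<lambda>s. F (t - 1) + integral {t - 1..s} u) has_real_derivative u t) (at t)" by simp
  have ev: "eventually (\<lambda>s. F (t - 1) + integral {t - 1..s} u = F s) (nhds t)"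
    unfolding eventually_nhds
  proof (intro exI[of _ "{t - 1<..}"] conjI ballI)
    fix s assume "s \<in> {t - 1<..}"
    then show "F (t - 1) + integral {t - 1..s} u = F s"
      using integral_unique[OF primitiveD[OF F, of "t - 1" s]] by simp
  qed auto
  show ?thesis using D by (simp only: DERIV_cong_ev[OF refl ev refl])
qed

lemma primitive_cong_AE:
  assumes F: "primitive F u" and ae: "AE t in lborel. u t = v t"
  shows "primitive F v"
  unfolding primitive_def
proof (intro allI impI)
  fix a b :: real assume ab: "a \<le> b"
  have N: "negligible {t. \<not> (u t = v t)}"
    using ae by (simp only: AE_lborel_iff_lebesgue[symmetric] AE_lebesgue_iff_negligible)
  show "(v has_integral F b - F a) {a..b}"
    by (rule has_integral_spike[OF N _ primitiveD[OF F ab]]) auto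
qed

text \<open>The inner function is a test function that agrees with \<open>\<theta> (x $ i)\<close> near the origin; the derivatives of
  \<open>f \<circ> g\<close> in direction \<open>i\<close>, restricted to a generic line, then give the chain.\<close>

lemma probe:
  fixes X :: "(real^'n::finite \<Rightarrow> real) set"
  assumes X: "\<And>g. test_function g \<Longrightarrow> g \<in> X" "X \<subseteq> sobolev m p" "\<forall>g\<in>X. f \<circ> g \<in> X"
    and m: "m \<ge> 1" and \<theta>: "smooth \<theta>" and R: "R > 0"
  shows "\<exists>A. local_chain m A \<and> (AE t in lborel. \<bar>t\<bar> < R \<longrightarrow> f (\<theta> t) = A 0 t)"
proof -
  obtain i :: 'n where True by simp
  let ?e = "axis i 1 :: real^'n"
  \<comment> \<open>The generic line will have a base point with coordinates below 1 in absolute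
    value and is followed for \<open>\<bar>t\<bar> < R + 1\<close>, so it stays where the plateau
    equals 1.\<close>
  define g where "g x = \<theta> (x \<bullet> ?e + 0) * plateau (R + 2) x" for x
  have "test_function g"
    unfolding g_def[abs_def]
    by (intro test_function_mult_left smooth_comp[OF \<theta>] smooth_affine test_function_plateau)
  then have "f \<circ> g \<in> sobolev m p" using X by blast
  then obtain G where G: "deriv_family m G" "AE x in lborel. (f \<circ> g) x = G 0 x"
    using sobolev_deriv_family by blast
  define w where "w k = G (axis i k)" for k
  have axis_0: "axis i 0 = (0 :: 'n multi_index)" by (simp add: vec_eq_iff axis_def)
  have w0: "w 0 = G 0" by (simp only: w_def axis_0)
  have axis_Suc: "axis i k + axis i 1 = (axis i (Suc k) :: 'n multi_index)" for k
    by (auto simp: vec_eq_iff axis_def)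
  have bd: "borel_deriv [?e] (w k) (w (Suc k))" if "k < m" for k
    using G(1) that unfolding deriv_family_def w_def axis_Suc[symmetric] by simp
  have "AE x in lborel. \<forall>k\<in>{..<m}. \<exists>H. primitive H (\<lambda>t. w (Suc k) (x + t *\<^sub>R ?e)) \<and> (AE t in lborel. w k (x + t *\<^sub>R ?e) = H t)"
    using bd by (intro AE_finite_allI borel_deriv_lines axis_in_Basis) auto
  moreover have wm: "loc_borel (w m)" using G(1) by (simp add: deriv_family_def w_def)
  moreover have "AE x in lborel. AE t in lborel. (f \<circ> g) (x + t *\<^sub>R ?e) = w 0 (x + t *\<^sub>R ?e)"
    using AE_lines[OF G(2)] by (simp add: w0)
  ultimately have "AE x in lborel. (\<forall>k\<in>{..<m}. \<exists>H. primitive H (\<lambda>t. w (Suc k) (x + t *\<^sub>R ?e)) \<and> (AE t in lborel. w k (x + t *\<^sub>R ?e) = H t)) \<and>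
      (\<forall>a b. set_integrable lborel {a..b} (\<lambda>t. w m (x + t *\<^sub>R ?e))) \<and>
      (AE t in lborel. (f \<circ> g) (x + t *\<^sub>R ?e) = w 0 (x + t *\<^sub>R ?e))"
    using loc_borel_line_integrable[OF wm norm_Basis[OF axis_in_Basis]] by (intro AE_conjI)
  from AE_open_witness[OF this, of "box (- One) One"]
  obtain x where x: "x \<in> box (- One) One"
    and xH: "\<forall>k\<in>{..<m}. \<exists>H. primitive H (\<lambda>t. w (Suc k) (x + t *\<^sub>R ?e)) \<and> (AE t in lborel. w k (x + t *\<^sub>R ?e) = H t)"
    and xm: "\<forall>a b. set_integrable lborel {a..b} (\<lambda>t. w m (x + t *\<^sub>R ?e))"
    and xf: "AE t in lborel. (f \<circ> g) (x + t *\<^sub>R ?e) = w 0 (x + t *\<^sub>R ?e)"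
    by (auto simp: box_eq_empty open_box)
  from xH obtain H where H: "\<forall>k\<in>{..<m}. primitive (H k) (\<lambda>t. w (Suc k) (x + t *\<^sub>R ?e)) \<and> (AE t in lborel. w k (x + t *\<^sub>R ?e) = H k t)"
    by (rule bchoice[THEN exE])
  \<comment> \<open>Below order \<open>m\<close> the continuous versions on the line; at order
    \<open>m\<close>, where there is only local integrability, the restriction itself.\<close>
  define A where "A k = (if k < m then H k else (\<lambda>t. w m (x + t *\<^sub>R ?e)))" for k
  have "(A k has_real_derivative A (Suc k) t) (at t)" if k: "Suc k < m" for k t
  proof (rule primitive_continuous_deriv)
    have "primitive (H k) (\<lambda>t. w (Suc k) (x + t *\<^sub>R ?e))" "AE t in lborel. w (Suc k) (x + t *\<^sub>R ?e) = H (Suc k) t"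
      using H k by auto
    then have "primitive (H k) (H (Suc k))" by (rule primitive_cong_AE)
    then show "primitive (A k) (A (Suc k))" using k by (simp add: A_def)
    show "continuous_on UNIV (A (Suc k))"
      using k H by (auto simp: A_def intro: primitive_continuous)
  qed
  moreover have "primitive (A (m - 1)) (A m)" using H m by (auto simp: A_def dest: bspec[of _ _ "m - 1"])
  moreover have "loc_borel (A m)"
  proof -
    have [measurable]: "w m \<in> borel_measurable borel" using wm by (simp add: loc_borel_def)
    show ?thesis using xm by (simp add: loc_borel_real_iff A_def)
  qed
  ultimately have A: "local_chain m A" by (simp add: local_chain_def)
  have xb: "\<bar>x \<bullet> b\<bar> < 1" if "b \<in> Basis" for b
    using x that by (auto simp: mem_box abs_less_iff)
  define y where "y = x \<bullet> ?e"
  have y: "\<bar>y\<bar> < 1" unfolding y_def by (rule xb[OF axis_in_Basis])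
  have gx: "g (x + t *\<^sub>R ?e) = \<theta> (y + t)" if "\<bar>t\<bar> < R + 1" for t
  proof -
    have "plateau (R + 2) (x + t *\<^sub>R ?e) = 1"
    proof (rule plateau_1)
      fix b :: "real^'n" assume b: "b \<in> Basis"
      have "\<bar>?e \<bullet> b\<bar> \<le> 1" using b axis_in_Basis[of i] by (simp add: inner_Basis)
      then have "\<bar>t\<bar> * \<bar>?e \<bullet> b\<bar> \<le> \<bar>t\<bar> * 1" by (rule mult_left_mono) simp
      then have "\<bar>t * (?e \<bullet> b)\<bar> \<le> \<bar>t\<bar>" by (simp add: abs_mult)
      then show "\<bar>(x + t *\<^sub>R ?e) \<bullet> b\<bar> \<le> R + 2"
        using xb[OF b] that by (simp add: inner_add_left)
    qed
    moreover have "?e \<bullet> ?e = 1" using norm_Basis[OF axis_in_Basis[of i]] by (simp add: norm_eq_1)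
    ultimately show ?thesis by (simp add: g_def y_def inner_add_left)
  qed
  have "AE t in lborel. w 0 (x + t *\<^sub>R ?e) = A 0 t" using H m by (simp add: A_def)
  with xf have "AE t in lborel. \<bar>t\<bar> < R + 1 \<longrightarrow> f (\<theta> (y + t)) = A 0 t"
  proof eventually_elim
    case (elim t)
    then show ?case using gx[of t] by auto
  qed
  \<comment> \<open>Makes the coordinate itself the parameter; since
    \<open>\<bar>y\<bar> < 1\<close>, the window \<open>R + 1\<close> shrinks to
    \<open>R\<close>.\<close>
  from AE_translate[OF this, of "- y"]
  have "AE t in lborel. \<bar>t\<bar> < R \<longrightarrow> f (\<theta> t) = A 0 (t + (- y))"
    by eventually_elim (use y in auto)
  then show ?thesis using local_chain_shift[OF A, of "- y"] by (intro exI[of _ "\<lambda>k t. A k (t + (- y))"]) auto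
qed

lemma AE_zero_closed_interval:
  fixes K :: "real \<Rightarrow> real"
  assumes K: "continuous_on UNIV K" and ab: "a < b" and ae: "AE t in lborel. t \<in> {a<..<b} \<longrightarrow> K t = 0"
    and t: "t \<in> {a..b}"
  shows "K t = 0"
proof (rule continuous_constant_on_closure[of "{a<..<b}" K 0])
  show "continuous_on (closure {a<..<b}) K" by (rule continuous_on_subset[OF K]) auto
  show "t \<in> closure {a<..<b}" using ab t by simp
  fix s assume s: "s \<in> {a<..<b}"
  show "K s = 0"
  proof (rule ccontr)
    assume "K s \<noteq> 0"
    have "open ({a<..<b} \<inter> {s. K s \<noteq> 0})"
      by (intro open_Int open_Collect_neq) (use K in auto)
    moreover have "{a<..<b} \<inter> {s. K s \<noteq> 0} \<noteq> {}" using s \<open>K s \<noteq> 0\<close> by auto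
    ultimately have "\<exists>r\<in>{a<..<b} \<inter> {s. K s \<noteq> 0}. r \<in> {a<..<b} \<longrightarrow> K r = 0"
      by (rule AE_open_witness[OF ae])
    then show False by auto
  qed
qed

lemma local_chain_continuous:
  assumes A: "local_chain m A" and k: "k < m" shows "continuous_on UNIV (A k)"
proof (cases "Suc k < m")
  case True
  then have "isCont (A k) t" for t using A unfolding local_chain_def by (meson DERIV_isCont)
  then show ?thesis by (simp add: continuous_at_imp_continuous_on)
next
  case False
  then have "k = m - 1" using k by simp
  then show ?thesis using A by (auto simp: local_chain_def intro: primitive_continuous)
qed

lemma flat_deriv_pos:
  assumes "t > 0" shows "\<exists>d>0. (flat has_real_derivative d) (at t)"
proof -
  have "((\<lambda>t. exp (- (1 / t))) has_real_derivative exp (- (1 / t)) / t\<^sup>2) (at t)"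
    using assms by (auto intro!: derivative_eq_intros simp: power2_eq_square)
  moreover have ev: "eventually (\<lambda>s. flat s = exp (- (1 / s))) (nhds t)"
    using eventually_nhds_in_open[of "{0<..}" t] assms by (auto elim!: eventually_mono simp: flat_def)
  ultimately have "(flat has_real_derivative exp (- (1 / t)) / t\<^sup>2) (at t)"
    by (simp only: DERIV_cong_ev[OF refl ev refl])
  then show ?thesis using assms by (intro exI[of _ "exp (- (1 / t)) / t\<^sup>2"]) auto
qed

text \<open>The probe \<open>t0 + c * flat t\<close> takes the value \<open>t0\<close> on a half line; so it detects \<open>f t0\<close> itself, whereas
  the linear probe only sees \<open>f\<close> up to null sets.\<close>

lemma local_representation:
  fixes X :: "(real^'n::finite \<Rightarrow> real) set"
  assumes X: "\<And>g. test_function g \<Longrightarrow> g \<in> X" "X \<subseteq> sobolev m p" "\<forall>g\<in>X. f \<circ> g \<in> X"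
    and m: "m \<ge> 1" and R: "R > 0"
  shows "\<exists>A. local_chain m A \<and> (\<forall>t. \<bar>t\<bar> < R \<longrightarrow> f t = A 0 t)"
proof -
  have "smooth (\<lambda>t::real. t)" using smooth_affine[of "1::real" 0] by simp
  from probe[OF X m this R] obtain B where B: "local_chain m B" "AE t in lborel. \<bar>t\<bar> < R \<longrightarrow> f t = B 0 t"
    by auto
  have "f t0 = B 0 t0" if t0: "\<bar>t0\<bar> < R" for t0
  proof -
    \<comment> \<open>As \<open>flat\<close> is at most 1, half of the room left by
      \<open>t0\<close> keeps all values of \<open>\<theta>\<close> inside
      \<open>{-R<..<R}\<close>.\<close>
    define c where "c = (R - \<bar>t0\<bar>) / 2"
    have c: "c > 0" "\<bar>t0\<bar> + c < R" using t0 by (auto simp: c_def field_simps)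
    define \<theta> where "\<theta> t = t0 + c * flat t" for t
    have \<theta>R: "\<bar>\<theta> t\<bar> < R" for t
    proof -
      have "c * flat t \<le> c * 1" using c by (intro mult_left_mono flat_le_1) auto
      moreover have "0 \<le> c * flat t" using c flat_nonneg[of t] by simp
      ultimately show ?thesis using c unfolding \<theta>_def by linarith
    qed
    have "smooth \<theta>" unfolding \<theta>_def[abs_def]
      by (intro smooth_add smooth_mult smooth_const smooth_flat)
    from probe[OF X m this, of 1] obtain A where A: "local_chain m A" "AE t in lborel. \<bar>t\<bar> < 1 \<longrightarrow> f (\<theta> t) = A 0 t"
      by auto
    have cA: "continuous_on UNIV (A 0)" and cB: "continuous_on UNIV (B 0)"
      using local_chain_continuous[OF A(1)] local_chain_continuous[OF B(1)] m by auto
    \<comment> \<open>For negative \<open>t\<close> the probe is constantly \<open>t0\<close>, and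
      continuity of \<open>A 0\<close> carries the value \<open>f t0\<close> to the point 0. The
      comparison with \<open>B 0\<close>, made from the right, meets this one at
      \<open>t = 0\<close>.\<close>
    have "A 0 0 - f t0 = 0"
    proof (rule AE_zero_closed_interval[of "\<lambda>t. A 0 t - f t0" "-1" 0])
      show "AE t in lborel. t \<in> {-1<..<0} \<longrightarrow> A 0 t - f t0 = 0"
        using A(2) by eventually_elim (auto simp: \<theta>_def flat_nonpos)
    qed (auto intro!: continuous_intros cA)
    moreover have "A 0 0 - B 0 (\<theta> 0) = 0"
    proof (rule AE_zero_closed_interval[of "\<lambda>t. A 0 t - B 0 (\<theta> t)" 0 1])
      show "continuous_on UNIV (\<lambda>t. A 0 t - B 0 (\<theta> t))"
        by (intro continuous_intros cA continuous_on_compose2[OF cB smooth_continuous[OF \<open>smooth \<theta>\<close>]]) auto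
      have "\<exists>d. \<forall>t>0. d t > 0 \<and> (flat has_real_derivative d t) (at t)"
        using flat_deriv_pos by metis
      then obtain d where d: "\<forall>t>0. d t > 0 \<and> (flat has_real_derivative d t) (at t)" by blast
      let ?Z = "{z. \<not> (\<bar>z\<bar> < R \<longrightarrow> f z = B 0 z)}" and ?E = "{t. t > 0 \<and> \<theta> t \<in> {z. \<not> (\<bar>z\<bar> < R \<longrightarrow> f z = B 0 z)}}"
      have Z: "negligible ?Z"
        using B(2) by (simp only: AE_lborel_iff_lebesgue[symmetric] AE_lebesgue_iff_negligible)
      \<comment> \<open>The lemma is read backwards: \<open>\<theta>\<close> maps \<open>?E\<close>
        into a null set although its derivative \<open>c * d t\<close> is positive there, so
        \<open>?E\<close> itself is null, and \<open>f (\<theta> t) = B 0 (\<theta> t)\<close> for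
        almost every positive \<open>t\<close>.\<close>
      have "negligible {t \<in> ?E. c * d t \<noteq> 0}"
      proof (rule negligible_nonzero_deriv[where h = \<theta>])
        show "(\<theta> has_real_derivative c * d t) (at t)" if "t \<in> ?E" for t
        proof -
          have "((\<lambda>t. t0 + c * flat t) has_real_derivative 0 + c * d t) (at t)"
            using d that by (intro DERIV_add DERIV_const DERIV_cmult) auto
          then show ?thesis by (simp add: \<theta>_def[abs_def])
        qed
        show "negligible (\<theta> ` ?E)" by (rule negligible_subset[OF Z]) auto
      qed
      moreover have "c * d t \<noteq> 0" if "t \<in> ?E" for t
      proof -
        have "0 < c * d t" using c(1) d that by (intro mult_pos_pos) auto
        then show ?thesis by (rule less_imp_neq[THEN not_sym])
      qed
      then have "{t \<in> ?E. c * d t \<noteq> 0} = ?E" by blast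
      ultimately have "negligible ?E" by simp
      then have "AE t in lborel. \<not> (t > 0 \<and> \<theta> t \<in> ?Z)"
        by (simp only: AE_lborel_iff_lebesgue[symmetric] AE_lebesgue_iff_negligible not_not)
      then show "AE t in lborel. t \<in> {0<..<1} \<longrightarrow> A 0 t - B 0 (\<theta> t) = 0"
        using A(2) by eventually_elim (use \<theta>R in auto)
    qed auto
    ultimately show "f t0 = B 0 t0" by (simp add: \<theta>_def flat_nonpos)
  qed
  with B(1) show ?thesis by blast
qed

lemma local_chain_deriv:
  assumes A: "local_chain m A" and f: "\<And>t. \<bar>t\<bar> < R \<Longrightarrow> f t = A 0 t"
  shows "k < m \<Longrightarrow> \<bar>t\<bar> < R \<Longrightarrow> (deriv ^^ k) f t = A k t"
proof (induction k arbitrary: t)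
  case 0
  then show ?case using f by simp
next
  case (Suc k)
  have D: "(A k has_real_derivative A (Suc k) t) (at t)"
    using A Suc.prems by (simp add: local_chain_def)
  have ev: "eventually (\<lambda>s. (deriv ^^ k) f s = A k s) (nhds t)"
    unfolding eventually_nhds
    by (rule exI[of _ "{-R<..<R}"]) (use Suc in auto)
  have "((deriv ^^ k) f has_real_derivative A (Suc k) t) (at t)"
    using D by (simp only: DERIV_cong_ev[OF refl ev refl])
  then show ?case by (simp add: DERIV_imp_deriv)
qed

text \<open>Local chains on growing intervals are glued. Below order \<open>m\<close> they are
  determined by \<open>f\<close>; at order \<open>m\<close> they agree almost everywhere, being
  derivatives of \<open>f^(m-1)\<close> wherever these exist, and a measurable selection is made
  among them.\<close>

lemma deriv_chain_exists:
  assumes rep: "\<And>R. R > 0 \<Longrightarrow> \<exists>A. local_chain m A \<and> (\<forall>t. \<bar>t\<bar> < R \<longrightarrow> f t = A 0 t)" and m: "m \<ge> 1"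
  shows "\<exists>d. deriv_chain m d \<and> (\<forall>s<m. d s = (deriv ^^ s) f) \<and> loc_borel (d m)"
proof -
  have "\<forall>n::nat. \<exists>A. local_chain m A \<and> (\<forall>t. \<bar>t\<bar> < real (Suc n) \<longrightarrow> f t = A 0 t)"
    using rep by auto
  then obtain A where A: "\<And>n. local_chain m (A n)" "\<And>n t. \<bar>t\<bar> < real (Suc n) \<Longrightarrow> f t = A n 0 t"
    by metis
  have fA: "(deriv ^^ k) f t = A n k t" if "k < m" "\<bar>t\<bar> < real (Suc n)" for k n t
    by (rule local_chain_deriv[OF A(1) A(2)]) (use that in auto)
  have near: "eventually (\<lambda>s. (deriv ^^ k) f s = A n k s) (nhds t)" if "k < m" "\<bar>t\<bar> < real (Suc n)" for k n t
    unfolding eventually_nhds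
    by (rule exI[of _ "{- real (Suc n)<..<real (Suc n)}"]) (use that fA in auto)
  \<comment> \<open>The least index whose interval contains \<open>t\<close>; being measurable with
    values in a countable set, it keeps \<open>u\<close> Borel.\<close>
  define N where "N t = nat \<lfloor>\<bar>t\<bar>\<rfloor>" for t :: real
  have N: "\<bar>t\<bar> < real (Suc (N t))" for t unfolding N_def by linarith
  define u where "u t = A (N t) m t" for t
  define d where "d s = (if s < m then (deriv ^^ s) f else u)" for s
  have der: "(d s has_real_derivative d (Suc s) t) (at t)" if "Suc s < m" for s t
  proof -
    have "(A (N t) s has_real_derivative A (N t) (Suc s) t) (at t)"
      using A(1)[of "N t"] that by (simp add: local_chain_def)
    then have "((deriv ^^ s) f has_real_derivative A (N t) (Suc s) t) (at t)"
      using that by (simp only: DERIV_cong_ev[OF refl near[OF _ N] refl] Suc_lessD)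
    then show ?thesis using that fA[OF that N, of t] by (simp add: d_def del: funpow.simps)
  qed
  have cont: "continuous_on UNIV (d s)" if "s < m" for s
  proof -
    have "isCont (d s) t" for t
    proof -
      have "isCont (A (N t) s) t"
        using local_chain_continuous[OF A(1) that, of "N t"] by (simp add: continuous_on_eq_continuous_at)
      then show ?thesis using that isCont_cong[OF near[OF that N]] by (simp add: d_def)
    qed
    then show ?thesis by (simp add: continuous_at_imp_continuous_on)
  qed
  \<comment> \<open>At almost every \<open>t\<close> all \<open>A n (m - 1)\<close> have their
    derivatives \<open>A n m t\<close>; those with \<open>\<bar>t\<bar> < real (Suc n)\<close>
    coincide near \<open>t\<close> with \<open>f^(m-1)\<close>, and a derivative is unique.\<close>
  have "AE t in lebesgue. \<forall>n. (A n (m - 1) has_real_derivative A n m t) (at t)"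
    unfolding AE_all_countable using A(1) by (auto simp: local_chain_def intro: primitive_AE_deriv)
  then have AEu: "AE t in lborel. \<forall>n. \<bar>t\<bar> < real (Suc n) \<longrightarrow> A n m t = u t"
    unfolding AE_lborel_iff_lebesgue[symmetric]
  proof eventually_elim
    case (elim t)
    have *: "((deriv ^^ (m - 1)) f has_real_derivative A n m t) (at t)" if "\<bar>t\<bar> < real (Suc n)" for n
      using elim[rule_format, of n] m by (simp only: DERIV_cong_ev[OF refl near[OF _ that] refl])
    show ?case unfolding u_def using * N DERIV_unique by blast
  qed
  have um: "u \<in> borel_measurable borel"
    unfolding u_def[abs_def]
  proof (rule measurable_compose_countable[where f = "\<lambda>n. A n m" and g = N])
    show "A n m \<in> borel_measurable borel" for n using A(1)[of n] by (simp add: local_chain_def loc_borel_def)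
    show "N \<in> borel \<rightarrow>\<^sub>M count_space UNIV" unfolding N_def[abs_def] by measurable
  qed
  have bigN: "\<exists>n. \<bar>a\<bar> < real (Suc n) \<and> \<bar>b\<bar> < real (Suc n)" for a b :: real
  proof -
    obtain n :: nat where "max \<bar>a\<bar> \<bar>b\<bar> < real n" using reals_Archimedean2 by blast
    then show ?thesis by (intro exI[of _ n]) auto
  qed
  have loc: "loc_borel u"
    unfolding loc_borel_real_iff
  proof (intro conjI allI um)
    fix a b
    obtain n where n: "\<bar>a\<bar> < real (Suc n)" "\<bar>b\<bar> < real (Suc n)" using bigN by blast
    have i: "set_integrable lborel {a..b} (A n m)"
      using A(1)[of n] by (simp add: local_chain_def loc_borel_real_iff)
    show "set_integrable lborel {a..b} u"
      unfolding set_integrable_def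
    proof (rule integrable_cong_AE_imp[OF i[unfolded set_integrable_def]])
      show "AE t in lborel. indicator {a..b} t *\<^sub>R A n m t = indicator {a..b} t *\<^sub>R u t"
        using AEu by eventually_elim (use n in \<open>auto simp: indicator_def\<close>)
    qed (use um in measurable)
  qed
  have last: "primitive (d (m - 1)) (d m)"
    unfolding primitive_def
  proof (intro allI impI)
    fix a b :: real assume ab: "a \<le> b"
    obtain n where n: "\<bar>a\<bar> < real (Suc n)" "\<bar>b\<bar> < real (Suc n)" using bigN by blast
    have "primitive (A n (m - 1)) (A n m)" using A(1) by (simp add: local_chain_def)
    from primitiveD[OF this ab] have h: "(A n m has_integral d (m - 1) b - d (m - 1) a) {a..b}"
      using fA[of "m - 1" a n] fA[of "m - 1" b n] n m by (simp add: d_def)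
    have "negligible {t. \<not> (\<forall>n. \<bar>t\<bar> < real (Suc n) \<longrightarrow> A n m t = u t)}"
      using AEu by (simp only: AE_lborel_iff_lebesgue[symmetric] AE_lebesgue_iff_negligible)
    then show "(d m has_integral d (m - 1) b - d (m - 1) a) {a..b}"
      by (rule has_integral_spike[OF _ _ h]) (use n in \<open>auto simp: d_def\<close>)
  qed
  have "deriv_chain m d"
    unfolding deriv_chain_def
  proof (intro conjI allI impI)
    fix s assume s: "s \<le> m"
    show "d s \<in> borel_measurable borel"
      using s um cont[of s] by (cases "s < m") (auto intro: borel_measurable_continuous_onI simp: d_def)
  next
    fix s assume s: "s < m"
    show "primitive (d s) (d (Suc s))"
    proof (cases "Suc s < m")
      case True
      show ?thesis
        unfolding primitive_def
        using der[OF True] by (intro allI impI fundamental_theorem_of_calculus)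
          (auto simp: has_real_derivative_iff_has_vector_derivative[symmetric] intro: has_field_derivative_at_within)
    next
      case False
      then have "s = m - 1" "Suc s = m" using s by auto
      then show ?thesis using last by simp
    qed
  qed (rule der)
  then show ?thesis using loc by (intro exI[of _ d]) (simp add: d_def)
qed

lemma deriv_chain_continuous: "deriv_chain m d \<Longrightarrow> s < m \<Longrightarrow> continuous_on UNIV (d s)"
  unfolding deriv_chain_def by (blast intro: primitive_continuous)

lemma deriv_chain_class_C:
  assumes d: "deriv_chain m d" "\<And>s. s < m \<Longrightarrow> d s = (deriv ^^ s) f" and m: "m \<ge> 1"
  shows "class_C (m - 1) f"
  unfolding class_C_def
proof (intro conjI allI impI)
  fix s t assume "s < m - 1"
  then have s: "Suc s < m" by simp
  have "(d s has_real_derivative d (Suc s) t) (at t)" using d(1) s by (simp add: deriv_chain_def)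
  then show "(deriv ^^ s) f field_differentiable at t"
    using d(2)[of s] s by (auto simp: field_differentiable_def)
next
  show "continuous_on UNIV ((deriv ^^ (m - 1)) f)"
    using deriv_chain_continuous[OF d(1), of "m - 1"] d(2)[of "m - 1"] m by simp
qed

text \<open>From the top downwards: each link is a distributional derivative by
  \<open>primitive_borel_deriv\<close>, and prepending it lengthens the list of directions by
  one.\<close>

lemma deriv_chain_deriv_rep:
  assumes d: "deriv_chain m d" "d 0 = f" and u: "loc_borel (d m)"
  shows "deriv_rep m f m (d m)"
proof -
  have l: "loc_borel (d s)" if "s \<le> m" for s
  proof (cases "s = m")
    case False
    then show ?thesis using that
      by (intro loc_borel_continuous deriv_chain_continuous[OF d(1)]) simp
  qed (use u in simp)
  have "borel_deriv (replicate k 1) (d (m - k)) (d m)" if "k \<le> m" for k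
    using that
  proof (induction k)
    case 0
    then show ?case using u by (simp add: borel_deriv_def)
  next
    case (Suc k)
    have "primitive (d (m - Suc k)) (d (Suc (m - Suc k)))" using d(1) Suc.prems by (simp add: deriv_chain_def)
    moreover have "Suc (m - Suc k) = m - k" using Suc.prems by simp
    ultimately have "borel_deriv [1] (d (m - Suc k)) (d (m - k))"
      using l by (intro primitive_borel_deriv) auto
    moreover have "borel_deriv (replicate k 1) (d (m - k)) (d m)" using Suc by simp
    ultimately have "borel_deriv (1 # replicate k 1) (d (m - Suc k)) (d m)"
      by (rule borel_deriv_Cons) auto
    then show ?case by simp
  qed
  from this[of m] have "borel_deriv (replicate m 1) f (d m)" using d(2) by simp
  then have "distr_deriv (replicate m 1) f (d m)"
    using l[of 0] u d(2) by (subst distr_deriv_iff_borel[of f "d m"]) auto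
  then show ?thesis by (simp add: deriv_rep_def)
qed

text \<open>\<open>P\<close> assigns to every tuple an arbitrary member of the class of products in
  question; the number \<open>s\<close> of factors is implicit as the length of the tuple. Agreement
  of any two members \<open>P\<close> and \<open>Q\<close> of \<open>fdb_product\<close> expresses
  that the class is well defined, and the first two conjuncts give a meaning to the derivatives of
  \<open>f\<close> on the right side.\<close>

theorem theorem4:
  fixes m :: nat and p :: real
    and X :: "(real^'n::finite \<Rightarrow> real) set"
    and f :: "real \<Rightarrow> real"
    and \<alpha> :: "'n multi_index"
  assumes "m \<ge> 2" and "p \<ge> 1"
    and "X = adams_frazier m p \<or> X = sobolev m p"
    and "\<forall>g\<in>X. f \<circ> g \<in> X"
    and "0 < mi_abs \<alpha>" and "mi_abs \<alpha> \<le> m"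
  shows "class_C (m - 1) f \<and> (\<exists>u. deriv_rep m f m u) \<and>
    (\<forall>g\<in>X.
      (\<forall>s\<in>{1..mi_abs \<alpha>}. \<forall>\<gamma>\<in>mi_tuples \<alpha> s.
         \<forall>P\<in>fdb_product m f g \<gamma>. \<forall>Q\<in>fdb_product m f g \<gamma>. AE x in lebesgue. P x = Q x) \<and>
      (\<forall>P. (\<forall>s\<in>{1..mi_abs \<alpha>}. \<forall>\<gamma>\<in>mi_tuples \<alpha> s. P \<gamma> \<in> fdb_product m f g \<gamma>) \<longrightarrow>
         weak_deriv \<alpha> (f \<circ> g)
           (\<lambda>x. \<Sum>s=1..mi_abs \<alpha>. \<Sum>\<gamma>\<in>mi_tuples \<alpha> s. fdb_coeff \<alpha> s \<gamma> * P \<gamma> x) \<and>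
         (\<forall>h. weak_deriv \<alpha> (f \<circ> g) h \<longrightarrow>
           (AE x in lebesgue.
              h x = (\<Sum>s=1..mi_abs \<alpha>. \<Sum>\<gamma>\<in>mi_tuples \<alpha> s. fdb_coeff \<alpha> s \<gamma> * P \<gamma> x)))))"
proof -
  have m: "m \<ge> 1" and p: "p \<ge> 0" "real m * p \<ge> 0" using assms(1,2) by auto
  have \<alpha>0: "\<alpha> \<noteq> 0" using assms(5) by auto
  have XS: "X \<subseteq> sobolev m p" using assms(3) by (auto simp: adams_frazier_def)
  have XT: "g \<in> X" if "test_function g" for g
    using assms(3) test_function_in_sobolev(1)[OF that p(1), of m] test_function_in_sobolev(2)[OF that p(2)]
    by (auto simp: adams_frazier_def)
  obtain d where d: "deriv_chain m d" "\<forall>s<m. d s = (deriv ^^ s) f" "loc_borel (d m)"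
    using deriv_chain_exists[OF local_representation[OF XT XS assms(4) m] m] by blast
  have d0: "d 0 = f" using d(2) m by simp
  have dm: "deriv_rep m f m (d m)" by (rule deriv_chain_deriv_rep[OF d(1) d0 d(3)])
  have main: "(\<forall>s\<in>{1..mi_abs \<alpha>}. \<forall>\<gamma>\<in>mi_tuples \<alpha> s.
         \<forall>P\<in>fdb_product m f g \<gamma>. \<forall>Q\<in>fdb_product m f g \<gamma>. AE x in lebesgue. P x = Q x) \<and>
      (\<forall>P. (\<forall>s\<in>{1..mi_abs \<alpha>}. \<forall>\<gamma>\<in>mi_tuples \<alpha> s. P \<gamma> \<in> fdb_product m f g \<gamma>) \<longrightarrow>
         weak_deriv \<alpha> (f \<circ> g)
           (\<lambda>x. \<Sum>s=1..mi_abs \<alpha>. \<Sum>\<gamma>\<in>mi_tuples \<alpha> s. fdb_coeff \<alpha> s \<gamma> * P \<gamma> x))" if "g \<in> X" for g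
  proof -
    obtain w where w: "deriv_family m w" "AE x in lborel. g x = w 0 x"
        "\<forall>\<beta>. mi_abs \<beta> \<le> m \<longrightarrow> weak_deriv \<beta> g (w \<beta>)"
      using sobolev_deriv_family[of g m p] XS \<open>g \<in> X\<close> by blast
    obtain G where G: "deriv_family m G" "AE x in lborel. (f \<circ> g) x = G 0 x"
        "\<forall>\<beta>. mi_abs \<beta> \<le> m \<longrightarrow> weak_deriv \<beta> (f \<circ> g) (G \<beta>)"
      using sobolev_deriv_family[of "f \<circ> g" m p] XS assms(4) \<open>g \<in> X\<close> by blast
    have P: "AE x in lebesgue. P x = d s (w 0 x) * (\<Prod>r<s. w (\<gamma> ! r) x)"
      if "s \<in> {1..mi_abs \<alpha>}" "\<gamma> \<in> mi_tuples \<alpha> s" "P \<in> fdb_product m f g \<gamma>" for s \<gamma> P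
      by (rule fdb_product_AE[OF d(1) dm d(2)[rule_format] w(1,2) w(3)[rule_format] assms(6) that])
    have "AE x in lborel. G 0 x = d 0 (w 0 x)"
      using w(2) G(2) by eventually_elim (simp add: d0)
    from faa_di_bruno_AE[OF d(1) w(1) G(1) this assms(6)]
    have formula: "AE x in lebesgue. G \<alpha> x = faa_di_bruno (\<lambda>s. d s (w 0 x)) (\<lambda>\<beta>. w \<beta> x) \<alpha>"
      by (simp only: AE_lborel_iff_lebesgue)
    have wd: "weak_deriv \<alpha> (f \<circ> g) (\<lambda>x. \<Sum>s=1..mi_abs \<alpha>. \<Sum>\<gamma>\<in>mi_tuples \<alpha> s. fdb_coeff \<alpha> s \<gamma> * P \<gamma> x)"
      if Pm: "\<forall>s\<in>{1..mi_abs \<alpha>}. \<forall>\<gamma>\<in>mi_tuples \<alpha> s. P \<gamma> \<in> fdb_product m f g \<gamma>" for P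
    proof -
      have "AE x in lebesgue. \<forall>s\<in>{1..mi_abs \<alpha>}. \<forall>\<gamma>\<in>mi_tuples \<alpha> s. P \<gamma> x = d s (w 0 x) * (\<Prod>r<s. w (\<gamma> ! r) x)"
        using Pm by (intro AE_finite_allI finite_mi_tuples P) auto
      then have ae: "AE x in lebesgue. G \<alpha> x = (\<Sum>s=1..mi_abs \<alpha>. \<Sum>\<gamma>\<in>mi_tuples \<alpha> s. fdb_coeff \<alpha> s \<gamma> * P \<gamma> x)"
        using formula
        by eventually_elim (simp add: faa_di_bruno_conv_fdb_coeff[OF \<alpha>0])
      have D: "distr_deriv (mi_dirs \<alpha>) (f \<circ> g) (G \<alpha>)"
        using G(3) assms(6) by (simp add: weak_deriv_mi_dirs)
      show ?thesis
        unfolding weak_deriv_mi_dirs by (rule distr_deriv_cong[OF D _ ae mi_dirs_Basis]) simp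
    qed
    have PQ: "AE x in lebesgue. P x = Q x"
      if "s \<in> {1..mi_abs \<alpha>}" "\<gamma> \<in> mi_tuples \<alpha> s" "P \<in> fdb_product m f g \<gamma>" "Q \<in> fdb_product m f g \<gamma>" for s \<gamma> P Q
    proof -
      have "AE x in lebesgue. P x = d s (w 0 x) * (\<Prod>r<s. w (\<gamma> ! r) x)" by (rule P) (rule that)+
      moreover have "AE x in lebesgue. Q x = d s (w 0 x) * (\<Prod>r<s. w (\<gamma> ! r) x)" by (rule P) (rule that)+
      ultimately show ?thesis by eventually_elim simp
    qed
    show ?thesis by (intro conjI ballI allI impI; (rule PQ wd; assumption))
  qed
  have unique: "AE x in lebesgue. h x = h' x" if "weak_deriv \<alpha> (f \<circ> g) h" "weak_deriv \<alpha> (f \<circ> g) h'" for g h h'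
    using that unfolding weak_deriv_mi_dirs by (rule distr_deriv_unique) (rule mi_dirs_Basis)
  show ?thesis
  proof (intro conjI ballI allI impI)
    show "class_C (m - 1) f" by (rule deriv_chain_class_C[OF d(1) d(2)[rule_format] m])
    show "\<exists>u. deriv_rep m f m u" by (rule exI, rule dm)
  next
    fix g s \<gamma> P Q
    assume "g \<in> X" "s \<in> {1..mi_abs \<alpha>}" "\<gamma> \<in> mi_tuples \<alpha> s" "P \<in> fdb_product m f g \<gamma>" "Q \<in> fdb_product m f g \<gamma>"
    then show "AE x in lebesgue. P x = Q x" using main[THEN conjunct1] by blast
  next
    fix g P assume g: "g \<in> X"
      and P: "\<forall>s\<in>{1..mi_abs \<alpha>}. \<forall>\<gamma>\<in>mi_tuples \<alpha> s. P \<gamma> \<in> fdb_product m f g \<gamma>"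
    show wd: "weak_deriv \<alpha> (f \<circ> g)
        (\<lambda>x. \<Sum>s=1..mi_abs \<alpha>. \<Sum>\<gamma>\<in>mi_tuples \<alpha> s. fdb_coeff \<alpha> s \<gamma> * P \<gamma> x)"
      by (rule main[THEN conjunct2, rule_format, OF g P[rule_format]])
    fix h assume "weak_deriv \<alpha> (f \<circ> g) h"
    then show "AE x in lebesgue. h x = (\<Sum>s=1..mi_abs \<alpha>. \<Sum>\<gamma>\<in>mi_tuples \<alpha> s. fdb_coeff \<alpha> s \<gamma> * P \<gamma> x)"
      by (rule unique) (rule wd)
  qed
qed

end
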